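(* Let $q\in L_1(0,\pi)$ be real-valued and let $f,F\in\mathscr R$ with $\operatorname{ind} f+\operatorname{ind} F\ge -1$ (i.e. $f$ and $F$ are not both $\infty$). Let $\{\lambda_n,\gamma_n\}_{n\ge 0}$ be the spectral data of the problem $\mathscr P(q,f,F)$, let $(\widehat q,\widehat f,\widehat F)=\widehat{\mathbf T}(q,f,F)$, and put $$I:=\operatorname{ind} f-\operatorname{ind}\widehat f=\begin{cases}1,&\operatorname{ind} f\ge 0,\\-1,&\operatorname{ind} f=-1,\end{cases}\qquad J:=\frac{\operatorname{ind} f+\operatorname{ind} F}{2}-\frac{\operatorname{ind}\widehat f+\operatorname{ind}\widehat F}{2}=\begin{cases}1,&\operatorname{ind} f,\operatorname{ind} F\ge 0,\\0,&\text{otherwise.}\end{cases}$$ Then the spectral data of the problem $\mathscr P(\widehat q,\widehat f,\widehat F)$ is $$\left\{\lambda_n,\ \frac{\gamma_n}{(\lambda_n-\Lambda)^I}\right\}_{n\ge J},$$ where $\Lambda:=\lambda_0$ if $f,F\ne\infty$ and $\Lambda:=\lambda_0-2$ otherwise.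
   Context: $\mathscr R$ is the set consisting of the symbol $\infty$ together with all rational functions $f(\lambda)=h_0\lambda+h+\sum_{k=1}^d\frac{\delta_k}{h_k-\lambda}$ ($d\ge 0$) with real coefficients, $h_0\ge 0$, $\delta_k>0$, $h_1<\dots<h_d$. The index is $\operatorname{ind} f=2d+1$ if $h_0>0$, $\operatorname{ind} f=2d$ if $h_0=0$, and $\operatorname{ind}\infty=-1$. For $f\neq\infty$ put $f_\downarrow(\lambda)=h_0'\prod_{k=1}^d(h_k-\lambda)$ with $h_0'=1/h_0$ if $h_0>0$ and $h_0'=1$ if $h_0=0$, and $f_\uparrow=f\cdot f_\downarrow$ (a polynomial); for $f=\infty$ put $f_\uparrow=-1$, $f_\downarrow=0$. $\mathring{\pi}(f)$ denotes the smallest pole of $f$, and $\mathring\pi(f)=+\infty$ if $\operatorname{ind} f\le 1$. $\mathscr P(q,f,F)$ is the boundary value problem $-y''+q(x)y=\lambda y$ on $(0,\pi)$, $\frac{y'(0)}{y(0)}=-f(\lambda)$, $\frac{y'(\pi)}{y(\pi)}=F(\lambda)$, i.e. $f_\downarrow(\lambda)y'(0)+f_\uparrow(\lambda)y(0)=0$ and $F_\downarrow(\lambda)y'(\pi)-F_\uparrow(\lambda)y(\pi)=0$ (so $\infty$ means a Dirichlet condition). $\varphi(x,\lambda)$, $\psi(x,\lambda)$ are the solutions of the equation with $\varphi(0,\lambda)=f_\downarrow(\lambda)$, $\varphi'(0,\lambda)=-f_\uparrow(\lambda)$, $\psi(\pi,\lambda)=F_\downarrow(\lambda)$, $\psi'(\pi,\lambda)=F_\uparrow(\lambda)$.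 The eigenvalues are real and simple, numbered $\lambda_0<\lambda_1<\dots$, and for each there is a unique $\beta_n\ne0$ with $\psi(x,\lambda_n)=\beta_n\varphi(x,\lambda_n)$. The norming constants are $\gamma_n=\int_0^\pi\varphi^2(x,\lambda_n)\,dx+f'(\lambda_n)f_\downarrow^2(\lambda_n)+\frac{1}{\beta_n^2}F'(\lambda_n)F_\downarrow^2(\lambda_n)$, where $f'f_\downarrow^2$ means the polynomial $f_\uparrow'f_\downarrow-f_\uparrow f_\downarrow'$ (so it is $0$ if $f$ is constant or $\infty$), and similarly for $F$. The spectral data of the problem is $\{\lambda_n,\gamma_n\}_{n\ge0}$ (eigenvalues in increasing order with the corresponding norming constants). Transformation $\boldsymbol\Theta$: for $\mu,\tau\in\mathbb R$ and $f\in\mathscr R$ with $\mu<\mathring\pi(f)$ and $\tau\ge f(\mu)$ if $f\neq\infty$, $\boldsymbol\Theta(\mu,\tau,f)(\lambda):=\frac{\mu-\lambda}{f(\lambda)-\tau}-\tau$; if $f\equiv\tau$ this means $\infty$, and if $f=\infty$ it means the constant $-\tau$. Transformation $\widehat{\mathbf T}$: for $(q,f,F)$ as in the claim, with $\Lambda$ as in the claim, set $v(x)=\varphi(x,\Lambda)$ if $f\ne\infty$ and $v(x)=\psi(x,\Lambda)$ if $f=\infty$ ($v$ has no zeros on $[0,\pi]$). Then $\widehat{\mathbf T}(q,f,F)=(\widehat q,\widehat f,\widehat F)$ with $\widehat q=q-2\left(\frac{v'}{v}\right)'$, $\widehat f=\boldsymbol\Theta\left(\Lambda,-\frac{v'(0)}{v(0)},f\right)$,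 $\widehat F=\boldsymbol\Theta\left(\Lambda,\frac{v'(\pi)}{v(\pi)},F\right)$. This is well defined, with values in $L_1(0,\pi)\times\mathscr R\times\mathscr R$. *)

theory Defs
  imports "HOL-Analysis.Analysis" "HOL-Computational_Algebra.Computational_Algebra"
begin

section \<open>The class of boundary functions\<close>

text \<open>
  A boundary coefficient is the symbol \<open>\<infinity>\<close> or a rational function with real coefficients, i.e. an
  element of the field of fractions of the polynomial ring.
\<close>

datatype boundary_fun = Infty | Rat "real poly fract"

text \<open>
  The rational function \<open>h0 \<lambda> + h + (\<Sum>k\<in>H. \<delta> k / (k - \<lambda>))\<close>. The poles \<open>h\<^sub>1 < \<dots> < h\<^sub>d\<close> are given by the
  finite set \<open>H\<close>, and the coefficient of \<open>1 / (h\<^sub>k - \<lambda>)\<close> is \<open>\<delta> h\<^sub>k\<close>; values of \<open>\<delta>\<close> outside \<open>H\<close> are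
  irrelevant.
\<close>

definition herglotz :: "real \<Rightarrow> real \<Rightarrow> real set \<Rightarrow> (real \<Rightarrow> real) \<Rightarrow> real poly fract" where
  "herglotz h0 h H \<delta> = Fract [:h, h0:] 1 + (\<Sum>k\<in>H. Fract [:\<delta> k:] [:k, -1:])"

definition herglotz_rep :: "boundary_fun \<Rightarrow> real \<Rightarrow> real \<Rightarrow> real set \<Rightarrow> (real \<Rightarrow> real) \<Rightarrow> bool" where
  "herglotz_rep f h0 h H \<delta> \<longleftrightarrow>
     f = Rat (herglotz h0 h H \<delta>) \<and> h0 \<ge> 0 \<and> finite H \<and> (\<forall>k\<in>H. \<delta> k > 0)"

definition class_R :: "boundary_fun set" where
  "class_R = insert Infty {f. \<exists>h0 h H \<delta>. herglotz_rep f h0 h H \<delta>}"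

text \<open>
  By uniqueness of the partial fraction decomposition, \<open>h0\<close> and \<open>H\<close> are determined by the function.
\<close>

definition slope :: "boundary_fun \<Rightarrow> real" where
  "slope f = (THE h0. \<exists>h H \<delta>. herglotz_rep f h0 h H \<delta>)"

definition poles :: "boundary_fun \<Rightarrow> real set" where
  "poles f = (THE H. \<exists>h0 h \<delta>. herglotz_rep f h0 h H \<delta>)"

definition ind :: "boundary_fun \<Rightarrow> int" where
  "ind f = (if f = Infty then -1
            else if slope f > 0 then 2 * int (card (poles f)) + 1
            else 2 * int (card (poles f)))"

definition fdown :: "boundary_fun \<Rightarrow> real poly" where
  "fdown f = (if f = Infty then 0
              else smult (if slope f > 0 then 1 / slope f else 1) (\<Prod>k\<in>poles f. [:k, -1:]))"

fun fup :: "boundary_fun \<Rightarrow> real poly" where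
  "fup Infty = -1"
| "fup (Rat r) = (THE p. Fract p 1 = r * Fract (fdown (Rat r)) 1)"

section \<open>The boundary value problem\<close>

definition absolutely_continuous_on_interval ::
    "real \<Rightarrow> real \<Rightarrow> (real \<Rightarrow> 'a::real_normed_vector) \<Rightarrow> bool" where
  "absolutely_continuous_on_interval a b g \<longleftrightarrow>
     (\<forall>\<epsilon>>0. \<exists>\<delta>>0. \<forall>D :: (real \<times> real) set.
        finite D \<and> (\<forall>(c, d)\<in>D. a \<le> c \<and> c < d \<and> d \<le> b) \<and>
        pairwise (\<lambda>(c, d) (c', d'). disjnt {c<..<d} {c'<..<d'}) D \<and>
        (\<Sum>(c, d)\<in>D. d - c) < \<delta>
        \<longrightarrow> (\<Sum>(c, d)\<in>D. norm (g d - g c)) < \<epsilon>)"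

text \<open>
  \<open>y\<close> is a solution of \<open>- y'' + q y = \<lambda> y\<close> with derivative \<open>y'\<close>. As \<open>q\<close> is merely integrable, this is
  understood as usual: \<open>y'\<close> is absolutely continuous on \<open>[0, \<pi>]\<close> and the equation holds almost
  everywhere. The spectral parameter \<open>\<lambda>\<close> is written \<open>\<zeta>\<close>; the scalars are real or complex.
\<close>

definition is_solution ::
    "(real \<Rightarrow> real) \<Rightarrow> 'a \<Rightarrow> (real \<Rightarrow> 'a::real_normed_field) \<Rightarrow> (real \<Rightarrow> 'a) \<Rightarrow> bool" where
  "is_solution q \<zeta> y y' \<longleftrightarrow>
     (\<forall>x\<in>{0..pi}. (y has_vector_derivative y' x) (at x within {0..pi})) \<and>
     absolutely_continuous_on_interval 0 pi y' \<and>
     (AE x in lebesgue_on {0<..<pi}.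
        \<exists>y''. (y' has_vector_derivative y'') (at x) \<and> - y'' + of_real (q x) * y x = \<zeta> * y x)"

text \<open>Eigenvalues are sought among all complex numbers.\<close>

definition eigenvalues :: "(real \<Rightarrow> real) \<Rightarrow> boundary_fun \<Rightarrow> boundary_fun \<Rightarrow> complex set" where
  "eigenvalues q f F = {\<zeta>. \<exists>y y'. is_solution q \<zeta> y y' \<and> (\<exists>x\<in>{0..pi}. y x \<noteq> 0) \<and>
     poly (map_poly of_real (fdown f)) \<zeta> * y' 0 + poly (map_poly of_real (fup f)) \<zeta> * y 0 = 0 \<and>
     poly (map_poly of_real (fdown F)) \<zeta> * y' pi - poly (map_poly of_real (fup F)) \<zeta> * y pi = 0}"

text \<open>
  The initial value problems determine the pair of a solution and its derivative uniquely on \<open>[0, \<pi>]\<close>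
  only; the choice made outside the interval is irrelevant.
\<close>

definition phi_pair :: "(real \<Rightarrow> real) \<Rightarrow> boundary_fun \<Rightarrow> real \<Rightarrow> (real \<Rightarrow> real) \<times> (real \<Rightarrow> real)" where
  "phi_pair q f \<zeta> = (SOME (y, y'). is_solution q \<zeta> y y' \<and>
     y 0 = poly (fdown f) \<zeta> \<and> y' 0 = - poly (fup f) \<zeta>)"

definition psi_pair :: "(real \<Rightarrow> real) \<Rightarrow> boundary_fun \<Rightarrow> real \<Rightarrow> (real \<Rightarrow> real) \<times> (real \<Rightarrow> real)" where
  "psi_pair q F \<zeta> = (SOME (y, y'). is_solution q \<zeta> y y' \<and>
     y pi = poly (fdown F) \<zeta> \<and> y' pi = poly (fup F) \<zeta>)"

definition phi :: "(real \<Rightarrow> real) \<Rightarrow> boundary_fun \<Rightarrow> real \<Rightarrow> real \<Rightarrow> real" where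
  "phi q f \<zeta> = fst (phi_pair q f \<zeta>)"

definition psi :: "(real \<Rightarrow> real) \<Rightarrow> boundary_fun \<Rightarrow> real \<Rightarrow> real \<Rightarrow> real" where
  "psi q F \<zeta> = fst (psi_pair q F \<zeta>)"

definition beta :: "(real \<Rightarrow> real) \<Rightarrow> boundary_fun \<Rightarrow> boundary_fun \<Rightarrow> real \<Rightarrow> real" where
  "beta q f F \<zeta> = (THE b. b \<noteq> 0 \<and> (\<forall>x\<in>{0..pi}. psi q F \<zeta> x = b * phi q f \<zeta> x))"

text \<open>The polynomial \<open>f' f\<^sub>\<down>\<^sup>2\<close>.\<close>

definition deriv_down_sq :: "boundary_fun \<Rightarrow> real poly" where
  "deriv_down_sq f = pderiv (fup f) * fdown f - fup f * pderiv (fdown f)"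

definition norming_const :: "(real \<Rightarrow> real) \<Rightarrow> boundary_fun \<Rightarrow> boundary_fun \<Rightarrow> real \<Rightarrow> real" where
  "norming_const q f F \<zeta> =
     integral {0..pi} (\<lambda>x. (phi q f \<zeta> x)\<^sup>2) + poly (deriv_down_sq f) \<zeta>
     + 1 / (beta q f F \<zeta>)\<^sup>2 * poly (deriv_down_sq F) \<zeta>"

definition spectral_data ::
    "(real \<Rightarrow> real) \<Rightarrow> boundary_fun \<Rightarrow> boundary_fun \<Rightarrow> (nat \<Rightarrow> real) \<Rightarrow> (nat \<Rightarrow> real) \<Rightarrow> bool" where
  "spectral_data q f F lam gam \<longleftrightarrow>
     strict_mono lam \<and> range (\<lambda>n. complex_of_real (lam n)) = eigenvalues q f F \<and>
     (\<forall>n. gam n = norming_const q f F (lam n))"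

section \<open>The transformations\<close>

text \<open>
  The formula is used without the conditions on \<open>\<mu>\<close> and \<open>\<tau>\<close> which ensure that the result lies in
  \<^const>\<open>class_R\<close>.
\<close>

fun Theta :: "real \<Rightarrow> real \<Rightarrow> boundary_fun \<Rightarrow> boundary_fun" where
  "Theta \<mu> \<tau> Infty = Rat (Fract [:-\<tau>:] 1)"
| "Theta \<mu> \<tau> (Rat r) =
     (if r = Fract [:\<tau>:] 1 then Infty
      else Rat (Fract [:\<mu>, -1:] 1 / (r - Fract [:\<tau>:] 1) - Fract [:\<tau>:] 1))"

text \<open>
  \<open>v' / v\<close> is absolutely continuous on \<open>[0, \<pi>]\<close>, so that \<open>deriv\<close> below is its derivative for almost
  every \<open>x\<close>; the values on the exceptional null set are irrelevant.
\<close>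

definition T_hat :: "real \<Rightarrow> (real \<Rightarrow> real) \<times> boundary_fun \<times> boundary_fun
    \<Rightarrow> (real \<Rightarrow> real) \<times> boundary_fun \<times> boundary_fun" where
  "T_hat \<Lambda> = (\<lambda>(q, f, F).
     let (v, v') = (if f = Infty then psi_pair q F \<Lambda> else phi_pair q f \<Lambda>)
     in (\<lambda>x. q x - 2 * deriv (\<lambda>t. v' t / v t) x,
         Theta \<Lambda> (- v' 0 / v 0) f,
         Theta \<Lambda> (v' pi / v pi) F))"

end

theory Submission
  imports Defs
begin

text \<open>
  Put \<open>w = v' / v\<close>. The map \<open>y \<mapsto> y' - w y\<close> takes solutions of the equation with potential \<open>q\<close> to
  solutions with potential \<open>q - 2 w'\<close> and is inverted, up to the factor \<open>\<Lambda> - \<lambda>\<close>, by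
  \<open>z \<mapsto> z' + w z\<close>. Writing \<open>\<tau> = - w(0)\<close>, which equals \<open>f(\<Lambda>)\<close> if \<open>f\<close> is finite, the
  polynomials of the transformed boundary function \<open>g\<close> satisfy
  \<open>f\<^sub>\<up> - \<tau> f\<^sub>\<down> = (\<lambda> - \<Lambda>) g\<^sub>\<down>\<close> and \<open>g\<^sub>\<up> = - f\<^sub>\<down> - \<tau> g\<^sub>\<down>\<close>, so that the boundary conditions
  correspond to each other, and the norming constants are compared by integrating
  \<open>(y z)' = z\<^sup>2 - (\<lambda> - \<Lambda>) y\<^sup>2\<close> for \<open>z = y' - w y\<close>. That \<open>\<Lambda>\<close> is below all poles and that \<open>v\<close> has
  no zeros follows by moving \<open>\<lambda>\<close> up from \<open>- \<infinity>\<close>: the first \<open>\<lambda>\<close> at which this fails lies above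
  a zero of the characteristic function.
\<close>

section \<open>Absolutely continuous functions\<close>

text \<open>As \<open>q\<close> is only integrable, \<open>y''\<close> and \<open>w'\<close> exist
  merely almost everywhere. Absolute continuity makes identities between them conclusive: an
  absolutely continuous function is the integral of its derivative, so a continuous almost
  everywhere derivative is a derivative everywhere. The classical arguments are run on a
  quasi-derivative that involves only a primitive of \<open>q\<close>. The two choices of \<Lambda>
  have different effects. If both boundary functions are finite, \<open>v\<close> at
  \<open>lam 0\<close> is an eigenfunction; it is mapped to 0, and this eigenvalue disappears. At a
  Dirichlet end an eigenfunction vanishes and cannot serve as a denominator, so \<Lambda> has to lie
  strictly below \<open>lam 0\<close>; then \<open>v\<close> meets only one boundary condition and
  no eigenvalue is lost. The 2 is a convenient positive gap. Away from \<Lambda> the map between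
  eigenfunctions can be inverted. At \<Lambda> the factor in the inverse vanishes, and a separate
  sign argument has to exclude \<Lambda> as a new eigenvalue; it rests on the positivity of the
  coefficients in the boundary functions. Claims about the right end are reduced to the left end by
  the reflection of the interval.\<close>

abbreviation ac :: "real \<Rightarrow> real \<Rightarrow> (real \<Rightarrow> 'a::real_normed_vector) \<Rightarrow> bool" where
  "ac \<equiv> absolutely_continuous_on_interval"

abbreviation short_intervals :: "real \<Rightarrow> real \<Rightarrow> real \<Rightarrow> (real \<times> real) set \<Rightarrow> bool" where
  "short_intervals a b \<delta> D \<equiv> finite D \<and> (\<forall>(c, d)\<in>D. a \<le> c \<and> c < d \<and> d \<le> b) \<and>
    pairwise (\<lambda>(c, d) (c', d'). disjnt {c<..<d} {c'<..<d'}) D \<and> (\<Sum>(c, d)\<in>D. d - c) < \<delta>"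

text \<open>Most closure properties below reduce to this: the increments of a sum, product,
  reciprocal or linear image are bounded by a constant times the increments of the
  ingredients.\<close>

lemma ac_dominated:
  assumes g: "ac a b g" and h: "ac a b h"
    and le: "\<And>c d. a \<le> c \<Longrightarrow> c < d \<Longrightarrow> d \<le> b \<Longrightarrow>
      norm (k d - k c) \<le> C * (norm (g d - g c) + norm (h d - h c))"
  shows "ac a b k"
  unfolding absolutely_continuous_on_interval_def
proof (intro allI impI)
  fix e :: real assume "e > 0"
  \<comment> \<open>\<open>\<bar>C\<bar> + 1\<close> keeps the denominator positive whatever the
    sign of \<open>C\<close>; the 2 splits the error between \<open>g\<close> and
    \<open>h\<close>.\<close>
  define e1 where "e1 = e / (2 * (\<bar>C\<bar> + 1))"
  have "e1 > 0" using \<open>e > 0\<close> by (simp add: e1_def add_nonneg_pos)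
  obtain d1 where d1: "d1 > 0" "\<And>D. short_intervals a b d1 D \<Longrightarrow> (\<Sum>(c, d)\<in>D. norm (g d - g c)) < e1"
    using g \<open>e1 > 0\<close> unfolding absolutely_continuous_on_interval_def by meson
  obtain d2 where d2: "d2 > 0" "\<And>D. short_intervals a b d2 D \<Longrightarrow> (\<Sum>(c, d)\<in>D. norm (h d - h c)) < e1"
    using h \<open>e1 > 0\<close> unfolding absolutely_continuous_on_interval_def by meson
  show "\<exists>\<delta>>0. \<forall>D. short_intervals a b \<delta> D \<longrightarrow> (\<Sum>(c, d)\<in>D. norm (k d - k c)) < e"
  proof (intro exI[of _ "min d1 d2"] conjI allI impI)
    show "0 < min d1 d2" using d1 d2 by simp
    fix D :: "(real \<times> real) set"
    assume D: "short_intervals a b (min d1 d2) D"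
    have 1: "(\<Sum>(c, d)\<in>D. norm (g d - g c)) < e1" using D by (intro d1(2)) simp
    have 2: "(\<Sum>(c, d)\<in>D. norm (h d - h c)) < e1" using D by (intro d2(2)) simp
    have "(\<Sum>(c, d)\<in>D. norm (k d - k c))
        \<le> (\<Sum>(c, d)\<in>D. (\<bar>C\<bar> + 1) * (norm (g d - g c) + norm (h d - h c)))"
    proof (intro sum_mono, clarify)
      fix c d assume "(c, d) \<in> D"
      then have "norm (k d - k c) \<le> C * (norm (g d - g c) + norm (h d - h c))"
        using D by (intro le) auto
      also have "\<dots> \<le> (\<bar>C\<bar> + 1) * (norm (g d - g c) + norm (h d - h c))"
        by (intro mult_right_mono) auto
      finally show "norm (k d - k c) \<le> (\<bar>C\<bar> + 1) * (norm (g d - g c) + norm (h d - h c))" .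
    qed
    also have "\<dots> = (\<bar>C\<bar> + 1) * ((\<Sum>(c, d)\<in>D. norm (g d - g c)) + (\<Sum>(c, d)\<in>D. norm (h d - h c)))"
      by (simp add: sum.distrib sum_distrib_left split_def distrib_left)
    also have "\<dots> < (\<bar>C\<bar> + 1) * (e1 + e1)"
      by (intro mult_strict_left_mono add_strict_mono 1 2) simp
    also have "\<dots> = e" using abs_ge_zero[of C] by (simp only: e1_def) (simp add: divide_simps)
    finally show "(\<Sum>(c, d)\<in>D. norm (k d - k c)) < e" .
  qed
qed

lemma ac_ident: "ac a b (\<lambda>x. x)"
  unfolding absolutely_continuous_on_interval_def
proof (intro allI impI)
  fix e :: real assume e: "e > 0"
  show "\<exists>\<delta>>0. \<forall>D. short_intervals a b \<delta> D \<longrightarrow> (\<Sum>(c, d)\<in>D. norm (d - c)) < e"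
  proof (intro exI[of _ e] conjI allI impI e)
    fix D :: "(real \<times> real) set"
    assume D: "short_intervals a b e D"
    have "(\<Sum>(c, d)\<in>D. norm (d - c)) = (\<Sum>(c, d)\<in>D. d - c)"
      using D by (intro sum.cong) auto
    then show "(\<Sum>(c, d)\<in>D. norm (d - c)) < e" using D by simp
  qed
qed

lemma ac_lipschitz:
  assumes "\<And>c d. a \<le> c \<Longrightarrow> c < d \<Longrightarrow> d \<le> b \<Longrightarrow> norm (k d - k c) \<le> C * (d - c)"
  shows "ac a b k"
proof (rule ac_dominated[OF ac_ident ac_ident, of a b k "C/2"])
  fix c d assume "a \<le> c" "c < d" "d \<le> b"
  with assms[of c d]
  show "norm (k d - k c) \<le> C / 2 * (norm (d - c) + norm (d - c))" by (simp add: algebra_simps)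
qed

lemma ac_continuous_on:
  assumes "ac a b g" shows "continuous_on {a..b} g"
  unfolding continuous_on_iff
proof (intro ballI allI impI)
  fix x e :: real assume x: "x \<in> {a..b}" and "e > 0"
  then obtain d where d: "d > 0" "\<And>D. short_intervals a b d D \<Longrightarrow> (\<Sum>(c, d)\<in>D. norm (g d - g c)) < e"
    using assms unfolding absolutely_continuous_on_interval_def by meson
  show "\<exists>d>0. \<forall>x'\<in>{a..b}. dist x' x < d \<longrightarrow> dist (g x') (g x) < e"
  proof (intro exI[of _ d] conjI ballI impI d)
    fix y assume y: "y \<in> {a..b}" "dist y x < d"
    consider "x = y" | "x < y" | "y < x" by linarith
    then show "dist (g y) (g x) < e"
    proof cases
      case 1 then show ?thesis using \<open>e > 0\<close> by simp
    next
      case 2 then show ?thesis using d(2)[of "{(x, y)}"] x y by (simp add: dist_norm)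
    next
      case 3 then show ?thesis using d(2)[of "{(y, x)}"] x y
        by (simp add: dist_norm norm_minus_commute)
    qed
  qed
qed

lemma ac_mono:
  assumes "ac a b g" "a \<le> a'" "b' \<le> b" shows "ac a' b' g"
  unfolding absolutely_continuous_on_interval_def
proof (intro allI impI)
  fix e :: real assume "e > 0"
  then obtain d where d: "d > 0" "\<And>D. short_intervals a b d D \<Longrightarrow> (\<Sum>(c, d)\<in>D. norm (g d - g c)) < e"
    using assms(1) unfolding absolutely_continuous_on_interval_def by meson
  show "\<exists>\<delta>>0. \<forall>D. short_intervals a' b' \<delta> D \<longrightarrow> (\<Sum>(c, d)\<in>D. norm (g d - g c)) < e"
    by (intro exI[of _ d] conjI allI impI d) (use assms in fastforce)+
qed

lemma ac_add: "ac a b g \<Longrightarrow> ac a b h \<Longrightarrow> ac a b (\<lambda>x. g x + h x)"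
  by (erule ac_dominated[where C = 1], assumption)
    (smt (verit, ccfv_SIG) add_diff_add mult_1 norm_triangle_ineq)

lemma ac_minus: "ac a b g \<Longrightarrow> ac a b (\<lambda>x. - g x)"
  by (rule ac_dominated[where C = 1 and g = g and h = g])
    (auto simp: norm_minus_commute)

lemma ac_diff: "ac a b g \<Longrightarrow> ac a b h \<Longrightarrow> ac a b (\<lambda>x. g x - h x)"
  using ac_add[OF _ ac_minus] by force

lemma ac_const: "ac a b (\<lambda>x. c)"
  by (rule ac_lipschitz[where C = 0]) simp

lemma ac_of_real: "ac a b g \<Longrightarrow> ac a b (\<lambda>x. of_real (g x) :: 'a :: real_normed_algebra_1)"
  by (rule ac_dominated[where C = 1 and g = g and h = g])
    (auto simp flip: of_real_diff)

lemma continuous_on_interval_bounded: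
  fixes g :: "real \<Rightarrow> 'a :: real_normed_vector"
  assumes "continuous_on {a..b} g"
  obtains B where "B > 0" "\<And>x. x \<in> {a..b} \<Longrightarrow> norm (g x) \<le> B"
proof -
  have "bounded (g ` {a..b})"
    by (intro compact_imp_bounded compact_continuous_image assms) simp
  then show thesis using that unfolding bounded_pos by auto
qed

lemma ac_mult:
  fixes g h :: "real \<Rightarrow> 'a :: real_normed_algebra"
  assumes g: "ac a b g" and h: "ac a b h"
  shows "ac a b (\<lambda>x. g x * h x)"
proof -
  obtain B where B: "B > 0" "\<And>x. x \<in> {a..b} \<Longrightarrow> norm (g x) \<le> B"
    using continuous_on_interval_bounded[OF ac_continuous_on[OF g]] by blast
  obtain E where E: "E > 0" "\<And>x. x \<in> {a..b} \<Longrightarrow> norm (h x) \<le> E"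
    using continuous_on_interval_bounded[OF ac_continuous_on[OF h]] by blast
  show ?thesis
  proof (rule ac_dominated[OF g h, of _ "max B E"])
    fix c d assume cd: "a \<le> c" "c < d" "d \<le> b"
    have "g d * h d - g c * h c = g d * (h d - h c) + (g d - g c) * h c"
      by (simp add: algebra_simps)
    then have "norm (g d * h d - g c * h c) \<le> norm (g d) * norm (h d - h c) + norm (g d - g c) * norm (h c)"
      by (smt (verit) norm_mult_ineq norm_triangle_ineq)
    also have "\<dots> \<le> max B E * norm (h d - h c) + norm (g d - g c) * max B E"
      using B(2)[of d] E(2)[of c] cd by (intro add_mono mult_right_mono mult_left_mono) auto
    finally show "norm (g d * h d - g c * h c) \<le> max B E * (norm (g d - g c) + norm (h d - h c))"
      by (simp add: algebra_simps)
  qed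
qed

lemma ac_inverse:
  fixes g :: "real \<Rightarrow> 'a :: real_normed_field"
  assumes g: "ac a b g" and nz: "\<And>x. x \<in> {a..b} \<Longrightarrow> g x \<noteq> 0"
  shows "ac a b (\<lambda>x. inverse (g x))"
proof -
  have "continuous_on {a..b} (\<lambda>x. inverse (g x))"
    using ac_continuous_on[OF g] nz by (intro continuous_intros) auto
  then obtain B where B: "B > 0" "\<And>x. x \<in> {a..b} \<Longrightarrow> norm (inverse (g x)) \<le> B"
    using continuous_on_interval_bounded by blast
  show ?thesis
  proof (rule ac_dominated[OF g g, of _ "B * B"])
    fix c d assume cd: "a \<le> c" "c < d" "d \<le> b"
    have "norm (inverse (g d) - inverse (g c))
      = norm (inverse (g d)) * norm (g d - g c) * norm (inverse (g c))"
      using nz cd by (subst inverse_diff_inverse) (auto simp: norm_mult)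
    also have "\<dots> \<le> B * norm (g d - g c) * B"
      using B(2)[of d] B(2)[of c] cd B(1) by (intro mult_mono) auto
    also have "\<dots> \<le> B * B * (norm (g d - g c) + norm (g d - g c))"
      using B(1) by (simp add: algebra_simps)
    finally show "norm (inverse (g d) - inverse (g c)) \<le> B * B * (norm (g d - g c) + norm (g d - g c))" .
  qed
qed

lemma ac_divide:
  fixes g h :: "real \<Rightarrow> 'a :: real_normed_field"
  assumes "ac a b g" "ac a b h" "\<And>x. x \<in> {a..b} \<Longrightarrow> h x \<noteq> 0"
  shows "ac a b (\<lambda>x. g x / h x)"
  unfolding divide_inverse by (intro ac_mult ac_inverse assms)

lemma ac_C1:
  assumes "\<And>x. x \<in> {a..b} \<Longrightarrow> (g has_vector_derivative g' x) (at x within {a..b})"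
    and "continuous_on {a..b} g'"
  shows "ac a b g"
proof -
  obtain B where B: "B > 0" "\<And>x. x \<in> {a..b} \<Longrightarrow> norm (g' x) \<le> B"
    using continuous_on_interval_bounded[OF assms(2)] by blast
  show ?thesis
  proof (rule ac_lipschitz)
    fix c d assume cd: "a \<le> c" "c < d" "d \<le> b"
    have "norm (g d - g c) \<le> B * norm (d - c)"
    proof (rule differentiable_bound[of "{a..b}" g "\<lambda>x h. h *\<^sub>R g' x"])
      fix x assume x: "x \<in> {a..b}"
      show "(g has_derivative (\<lambda>h. h *\<^sub>R g' x)) (at x within {a..b})"
        using assms(1)[OF x] by (simp add: has_vector_derivative_def)
      show "onorm (\<lambda>h. h *\<^sub>R g' x) \<le> B"
        by (rule onorm_le) (use B(2)[OF x] in \<open>simp add: mult.commute[of B] mult_left_mono\<close>)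
    qed (use cd in auto)
    then show "norm (g d - g c) \<le> B * (d - c)" using cd by simp
  qed
qed

text \<open>A gauge argument. Intervals with tag off \<open>N\<close> obey the derivative estimate.
  Those tagged in \<open>N\<close> are forced into an open set of measure below \<delta>, where
  absolute continuity makes the sum of the increments of \<open>g\<close> small.\<close>

lemma ac_fundamental_theorem_of_calculus:
  fixes g :: "real \<Rightarrow> 'a :: banach"
  assumes ab: "a \<le> b" and ac: "ac a b g" and N: "negligible N"
    and der: "\<And>x. x \<in> {a..b} - N \<Longrightarrow> (g has_vector_derivative g' x) (at x within {a..b})"
  shows "(g' has_integral (g b - g a)) {a..b}"
proof -
  \<comment> \<open>With the value 0 on \<open>N\<close> the Riemann terms tagged in
    \<open>N\<close> vanish, and only increments of \<open>g\<close> are left to estimate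
    there.\<close>
  define f' where "f' = (\<lambda>x. if x \<in> N then 0 else g' x)"
  have "(f' has_integral (g b - g a)) {a..b}"
    unfolding has_integral_real
  proof (intro allI impI)
    fix e :: real assume "e > 0"
    \<comment> \<open>The summand 1 keeps \<open>e1 * (b - a)\<close> strictly below
      \<open>e / 2\<close>, also when \<open>a = b\<close>.\<close>
    define e1 where "e1 = e / (2 * (b - a + 1))"
    have "e1 > 0" using \<open>e > 0\<close> ab by (simp add: e1_def)
    have "\<exists>d>0. x \<in> {a..b} - N \<longrightarrow>
         (\<forall>y\<in>{a..b}. norm (y-x) < d \<longrightarrow> norm (g y - g x - (y-x) *\<^sub>R g' x) \<le> e1 * norm (y-x))" for x
    proof (cases "x \<in> {a..b} - N")
      case True
      show ?thesis
        using der[OF True] \<open>e1 > 0\<close> unfolding has_vector_derivative_def has_derivative_within_alt by blast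
    next
      case False
      then show ?thesis by (intro exI[of _ 1] conjI impI) auto
    qed
    then have "\<forall>x. \<exists>d>0. x \<in> {a..b} - N \<longrightarrow>
         (\<forall>y\<in>{a..b}. norm (y-x) < d \<longrightarrow> norm (g y - g x - (y-x) *\<^sub>R g' x) \<le> e1 * norm (y-x))" ..
    from choice[OF this] obtain d where d: "\<And>x. d x > 0" "\<And>x y. x \<in> {a..b} - N \<Longrightarrow> y \<in> {a..b} \<Longrightarrow> norm (y-x) < d x \<Longrightarrow>
         norm (g y - g x - (y-x) *\<^sub>R g' x) \<le> e1 * norm (y-x)" by blast
    have "e / 2 > 0" using \<open>e > 0\<close> by simp
    obtain \<delta> where \<delta>: "\<delta> > 0" "\<And>D. short_intervals a b \<delta> D \<Longrightarrow> (\<Sum>(c, d)\<in>D. norm (g d - g c)) < e / 2"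
      using ac \<open>e / 2 > 0\<close> unfolding absolutely_continuous_on_interval_def by meson
    have NS: "N \<in> sets lebesgue" using N by (simp add: negligible_imp_sets)
    obtain T where T: "open T" "N \<subseteq> T" "(T - N) \<in> lmeasurable" "emeasure lebesgue (T - N) < ennreal \<delta>"
      using sets_lebesgue_outer_open[OF NS \<delta>(1)] by blast
    have Nn: "N \<in> null_sets lebesgue" using N by (simp add: negligible_iff_null_sets)
    have TS: "T \<in> sets lebesgue" using T(1) by auto
    have "emeasure lebesgue T = emeasure lebesgue (T - N)"
      using emeasure_Diff_null_set[OF Nn TS] by simp
    then have emT: "emeasure lebesgue T < ennreal \<delta>" using T(4) by simp
    then have TL: "T \<in> lmeasurable" using TS by (intro fmeasurableI) (auto intro: less_le_trans)
    have mT: "measure lebesgue T < \<delta>"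
      using emT \<delta>(1) TL by (simp add: emeasure_eq_measure2 ennreal_less_iff)
    define \<gamma> where "\<gamma> = (\<lambda>x. if x \<in> N then T else ball x (d x))"
    show "\<exists>\<gamma>. gauge \<gamma> \<and> (\<forall>\<D>. \<D> tagged_division_of {a..b} \<and> \<gamma> fine \<D> \<longrightarrow>
        norm ((\<Sum>(x, k)\<in>\<D>. measure lborel k *\<^sub>R f' x) - (g b - g a)) < e)"
    proof (intro exI[of _ \<gamma>] conjI allI impI)
      show "gauge \<gamma>" using T d(1) by (auto simp: \<gamma>_def gauge_def)
      fix p assume p: "p tagged_division_of {a..b} \<and> \<gamma> fine p"
      note pd = tagged_division_ofD[OF conjunct1[OF p]]
      have pk: "k = {Inf k..Sup k} \<and> Inf k \<le> x \<and> x \<le> Sup k \<and> a \<le> Inf k \<and> Sup k \<le> b \<and>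
          measure lborel k = Sup k - Inf k \<and> k \<subseteq> \<gamma> x" if xk: "(x, k) \<in> p" for x k
      proof -
        obtain u v where k: "k = cbox u v" using pd(4)[OF xk] by blast
        have "x \<in> k" "k \<subseteq> {a..b}" using pd(2,3)[OF xk] by blast+
        then show ?thesis using k p xk by (auto simp: fine_def)
      qed
      define P1 where "P1 = {z \<in> p. fst z \<notin> N}"
      define P2 where "P2 = {z \<in> p. fst z \<in> N \<and> Inf (snd z) < Sup (snd z)}"
      \<comment> \<open>Degenerate intervals are split off because absolute continuity speaks only
        of \<open>c < d\<close>; they contribute nothing.\<close>
      define P3 where "P3 = {z \<in> p. fst z \<in> N \<and> \<not> Inf (snd z) < Sup (snd z)}"
      define E where "E = (\<lambda>z. measure lborel (snd z) *\<^sub>R f' (fst z) - (g (Sup (snd z)) - g (Inf (snd z))))"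
      have fin: "finite p" by (rule pd(1))
      have eq: "(\<Sum>(x, k)\<in>p. measure lborel k *\<^sub>R f' x) - (g b - g a) = sum E p"
        using additive_tagged_division_1[OF ab conjunct1[OF p], of g]
        by (simp add: E_def split_def sum_subtractf)
      have sp: "p = P1 \<union> (P2 \<union> P3)" by (auto simp: P1_def P2_def P3_def)
      have sm: "(\<Sum>z\<in>p. norm (E z)) = (\<Sum>z\<in>P1. norm (E z)) + ((\<Sum>z\<in>P2. norm (E z)) + (\<Sum>z\<in>P3. norm (E z)))"
      proof -
        have f: "finite P1" "finite P2" "finite P3" using fin by (auto simp: P1_def P2_def P3_def)
        have d: "P1 \<inter> (P2 \<union> P3) = {}" "P2 \<inter> P3 = {}" by (auto simp: P1_def P2_def P3_def)
        show ?thesis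
          unfolding sp sum.union_disjoint[OF f(1) finite_UnI[OF f(2,3)] d(1)] sum.union_disjoint[OF f(2,3) d(2)] ..
      qed
      have 3: "(\<Sum>z\<in>P3. norm (E z)) = 0"
      proof (intro sum.neutral ballI)
        fix z assume z: "z \<in> P3"
        then have "Inf (snd z) = Sup (snd z)" using pk[of "fst z" "snd z"] by (auto simp: P3_def)
        then show "norm (E z) = 0" using z by (simp add: E_def P3_def f'_def)
      qed
      have "(\<Sum>z\<in>P1. norm (E z)) \<le> (\<Sum>z\<in>P1. e1 * measure lborel (snd z))"
      proof (intro sum_mono)
        fix z assume z: "z \<in> P1"
        obtain x k where zx: "z = (x, k)" by fastforce
        have xk: "(x, k) \<in> p" "x \<notin> N" using z by (auto simp: P1_def zx)
        let ?u = "Inf k" and ?v = "Sup k"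
        note q = pk[OF xk(1)]
        have xab: "x \<in> {a..b} - N" using q xk by auto
        have kb: "{?u..?v} \<subseteq> ball x (d x)" using q xk by (auto simp: \<gamma>_def)
        have uv: "?u \<le> ?v" using q by linarith
        have u: "?u \<in> ball x (d x)" "?v \<in> ball x (d x)"
          using subsetD[OF kb, of ?u] subsetD[OF kb, of ?v] uv by (simp_all del: mem_ball)
        have 1: "norm (g ?u - g x - (?u-x) *\<^sub>R g' x) \<le> e1 * norm (?u-x)"
          using u q by (intro d(2)[OF xab]) (auto simp: dist_norm abs_minus_commute)
        have 2: "norm (g ?v - g x - (?v-x) *\<^sub>R g' x) \<le> e1 * norm (?v-x)"
          using u q by (intro d(2)[OF xab]) (auto simp: dist_norm abs_minus_commute)
        have "E z = (g ?u - g x - (?u-x) *\<^sub>R g' x) - (g ?v - g x - (?v-x) *\<^sub>R g' x)"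
        proof -
          have "measure lborel k = ?v - ?u" using q by blast
          then have "E z = (?v - ?u) *\<^sub>R g' x - (g ?v - g ?u)" using xk(2) by (simp add: E_def zx f'_def)
          then show ?thesis by (simp add: algebra_simps)
        qed
        then have "norm (E z) \<le> e1 * norm (?u-x) + e1 * norm (?v-x)"
          using norm_triangle_ineq4 1 2 by (metis add_mono order_trans)
        also have "\<dots> = e1 * (?v - ?u)"
        proof -
          have "norm (?u - x) = x - ?u" "norm (?v - x) = ?v - x" using q by auto
          then show ?thesis by (simp only:) (simp add: algebra_simps)
        qed
        also have "\<dots> = e1 * measure lborel (snd z)"
        proof -
          have "measure lborel k = ?v - ?u" using q by blast
          then show ?thesis by (simp add: zx)
        qed
        finally show "norm (E z) \<le> e1 * measure lborel (snd z)" .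
      qed
      also have "\<dots> \<le> (\<Sum>z\<in>p. e1 * measure lborel (snd z))"
        using fin \<open>e1 > 0\<close> by (intro sum_mono2) (auto simp: P1_def)
      also have "\<dots> = e1 * (b - a)"
        using additive_content_tagged_division[of p a b] p ab
        by (simp add: sum_distrib_left[symmetric] split_def)
      also have "\<dots> < e / 2" using ab \<open>e > 0\<close> by (simp add: e1_def field_simps)
      finally have 1: "(\<Sum>z\<in>P1. norm (E z)) < e / 2" .
      define D where "D = (\<lambda>z. (Inf (snd z), Sup (snd z))) ` P2"
      have pw: "disjnt {Inf k<..<Sup k} {Inf k'<..<Sup k'}"
        if "(x, k) \<in> p" "(x', k') \<in> p" "(x, k) \<noteq> (x', k')" for x k x' k'
      proof -
        have "interior k \<inter> interior k' = {}" using pd(5)[OF that(1,2)] that(3) by blast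
        moreover have "interior k = {Inf k<..<Sup k}" using pk[OF that(1)] interior_atLeastAtMost_real by metis
        moreover have "interior k' = {Inf k'<..<Sup k'}" using pk[OF that(2)] interior_atLeastAtMost_real by metis
        ultimately show ?thesis by (simp add: disjnt_def)
      qed
      \<comment> \<open>Two members of \<open>P2\<close> with equal endpoints would have disjoint
        nonempty interiors, so nothing is lost in passing from tagged intervals to pairs of
        endpoints.\<close>
      have inj: "inj_on (\<lambda>z. (Inf (snd z), Sup (snd z))) P2"
      proof (rule inj_onI, rule ccontr)
        fix z z' assume z: "z \<in> P2" "z' \<in> P2" "(Inf (snd z), Sup (snd z)) = (Inf (snd z'), Sup (snd z'))" "z \<noteq> z'"
        then have "disjnt {Inf (snd z)<..<Sup (snd z)} {Inf (snd z')<..<Sup (snd z')}"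
          using pw[of "fst z" "snd z" "fst z'" "snd z'"] by (auto simp: P2_def)
        then show False using z by (auto simp: P2_def disjnt_def)
      qed
      have Dp: "\<forall>(c, d)\<in>D. a \<le> c \<and> c < d \<and> d \<le> b"
        using pk by (fastforce simp: D_def P2_def)
      have finD: "finite D" using fin by (simp add: D_def P2_def)
      have Ddis: "pairwise (\<lambda>(c, d) (c', d'). disjnt {c<..<d} {c'<..<d'}) D"
        unfolding pairwise_def
      proof (intro ballI impI)
        fix z z' assume "z \<in> D" "z' \<in> D" "z \<noteq> z'"
        then obtain y y' where y: "y \<in> P2" "y' \<in> P2" "y \<noteq> y'" "z = (Inf (snd y), Sup (snd y))"
          "z' = (Inf (snd y'), Sup (snd y'))" unfolding D_def by blast
        then have "disjnt {Inf (snd y)<..<Sup (snd y)} {Inf (snd y')<..<Sup (snd y')}"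
          using pw[of "fst y" "snd y" "fst y'" "snd y'"] by (auto simp: P2_def)
        then show "(case z of (c, d) \<Rightarrow> \<lambda>(c', d'). disjnt {c<..<d} {c'<..<d'}) z'"
          using y(4,5) by simp
      qed
      have "(\<Sum>(c, d)\<in>D. d - c) = (\<Sum>z\<in>D. measure lebesgue {fst z<..<snd z})"
        using Dp by (intro sum.cong) auto
      also have "\<dots> = measure lebesgue (\<Union>z\<in>D. {fst z<..<snd z})"
        proof (rule measure_finite_Union[symmetric])
        show "emeasure lebesgue {fst z<..<snd z} \<noteq> \<infinity>" if z: "z \<in> D" for z
        proof -
          have "fst z \<le> snd z" using Dp z by auto
          then show ?thesis by simp
        qed
      qed (use finD Ddis in \<open>auto simp: disjoint_family_on_def pairwise_def disjnt_def split_def\<close>)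
      also have "\<dots> \<le> measure lebesgue T"
      proof (rule measure_mono_fmeasurable)
        show "(\<Union>z\<in>D. {fst z<..<snd z}) \<subseteq> T"
        proof clarsimp
          fix c d t assume "(c, d) \<in> D" and t: "c < t" "t < d"
          then obtain x k where xk: "(x, k) \<in> p" "x \<in> N" "c = Inf k" "d = Sup k" by (auto simp: D_def P2_def)
          then have "k = {c..d}" "k \<subseteq> T" using pk[OF xk(1)] by (auto simp: \<gamma>_def)
          then show "t \<in> T" using t by auto
        qed
        show "(\<Union>z\<in>D. {fst z<..<snd z}) \<in> sets lebesgue"
          using finD by (intro sets.finite_UN) auto
      qed (rule TL)
      finally have "(\<Sum>(c, d)\<in>D. d - c) < \<delta>" using mT by simp
      then have "(\<Sum>(c, d)\<in>D. norm (g d - g c)) < e / 2" using finD Dp Ddis \<delta>(2)[of D] by blast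
      also have "(\<Sum>(c, d)\<in>D. norm (g d - g c)) = (\<Sum>z\<in>P2. norm (E z))"
        unfolding D_def by (subst sum.reindex[OF inj], intro sum.cong)
          (simp_all add: P2_def E_def f'_def norm_minus_commute)
      finally have 2: "(\<Sum>z\<in>P2. norm (E z)) < e / 2" .
      have "norm (sum E p) \<le> (\<Sum>z\<in>p. norm (E z))" by (rule norm_sum)
      then show "norm ((\<Sum>(x, k)\<in>p. measure lborel k *\<^sub>R f' x) - (g b - g a)) < e"
        using eq sm 1 2 3 by simp
    qed
  qed
  then show ?thesis
    by (rule has_integral_spike[OF N, rotated]) (simp add: f'_def)
qed

text \<open>The points where averages over arbitrarily short intervals stay \<eta> away from
  \<open>f x\<close> have a Vitali cover by intervals that are fine for the gauge of the Henstock
  lemma. Finite disjoint subfamilies are tagged partial divisions, so a Henstock error below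
  \<open>\<eta> * e\<close> bounds their total length by \<open>e\<close>.\<close>

lemma lebesgue_differentiation_real:
  fixes f :: "real \<Rightarrow> real"
  assumes f: "f integrable_on {a..b}"
  obtains N where "negligible N"
    "\<And>x. x \<in> {a<..<b} - N \<Longrightarrow> ((\<lambda>t. integral {a..t} f) has_vector_derivative f x) (at x)"
proof -
  \<comment> \<open>The point \<open>x\<close> may be an endpoint of the interval, so one-sided
    increments of the indefinite integral are covered.\<close>
  define bad where "bad = (\<lambda>\<eta> c d x. a \<le> c \<and> c \<le> x \<and> x \<le> d \<and> c < d \<and> d \<le> b \<and>
      \<bar>(d - c) * f x - integral {c..d} f\<bar> \<ge> \<eta> * (d - c))"
  define S where "S = (\<lambda>\<eta>. {x \<in> {a<..<b}. \<forall>r>0. \<exists>c d. bad \<eta> c d x \<and> d - c < r})"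
  have neg: "negligible (S \<eta>)" if "\<eta> > 0" for \<eta>
    unfolding negligible_outer_le
  proof (intro allI impI)
    fix e :: real assume "e > 0"
    then have "\<eta> * e > 0" using \<open>\<eta> > 0\<close> by simp
    with f obtain \<gamma> where \<gamma>: "gauge \<gamma>"
       "\<And>p. \<lbrakk>p tagged_partial_division_of (cbox a b); \<gamma> fine p\<rbrakk> \<Longrightarrow>
             sum (\<lambda>(x,k). norm(measure lborel k *\<^sub>R f x - integral k f)) p < \<eta> * e"
      using Henstock_lemma[of f a b "\<eta> * e"] by (auto simp: cbox_interval)
    define K where "K = {(x, c, d). x \<in> S \<eta> \<and> bad \<eta> c d x \<and> {c..d} \<subseteq> \<gamma> x}"
    define m where "m = (\<lambda>i::real\<times>real\<times>real. (fst (snd i) + snd (snd i)) / 2)"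
    define r where "r = (\<lambda>i::real\<times>real\<times>real. (snd (snd i) - fst (snd i)) / 2)"
    have cb: "cball (m i) (r i) = {fst (snd i)..snd (snd i)}" for i
      by (simp add: cball_eq_atLeastAtMost m_def r_def field_simps)
    obtain C where C: "countable C" "C \<subseteq> K"
       "pairwise (\<lambda>i j. disjnt (cball (m i) (r i)) (cball (m j) (r j))) C"
       "negligible(S \<eta> - (\<Union>i \<in> C. cball (m i) (r i)))"
    proof (rule Vitali_covering_theorem_cballs[of K r "S \<eta>" m])
      show "0 < r i" if "i \<in> K" for i using that by (auto simp: K_def bad_def r_def)
      fix x d :: real assume x: "x \<in> S \<eta>" "0 < d"
      have "open (\<gamma> x)" "x \<in> \<gamma> x" using \<gamma>(1) by (auto simp: gauge_def)
      then obtain s where s: "s > 0" "ball x s \<subseteq> \<gamma> x" using open_contains_ball by blast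
      obtain c c' where c: "bad \<eta> c c' x" "c' - c < min s d"
        using x s(1) unfolding S_def by (auto dest!: spec[of _ "min s d"])
      have "{c..c'} \<subseteq> ball x s" using c by (auto simp: bad_def dist_real_def)
      then have "(x, c, c') \<in> K" using x c s by (auto simp: K_def)
      moreover have "x \<in> cball (m (x, c, c')) (r (x, c, c'))" using c by (auto simp: cb bad_def)
      moreover have "r (x, c, c') < d" using c by (auto simp: r_def bad_def)
      ultimately show "\<exists>i. i \<in> K \<and> x \<in> cball (m i) (r i) \<and> r i < d" by blast
    qed blast
    \<comment> \<open>The Henstock lemma speaks of finite divisions; the uniform bound passes to the
      countable union afterwards.\<close>
    have bnd: "measure lebesgue (\<Union>i\<in>F. cball (m i) (r i)) \<le> e" if F: "F \<subseteq> C" "finite F" for F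
    proof -
      have FK: "x \<in> S \<eta> \<and> bad \<eta> c d x \<and> {c..d} \<subseteq> \<gamma> x" if "(x, c, d) \<in> F" for x c d
        using F C(2) that by (auto simp: K_def)
      define p where "p = (\<lambda>i. (fst i, {fst (snd i)..snd (snd i)})) ` F"
      have dis: "{c..d} \<inter> {c'..d'} = {}" if "(x, c, d) \<in> F" "(x', c', d') \<in> F" "(x, c, d) \<noteq> (x', c', d')" for x c d x' c' d'
      proof -
        have "(x, c, d) \<in> C" "(x', c', d') \<in> C" using that F(1) by auto
        with C(3) that(3) show ?thesis unfolding pairwise_def disjnt_def cb by fastforce
      qed
      have inj: "inj_on (\<lambda>i. (fst i, {fst (snd i)..snd (snd i)})) F"
      proof (rule inj_onI)
        fix i j assume ij: "i \<in> F" "j \<in> F"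
          "(fst i, {fst (snd i)..snd (snd i)}) = (fst j, {fst (snd j)..snd (snd j)})"
        have "fst (snd i) < snd (snd i)"
          using FK[of "fst i" "fst (snd i)" "snd (snd i)"] ij(1) by (auto simp: bad_def)
        then show "i = j" using ij(3) by (auto simp: Icc_eq_Icc prod_eq_iff)
      qed
      have part: "p tagged_partial_division_of (cbox a b)"
        unfolding tagged_partial_division_of_def
      proof (intro conjI allI impI)
        show "finite p" using F by (simp add: p_def)
        fix x k assume "(x, k) \<in> p"
        then obtain c d where k: "(x, c, d) \<in> F" "k = {c..d}" by (auto simp: p_def)
        then show "x \<in> k" "k \<subseteq> cbox a b" "\<exists>a b. k = cbox a b"
          using FK[OF k(1)] by (auto simp: bad_def cbox_interval)
      next
        fix x k x' k' assume *: "(x, k) \<in> p \<and> (x', k') \<in> p \<and> (x, k) \<noteq> (x', k')"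
        have mem: "\<exists>c d. (x, c, d) \<in> F \<and> k = {c..d}" if "(x, k) \<in> p" for x k
          using that unfolding p_def by fastforce
        obtain c d where k1: "(x, c, d) \<in> F" "k = {c..d}" using * mem[of x k] by blast
        obtain c' d' where k2: "(x', c', d') \<in> F" "k' = {c'..d'}" using * mem[of x' k'] by blast
        note k = k1 k2
        have "k \<inter> k' = {}" using dis[OF k(1,3)] * k by blast
        then show "interior k \<inter> interior k' = {}" using interior_subset by blast
      qed
      have fine: "\<gamma> fine p" using FK by (fastforce simp: fine_def p_def)
      have le: "(\<Sum>(x, c, d)\<in>F. \<eta> * (d - c)) \<le> (\<Sum>(x,k)\<in>p. norm(measure lborel k *\<^sub>R f x - integral k f))"
        unfolding p_def
      proof (subst sum.reindex[OF inj], intro sum_mono)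
        fix i assume i: "i \<in> F"
        obtain x c d where ix: "i = (x, c, d)" by (cases i) auto
        show "(case i of (x, c, d) \<Rightarrow> \<eta> * (d - c))
          \<le> ((\<lambda>(x, k). norm (measure lborel k *\<^sub>R f x - integral k f)) \<circ> (\<lambda>i. (fst i, {fst (snd i)..snd (snd i)}))) i"
          using FK[of x c d] i by (auto simp: ix bad_def)
      qed
      have "\<eta> * measure lebesgue (\<Union>i\<in>F. cball (m i) (r i)) = \<eta> * (\<Sum>i\<in>F. measure lebesgue (cball (m i) (r i)))"
      proof (subst measure_finite_Union)
        show "disjoint_family_on (\<lambda>i. cball (m i) (r i)) F"
          using C(3) F(1) unfolding disjoint_family_on_def pairwise_def disjnt_def by blast
        show "emeasure lebesgue (cball (m i) (r i)) \<noteq> \<infinity>" for i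
          by (simp add: cb emeasure_lborel_Icc_eq)
      qed (use F in auto)
      also have "\<dots> = (\<Sum>(x, c, d)\<in>F. \<eta> * (d - c))"
        unfolding sum_distrib_left cb
      proof (intro sum.cong refl)
        fix i assume i: "i \<in> F"
        obtain x c d where ix: "i = (x, c, d)" by (cases i) auto
        show "\<eta> * measure lebesgue {fst (snd i)..snd (snd i)} = (case i of (x, c, d) \<Rightarrow> \<eta> * (d - c))"
          using FK[of x c d] i by (auto simp: ix bad_def)
      qed
      also have "\<dots> < \<eta> * e" using le \<gamma>(2)[OF part fine] by simp
      finally show ?thesis using \<open>\<eta> > 0\<close> by simp
    qed
    define U where "U = (\<Union>i\<in>C. cball (m i) (r i))"
    have UL: "U \<in> lmeasurable \<and> measure lebesgue U \<le> e"
    proof -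
      let ?F = "(\<lambda>i. cball (m i) (r i)) ` C"
      have c: "countable ?F" using C(1) by simp
      have m: "K \<in> lmeasurable" if "K \<in> ?F" for K
        using that by auto
      have b: "measure lebesgue (\<Union>\<D>) \<le> e" if *: "\<D> \<subseteq> ?F" "finite \<D>" for \<D>
      proof -
        obtain F where "F \<subseteq> C" "finite F" "\<D> = (\<lambda>i. cball (m i) (r i)) ` F"
          using finite_subset_image[OF *(2,1)] by blast
        then show ?thesis using bnd[of F] by simp
      qed
      have "\<Union>?F \<in> lmeasurable" by (rule fmeasurable_Union_bound[OF c m b])
      moreover have "measure lebesgue (\<Union>?F) \<le> e" by (rule measure_Union_bound[OF c m b])
      ultimately show ?thesis by (simp add: U_def)
    qed
    let ?R = "S \<eta> - U"
    have R: "?R \<in> null_sets lebesgue" using C(4) by (simp add: U_def negligible_iff_null_sets)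
    have "measure lebesgue (U \<union> ?R) = measure lebesgue U"
      using UL R by (intro measure_Un_null_set) auto
    moreover have "U \<union> ?R \<in> lmeasurable"
      using UL C(4) by (intro fmeasurable.Un) (auto simp: U_def negligible_imp_measurable)
    ultimately show "\<exists>T. S \<eta> \<subseteq> T \<and> T \<in> lmeasurable \<and> measure lebesgue T \<le> e"
      using UL by (intro exI[of _ "U \<union> ?R"]) auto
  qed
  show thesis
  proof
    \<comment> \<open>A failure of differentiability for some tolerance is also one for some
      \<open>1 / Suc n\<close>, so countably many null sets suffice.\<close>
    show "negligible (\<Union>n::nat. S (1 / Suc n))"
      by (intro negligible_countable_Union) (use neg in auto)
    fix x assume x: "x \<in> {a<..<b} - (\<Union>n::nat. S (1 / Suc n))"
    have int: "f integrable_on {c..d}" if "a \<le> c" "d \<le> b" for c d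
      using integrable_on_subinterval[OF f] that by auto
    have comb: "integral {a..d} f - integral {a..c} f = integral {c..d} f" if "a \<le> c" "c \<le> d" "d \<le> b" for c d
      using Henstock_Kurzweil_Integration.integral_combine[of a c d f] int that by auto
    show "((\<lambda>t. integral {a..t} f) has_vector_derivative f x) (at x)"
      unfolding has_vector_derivative_def has_derivative_at_alt
    proof (intro conjI allI impI bounded_linear_scaleR_left)
      fix e :: real assume "e > 0"
      then obtain n :: nat where n: "1 / Suc n < e" using nat_approx_posE by auto
      have "x \<notin> S (1 / Suc n)" using x by auto
      then obtain r where r: "r > 0" "\<And>c d. bad (1 / Suc n) c d x \<Longrightarrow> d - c \<ge> r"
        using x by (force simp: S_def)
      define s where "s = min r (min (x - a) (b - x))"
      have "s > 0" using r x by (auto simp: s_def)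
      show "\<exists>d>0. \<forall>y. norm (y - x) < d \<longrightarrow>
         norm (integral {a..y} f - integral {a..x} f - (y - x) *\<^sub>R f x) \<le> e * norm (y - x)"
      proof (intro exI[of _ s] conjI allI impI \<open>s > 0\<close>)
        fix y assume y: "norm (y - x) < s"
        consider "y = x" | "x < y" | "y < x" by linarith
        then show "norm (integral {a..y} f - integral {a..x} f - (y - x) *\<^sub>R f x) \<le> e * norm (y - x)"
        proof cases
          case 2
          have "\<not> bad (1 / Suc n) x y x" using r(2)[of x y] y by (auto simp: s_def)
          then have "\<bar>(y - x) * f x - integral {x..y} f\<bar> \<le> (1 / Suc n) * (y - x)"
            using 2 y x by (auto simp: bad_def s_def)
          also have "\<dots> \<le> e * (y - x)" using n 2 by (intro mult_right_mono) auto
          finally show ?thesis using comb[of x y] 2 x y by (auto simp: s_def abs_minus_commute)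
        next
          case 3
          have "\<not> bad (1 / Suc n) y x x" using r(2)[of y x] y by (auto simp: s_def)
          then have "\<bar>(x - y) * f x - integral {y..x} f\<bar> \<le> (1 / Suc n) * (x - y)"
            using 3 y x by (auto simp: bad_def s_def)
          also have "\<dots> \<le> e * (x - y)" using n 3 by (intro mult_right_mono) auto
          finally show ?thesis using comb[of y x] 3 x y by (auto simp: s_def algebra_simps)
        qed simp
      qed
    qed
  qed
qed

text \<open>Truncation at height \<open>n\<close>: the excess \<open>h n\<close> of
  \<open>\<bar>f\<bar>\<close> over \<open>n\<close> has a small integral over the whole interval by
  dominated convergence, and the bounded rest contributes at most \<open>n\<close> times the total
  length.\<close>

lemma ac_indefinite_integral:
  fixes f :: "real \<Rightarrow> real"
  assumes f: "f absolutely_integrable_on {a..b}"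
  shows "ac a b (\<lambda>x. integral {a..x} f)"
  unfolding absolutely_continuous_on_interval_def
proof (intro allI impI)
  fix e :: real assume "e > 0"
  define h where "h = (\<lambda>n x. max (\<bar>f x\<bar> - real n) 0)"
  have absf: "(\<lambda>x. \<bar>f x\<bar>) absolutely_integrable_on {a..b}"
    using absolutely_integrable_norm[OF f] by (simp add: o_def)
  have fI: "f integrable_on {a..b}" "(\<lambda>x. \<bar>f x\<bar>) integrable_on {a..b}"
    using f absf set_lebesgue_integral_eq_integral(1) by blast+
  have hA: "h n absolutely_integrable_on {a..b}" for n
  proof -
    have "(\<lambda>x. \<bar>f x\<bar> - real n) absolutely_integrable_on {a..b}"
      using absf by (intro set_integral_diff) auto
    then show ?thesis unfolding h_def by (intro absolutely_integrable_max_1 absolutely_integrable_on_const) auto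
  qed
  then have hI: "h n integrable_on {a..b}" for n
    using set_lebesgue_integral_eq_integral(1) by blast
  have "(\<lambda>n. integral {a..b} (h n)) \<longlonglongrightarrow> integral {a..b} (\<lambda>x. 0)"
  proof (rule dominated_convergence(2)[OF hI fI(2)])
    show "norm (h n x) \<le> \<bar>f x\<bar>" for n x by (auto simp: h_def)
    fix x
    obtain N :: nat where "real N \<ge> \<bar>f x\<bar>" using real_arch_simple by blast
    then have "eventually (\<lambda>n. h n x = 0) sequentially"
      unfolding h_def by (intro eventually_sequentiallyI[of N]) auto
    then show "(\<lambda>n. h n x) \<longlonglongrightarrow> 0" by (rule tendsto_eventually)
  qed
  then have "eventually (\<lambda>n. integral {a..b} (h n) < e / 2) sequentially"
    using \<open>e > 0\<close> by (intro order_tendstoD(2)) auto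
  then obtain n where n: "integral {a..b} (h n) < e / 2"
    by (auto simp: eventually_sequentially)
  show "\<exists>\<delta>>0. \<forall>D. short_intervals a b \<delta> D \<longrightarrow>
        (\<Sum>(c, d)\<in>D. norm (integral {a..d} f - integral {a..c} f)) < e"
  \<comment> \<open>With this length the bounded part adds at most \<open>e / 2\<close>;
    \<open>n + 1\<close> avoids a zero denominator.\<close>
  proof (intro exI[of _ "e / (2 * (real n + 1))"] conjI allI impI)
    show "0 < e / (2 * (real n + 1))" using \<open>e > 0\<close> by simp
    fix D :: "(real \<times> real) set"
    assume D: "short_intervals a b (e / (2 * (real n + 1))) D"
    define I where "I = (\<lambda>z::real\<times>real. {fst z<..<snd z})"
    have ID: "I z \<subseteq> {a..b}" if "z \<in> D" for z using D that by (fastforce simp: I_def)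
    have hz: "(\<lambda>x. if x \<in> I z then h n x else 0) integrable_on {a..b} \<and>
        integral {a..b} (\<lambda>x. if x \<in> I z then h n x else 0) = integral (I z) (h n)" if "z \<in> D" for z
    proof -
      have "I z \<inter> {a..b} = I z" "{a..b} \<inter> I z = I z" using ID[OF that] by auto
      moreover have "h n integrable_on I z"
        using integrable_on_subinterval[OF hI, of "fst z" "snd z" n] D that
        unfolding I_def by (fastforce simp: integrable_on_open_interval_real cbox_interval)
      ultimately show ?thesis
        by (simp add: integral_restrict_Int integrable_restrict_Int)
    qed
    have le: "norm (integral {a..snd z} f - integral {a..fst z} f) \<le> integral (I z) (h n) + real n * (snd z - fst z)"
      if "z \<in> D" for z
    proof -
      obtain c d where z: "z = (c, d)" by fastforce
      have cd: "a \<le> c" "c < d" "d \<le> b" using D that z by auto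
      have int: "f integrable_on {u..v}" "(\<lambda>x. \<bar>f x\<bar>) integrable_on {u..v}" "h n integrable_on {u..v}"
        if "a \<le> u" "v \<le> b" for u v
        using integrable_on_subinterval[OF fI(1), of u v] integrable_on_subinterval[OF fI(2), of u v]
          integrable_on_subinterval[OF hI, of u v n] that by auto
      have "integral {a..d} f - integral {a..c} f = integral {c..d} f"
        using Henstock_Kurzweil_Integration.integral_combine[of a c d f] int cd by auto
      then have "norm (integral {a..d} f - integral {a..c} f) \<le> integral {c..d} (\<lambda>x. \<bar>f x\<bar>)"
        using integral_norm_bound_integral[of f "{c..d}" "\<lambda>x. \<bar>f x\<bar>"] int cd by auto
      also have "\<dots> \<le> integral {c..d} (\<lambda>x. h n x + real n)"
        using int cd by (intro integral_le integrable_add) (auto simp: h_def)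
      also have "\<dots> = integral {c..d} (h n) + real n * (d - c)"
        using int cd by (subst integral_add) auto
      finally show ?thesis by (simp add: z I_def integral_open_interval_real)
    qed
    have "(\<Sum>z\<in>D. integral (I z) (h n)) = integral {a..b} (\<lambda>x. \<Sum>z\<in>D. if x \<in> I z then h n x else 0)"
      using D hz by (subst integral_sum) auto
    also have "\<dots> \<le> integral {a..b} (h n)"
    proof (rule integral_le)
      show "(\<lambda>x. \<Sum>z\<in>D. if x \<in> I z then h n x else 0) integrable_on {a..b}"
        using D hz by (intro integrable_sum) auto
      show "h n integrable_on {a..b}" by (rule hI)
      fix x assume "x \<in> {a..b}"
      have h0: "h n x \<ge> 0" by (simp add: h_def)
      show "(\<Sum>z\<in>D. if x \<in> I z then h n x else 0) \<le> h n x"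
      proof (cases "\<exists>z\<in>D. x \<in> I z")
        case True
        then obtain z where z: "z \<in> D" "x \<in> I z" by blast
        have uq: "z' = z" if "z' \<in> D" "x \<in> I z'" for z'
        proof (rule ccontr)
          assume "z' \<noteq> z"
          then have "disjnt (I z') (I z)"
            using D z that by (simp add: pairwise_def I_def split_def)
          then show False using z that by (auto simp: disjnt_def)
        qed
        have "(\<Sum>z'\<in>D. if x \<in> I z' then h n x else 0) = (\<Sum>z'\<in>D. if z' = z then h n x else 0)"
        proof (rule sum.cong[OF refl])
          fix z' assume z': "z' \<in> D"
          show "(if x \<in> I z' then h n x else 0) = (if z' = z then h n x else 0)"
            using uq[OF z'] z(2) by (cases "z' = z") auto
        qed
        also have "\<dots> = h n x" using conjunct1[OF D] z(1) by simp
        finally show ?thesis by simp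
      next
        case False
        then have "(\<Sum>z\<in>D. if x \<in> I z then h n x else 0) = 0" by (intro sum.neutral) auto
        then show ?thesis using h0 by simp
      qed
    qed
    also note n
    finally have 1: "(\<Sum>z\<in>D. integral (I z) (h n)) < e / 2" .
    have "real n * (\<Sum>z\<in>D. snd z - fst z) \<le> (real n + 1) * (e / (2 * (real n + 1)))"
      using D \<open>e > 0\<close> by (intro mult_mono) (auto simp: split_def intro!: sum_nonneg)
    also have "\<dots> = e / 2" by (simp add: divide_simps)
    finally have 2: "real n * (\<Sum>z\<in>D. snd z - fst z) \<le> e / 2" .
    have "(\<Sum>(c, d)\<in>D. norm (integral {a..d} f - integral {a..c} f))
      \<le> (\<Sum>z\<in>D. integral (I z) (h n) + real n * (snd z - fst z))"
      unfolding split_def by (intro sum_mono le)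
    also have "\<dots> < e" using 1 2 by (simp add: sum.distrib sum_distrib_left)
    finally show "(\<Sum>(c, d)\<in>D. norm (integral {a..d} f - integral {a..c} f)) < e" .
  qed
qed

lemma AE_lebesgue_on_negligible_iff:
  fixes S :: "'a::euclidean_space set"
  assumes "S \<in> sets lebesgue"
  shows "(AE x in lebesgue_on S. P x) \<longleftrightarrow> (\<exists>N. negligible N \<and> (\<forall>x\<in>S - N. P x))"
proof -
  have "(AE x in lebesgue_on S. P x) \<longleftrightarrow> (AE x in lebesgue. x \<in> S \<longrightarrow> P x)"
    using assms by (intro AE_restrict_space_iff) simp
  also have "\<dots> \<longleftrightarrow> (\<exists>N\<in>null_sets lebesgue. {x \<in> space lebesgue. \<not> (x \<in> S \<longrightarrow> P x)} \<subseteq> N)"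
    by (rule eventually_ae_filter)
  also have "\<dots> \<longleftrightarrow> (\<exists>N. negligible N \<and> (\<forall>x\<in>S - N. P x))"
    unfolding negligible_iff_null_sets by (auto simp: subset_iff)
  finally show ?thesis .
qed

text \<open>\<open>g\<close> is the integral of the continuous function \<open>c\<close>, so the
  derivative exists at every point, endpoints included. Through this lemma the identities for
  quasi-derivatives and Darboux transforms pass from almost every point to all points.\<close>

lemma ac_derivative_continuous:
  fixes g :: "real \<Rightarrow> 'a :: banach"
  assumes ac: "ac a b g" and N: "negligible N" and cont: "continuous_on {a..b} c"
    and der: "\<And>x. x \<in> {a<..<b} - N \<Longrightarrow> (g has_vector_derivative c x) (at x)"
    and x: "x \<in> {a..b}"
  shows "(g has_vector_derivative c x) (at x within {a..b})"
proof -
  have eq: "g t = g a + integral {a..t} c" if t: "t \<in> {a..b}" for t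
  proof -
    have "(c has_integral (g t - g a)) {a..t}"
    proof (rule ac_fundamental_theorem_of_calculus)
      show "a \<le> t" using t by simp
      show "ac a t g" by (rule ac_mono[OF ac]) (use t in auto)
      show "negligible (insert a (insert b N))" using N by (simp add: negligible_insert)
      fix y assume "y \<in> {a..t} - insert a (insert b N)"
      then have "y \<in> {a<..<b} - N" using t by auto
      then show "(g has_vector_derivative c y) (at y within {a..t})"
        by (rule has_vector_derivative_at_within[OF der])
    qed
    from integral_unique[OF this] show ?thesis by simp
  qed
  have "((\<lambda>t. g a + integral {a..t} c) has_vector_derivative 0 + c x) (at x within {a..b})"
    by (rule has_vector_derivative_add[OF has_vector_derivative_const integral_has_vector_derivative[OF cont x]])
  then have d: "((\<lambda>t. g a + integral {a..t} c) has_vector_derivative c x) (at x within {a..b})"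
    by (simp only: add_0_left)
  show ?thesis
    by (rule has_vector_derivative_transform[OF x _ d]) (rule eq)
qed

section \<open>Gronwall bound and linear systems with continuous coefficients\<close>

lemma gronwall_bound:
  fixes E :: "real \<Rightarrow> real"
  assumes der: "\<And>x. x \<in> {a..b} \<Longrightarrow> (E has_vector_derivative E' x) (at x within {a..b})"
    and bnd: "\<And>x. x \<in> {a..b} \<Longrightarrow> \<bar>E' x\<bar> \<le> K * E x"
    and x: "x \<in> {a..b}" and t: "t \<in> {a..b}"
  shows "E x \<le> E t * exp (K * \<bar>x - t\<bar>)"
proof -
  have cE: "continuous_on {a..b} E"
    by (rule continuous_on_vector_derivative[OF der])
  have dE: "(E has_real_derivative E' y) (at y)" if "a < y" "y < b" for y
    using der[of y] that at_within_Icc_at[of a y b]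
    by (simp add: has_real_derivative_iff_has_vector_derivative)
  show ?thesis
  proof (cases "t \<le> x")
    case True
    \<comment> \<open>The bound on \<open>E'\<close> makes \<open>E x * exp (- K * x)\<close>
      nonincreasing; to the left of \<open>t\<close> the product \<open>E x * exp (K * x)\<close>,
      which is nondecreasing, takes its place.\<close>
    have "E x * exp (- K * x) \<le> E t * exp (- K * t)"
    proof (rule DERIV_nonpos_imp_decreasing_open[OF True])
      fix y assume y: "t < y" "y < x"
      have 1: "((\<lambda>x. exp (- K * x)) has_real_derivative - K * exp (- K * y)) (at y)"
        by (auto intro!: derivative_eq_intros)
      have 2: "(E has_real_derivative E' y) (at y)" using x t y by (intro dE) auto
      have "((\<lambda>x. E x * exp (- K * x)) has_real_derivative (E' y - K * E y) * exp (- K * y)) (at y)"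
        using DERIV_mult[OF 2 1] by (simp add: algebra_simps)
      moreover have "(E' y - K * E y) * exp (- K * y) \<le> 0"
        using bnd[of y] x t y by (intro mult_nonpos_nonneg) auto
      ultimately show "\<exists>D. ((\<lambda>x. E x * exp (- K * x)) has_real_derivative D) (at y) \<and> D \<le> 0" by blast
    qed (intro continuous_on_mult continuous_on_exp continuous_on_const continuous_on_id continuous_on_subset[OF cE], use x t in auto)
    then have "E x * exp (- K * x) * exp (K * x) \<le> E t * exp (- K * t) * exp (K * x)"
      by (intro mult_right_mono) auto
    also have "E x * exp (- K * x) * exp (K * x) = E x" by (simp add: mult.assoc flip: exp_add)
    also have "E t * exp (- K * t) * exp (K * x) = E t * exp (K * \<bar>x - t\<bar>)"
      using True by (simp add: mult.assoc right_diff_distrib flip: exp_add)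
    finally show ?thesis .
  next
    case False
    then have tx: "x \<le> t" by simp
    have "E x * exp (K * x) \<le> E t * exp (K * t)"
    proof (rule DERIV_nonneg_imp_increasing_open[OF tx])
      fix y assume y: "x < y" "y < t"
      have 1: "((\<lambda>x. exp (K * x)) has_real_derivative K * exp (K * y)) (at y)"
        by (auto intro!: derivative_eq_intros)
      have 2: "(E has_real_derivative E' y) (at y)" using x t y by (intro dE) auto
      have "((\<lambda>x. E x * exp (K * x)) has_real_derivative (E' y + K * E y) * exp (K * y)) (at y)"
        using DERIV_mult[OF 2 1] by (simp add: algebra_simps)
      moreover have "(E' y + K * E y) * exp (K * y) \<ge> 0"
        using bnd[of y] x t y by (intro mult_nonneg_nonneg) auto
      ultimately show "\<exists>D. ((\<lambda>x. E x * exp (K * x)) has_real_derivative D) (at y) \<and> D \<ge> 0" by blast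
    qed (intro continuous_on_mult continuous_on_exp continuous_on_const continuous_on_id continuous_on_subset[OF cE], use x t in auto)
    then have "E x * exp (K * x) * exp (- K * x) \<le> E t * exp (K * t) * exp (- K * x)"
      by (intro mult_right_mono) auto
    also have "E x * exp (K * x) * exp (- K * x) = E x" by (simp add: mult.assoc flip: exp_add)
    also have "E t * exp (K * t) * exp (- K * x) = E t * exp (K * \<bar>x - t\<bar>)"
      using tx by (simp add: mult.assoc right_diff_distrib flip: exp_add)
    finally show ?thesis .
  qed
qed

text \<open>Picard iteration. Stating continuity for the composition \<open>A x (Y x)\<close> avoids
  a topology on the operators \<open>A x\<close>.\<close>

lemma linear_ode_exists:
  fixes A :: "real \<Rightarrow> 'a::banach \<Rightarrow> 'a"
  assumes diff: "\<And>x v w. A x (v - w) = A x v - A x w"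
    and bnd: "\<And>x v. x \<in> {0..b} \<Longrightarrow> norm (A x v) \<le> K * norm v"
    and cont: "\<And>Y. continuous_on {0..b} Y \<Longrightarrow> continuous_on {0..b} (\<lambda>x. A x (Y x))"
  shows "\<exists>Y. Y 0 = c \<and> (\<forall>x\<in>{0..b}. (Y has_vector_derivative A x (Y x)) (at x within {0..b}))"
proof -
  define L where "L = \<bar>K\<bar> + 1"
  have "L > 0" by (simp add: L_def)
  have bndL: "norm (A x v) \<le> L * norm v" if "x \<in> {0..b}" for x v
  proof -
    have "K * norm v \<le> L * norm v" by (intro mult_right_mono) (auto simp: L_def)
    with bnd[OF that, of v] show ?thesis by linarith
  qed
  define S where "S = rec_nat (\<lambda>x. c) (\<lambda>n s x. c + integral {0..x} (\<lambda>t. A t (s t)))"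
  have S0: "S 0 = (\<lambda>x. c)" and SS: "S (Suc n) = (\<lambda>x. c + integral {0..x} (\<lambda>t. A t (S n t)))" for n
    by (simp_all add: S_def)
  have Sc: "continuous_on {0..b} (S n)" for n
  proof (induction n)
    case (Suc n)
    then show ?case unfolding SS
      by (intro continuous_intros indefinite_integral_continuous_1 integrable_continuous_real cont)
  qed (simp add: S0)
  have ASc: "continuous_on {0..b} (\<lambda>t. A t (S n t))" for n by (rule cont[OF Sc])
  have AI: "(\<lambda>t. A t (S n t)) integrable_on {0..x}" if "x \<in> {0..b}" for n x
    using that by (intro integrable_continuous_real continuous_on_subset[OF ASc]) auto
  have expint: "((\<lambda>t. exp (2 * L * t)) has_integral (exp (2 * L * x) - 1) / (2 * L)) {0..x}" if "x \<ge> 0" for x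
  proof -
    have "((\<lambda>t. exp (2 * L * t)) has_integral (exp (2 * L * x) / (2 * L) - exp (2 * L * 0) / (2 * L))) {0..x}"
      using \<open>L > 0\<close> that by (intro fundamental_theorem_of_calculus)
        (auto intro!: derivative_eq_intros simp flip: has_real_derivative_iff_has_vector_derivative)
    then show ?thesis by (simp add: diff_divide_distrib)
  qed
  \<comment> \<open>Against the weight \<open>exp (2 * L * x)\<close> one integration with the
    constant \<open>L\<close> gains a factor 1/2, so the iterates converge on the whole interval at
    once, whatever the size of \<open>L * b\<close>.\<close>
  have est: "norm (S (Suc n) x - S n x) \<le> norm c * (1 / 2) ^ n * exp (2 * L * x)" if "x \<in> {0..b}" for n x
    using that
  proof (induction n arbitrary: x)
    case 0
    have "norm (S (Suc 0) x - S 0 x) = norm (integral {0..x} (\<lambda>t. A t c))" by (simp add: SS S0)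
    also have "\<dots> \<le> integral {0..x} (\<lambda>t. L * norm c)"
      using 0 AI[OF 0, of 0] bndL by (intro integral_norm_bound_integral) (auto simp: S0)
    also have "\<dots> = norm c * (L * x)" using 0 by simp
    also have "\<dots> \<le> norm c * exp (2 * L * x)"
    proof (rule mult_left_mono)
      have "0 \<le> L * x" using 0 \<open>L > 0\<close> by simp
      then show "L * x \<le> exp (2 * L * x)" using exp_ge_add_one_self[of "2 * L * x"] by linarith
    qed simp
    finally show ?case by simp
  next
    case (Suc n)
    have "S (Suc (Suc n)) x - S (Suc n) x = integral {0..x} (\<lambda>t. A t (S (Suc n) t)) - integral {0..x} (\<lambda>t. A t (S n t))"
      using fun_cong[OF SS[of n], of x] fun_cong[OF SS[of "Suc n"], of x] by simp
    also have "\<dots> = integral {0..x} (\<lambda>t. A t (S (Suc n) t) - A t (S n t))"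
      by (rule Henstock_Kurzweil_Integration.integral_diff[symmetric]) (intro AI Suc)+
    finally have "norm (S (Suc (Suc n)) x - S (Suc n) x) = norm (integral {0..x} (\<lambda>t. A t (S (Suc n) t) - A t (S n t)))"
      by simp
    also have "\<dots> \<le> integral {0..x} (\<lambda>t. L * (norm c * (1 / 2) ^ n) * exp (2 * L * t))"
    proof (rule integral_norm_bound_integral)
      show "(\<lambda>t. A t (S (Suc n) t) - A t (S n t)) integrable_on {0..x}"
        by (intro Henstock_Kurzweil_Integration.integrable_diff AI Suc)
      show "(\<lambda>t. L * (norm c * (1 / 2) ^ n) * exp (2 * L * t)) integrable_on {0..x}"
        by (intro integrable_continuous_real continuous_intros)
      fix t assume t: "t \<in> {0..x}"
      have "norm (A t (S (Suc n) t) - A t (S n t)) \<le> L * norm (S (Suc n) t - S n t)"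
        using bndL[of t "S (Suc n) t - S n t"] t Suc by (simp add: diff)
      also have "\<dots> \<le> L * (norm c * (1 / 2) ^ n * exp (2 * L * t))"
        using Suc.IH[of t] t Suc.prems \<open>L > 0\<close> by (intro mult_left_mono) auto
      finally show "norm (A t (S (Suc n) t) - A t (S n t)) \<le> L * (norm c * (1 / 2) ^ n) * exp (2 * L * t)"
        by (simp add: mult.assoc)
    qed
    also have "\<dots> = L * (norm c * (1 / 2) ^ n) * ((exp (2 * L * x) - 1) / (2 * L))"
      using expint[of x] Suc.prems by (subst integral_mult_right) (simp add: integral_unique)
    also have "\<dots> = norm c * (1 / 2) ^ Suc n * (exp (2 * L * x) - 1)"
      using \<open>L > 0\<close> by (simp add: field_simps)
    also have "\<dots> \<le> norm c * (1 / 2) ^ Suc n * exp (2 * L * x)"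
      by (intro mult_left_mono) auto
    finally show ?case .
  qed
  define Y where "Y = (\<lambda>x. c + (\<Sum>n. S (Suc n) x - S n x))"
  have "uniform_limit {0..b} (\<lambda>n x. \<Sum>i<n. S (Suc i) x - S i x) (\<lambda>x. \<Sum>n. S (Suc n) x - S n x) sequentially"
  proof (rule Weierstrass_m_test)
    fix n x assume x: "x \<in> {0..b}"
    have "norm c * (1 / 2) ^ n * exp (2 * L * x) \<le> norm c * (1 / 2) ^ n * exp (2 * L * b)"
      using x \<open>L > 0\<close> by (intro mult_left_mono) auto
    with est[OF x, of n]
    show "norm (S (Suc n) x - S n x) \<le> norm c * exp (2 * L * b) * (1 / 2) ^ n"
      by (simp add: mult.assoc mult.commute mult.left_commute)
  next
    show "summable (\<lambda>n. norm c * exp (2 * L * b) * (1 / 2) ^ n)"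
      by (intro summable_mult summable_geometric) simp
  qed
  then have "uniform_limit {0..b} (\<lambda>n x. c + (\<Sum>i<n. S (Suc i) x - S i x)) Y sequentially"
    unfolding Y_def by (intro uniform_limit_intros)
  moreover have "c + (\<Sum>i<n. S (Suc i) x - S i x) = S n x" for n x
    by (subst sum_lessThan_telescope) (simp add: S0)
  ultimately have ul: "uniform_limit {0..b} S Y sequentially" by simp
  have Yc: "continuous_on {0..b} Y"
    by (rule uniform_limit_theorem[OF _ ul]) (use Sc in auto)
  have AYc: "continuous_on {0..b} (\<lambda>t. A t (Y t))" by (rule cont[OF Yc])
  have Yeq: "Y x = c + integral {0..x} (\<lambda>t. A t (Y t))" if x: "x \<in> {0..b}" for x
  proof -
    have ulA: "uniform_limit {0..x} (\<lambda>n t. A t (S n t)) (\<lambda>t. A t (Y t)) sequentially"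
      unfolding uniform_limit_iff
    proof (intro allI impI)
      fix e :: real assume "e > 0"
      then have "e / L > 0" using \<open>L > 0\<close> by simp
      then have "\<forall>\<^sub>F n in sequentially. \<forall>x\<in>{0..b}. dist (S n x) (Y x) < e / L"
        using ul unfolding uniform_limit_iff by blast
      then show "\<forall>\<^sub>F n in sequentially. \<forall>t\<in>{0..x}. dist (A t (S n t)) (A t (Y t)) < e"
      proof (rule eventually_mono, intro ballI)
        fix n t assume *: "\<forall>x\<in>{0..b}. dist (S n x) (Y x) < e / L" and t: "t \<in> {0..x}"
        have tb: "t \<in> {0..b}" using t x by auto
        have "dist (A t (S n t)) (A t (Y t)) \<le> L * dist (S n t) (Y t)"
          using bndL[OF tb, of "S n t - Y t"] by (simp add: diff dist_norm)
        also have "\<dots> < L * (e / L)" using * tb \<open>L > 0\<close> by (intro mult_strict_left_mono) auto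
        finally show "dist (A t (S n t)) (A t (Y t)) < e" using \<open>L > 0\<close> by simp
      qed
    qed
    obtain I J where IJ: "\<And>n. ((\<lambda>t. A t (S n t)) has_integral I n) {0..x}" "((\<lambda>t. A t (Y t)) has_integral J) {0..x}"
      "(I \<longlongrightarrow> J) sequentially"
      by (rule uniform_limit_integral[OF ulA]) (use x in \<open>auto intro: continuous_on_subset[OF ASc]\<close>)
    have "integral {0..x} (\<lambda>t. A t (S n t)) = I n" for n by (rule integral_unique[OF IJ(1)])
    then have "(\<lambda>n. S (Suc n) x) \<longlonglongrightarrow> c + J"
      unfolding SS using IJ(3) by (auto intro!: tendsto_intros)
    moreover have "(\<lambda>n. S (Suc n) x) \<longlonglongrightarrow> Y x"
      using tendsto_uniform_limitI[OF ul x] by (rule LIMSEQ_Suc)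
    ultimately have "Y x = c + J" using LIMSEQ_unique by blast
    then show ?thesis using IJ(2) by (simp add: integral_unique)
  qed
  have "(Y has_vector_derivative A x (Y x)) (at x within {0..b})" if x: "x \<in> {0..b}" for x
  proof -
    have "((\<lambda>t. c + integral {0..t} (\<lambda>t. A t (Y t))) has_vector_derivative A x (Y x)) (at x within {0..b})"
      using integral_has_vector_derivative[OF AYc x] by (auto intro!: derivative_eq_intros)
    then show ?thesis
      by (rule has_vector_derivative_transform[OF x, rotated]) (use Yeq in auto)
  qed
  then show ?thesis using Yeq[of 0] by (cases "0 \<le> b") auto
qed

section \<open>First properties of solutions, and reflection of the interval\<close>

lemma is_solution_deriv:
  "is_solution q \<zeta> y y' \<Longrightarrow> x \<in> {0..pi} \<Longrightarrow> (y has_vector_derivative y' x) (at x within {0..pi})"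
  by (simp add: is_solution_def)

lemma is_solution_ac_deriv: "is_solution q \<zeta> y y' \<Longrightarrow> ac 0 pi y'"
  by (simp add: is_solution_def)

lemma is_solution_continuous:
  assumes "is_solution q \<zeta> y y'"
  shows "continuous_on {0..pi} y" "continuous_on {0..pi} y'"
  by (rule continuous_on_vector_derivative[OF is_solution_deriv[OF assms]], assumption)
    (rule ac_continuous_on[OF is_solution_ac_deriv[OF assms]])

lemma is_solution_ac:
  assumes "is_solution q \<zeta> y y'" shows "ac 0 pi y"
  by (rule ac_C1[OF is_solution_deriv[OF assms] is_solution_continuous(2)[OF assms]])

lemma ac_bounded_linear:
  assumes "ac a b g" "bounded_linear L"
  shows "ac a b (\<lambda>x. L (g x))"
proof -
  interpret L: bounded_linear L by fact
  obtain K where K: "\<And>v. norm (L v) \<le> norm v * K" using L.bounded by blast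
  show ?thesis
  proof (rule ac_dominated[OF assms(1) assms(1), of _ "K / 2"])
    fix c d
    show "norm (L (g d) - L (g c)) \<le> K / 2 * (norm (g d - g c) + norm (g d - g c))"
      using K[of "g d - g c"] by (simp add: L.diff algebra_simps)
  qed
qed

text \<open>Reflection is the device by which claims at the right end are deduced from claims at the
  left end. The endpoints of each interval swap roles, hence the map \<open>r\<close> in the
  proof.\<close>

lemma ac_reflect:
  fixes g :: "real \<Rightarrow> 'a :: real_normed_vector"
  assumes "ac 0 b g" shows "ac 0 b (\<lambda>x. g (b - x))"
  unfolding absolutely_continuous_on_interval_def
proof (intro allI impI)
  fix e :: real assume "e > 0"
  then obtain \<delta> where d: "\<delta> > 0" "\<And>D. short_intervals 0 b \<delta> D \<Longrightarrow> (\<Sum>(c, d)\<in>D. norm (g d - g c)) < e"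
    using assms(1) unfolding absolutely_continuous_on_interval_def by meson
  show "\<exists>\<delta>>0. \<forall>D. short_intervals 0 b \<delta> D \<longrightarrow> (\<Sum>(c, d)\<in>D. norm (g (b - d) - g (b - c))) < e"
  proof (intro exI[of _ \<delta>] conjI allI impI d)
    fix D :: "(real \<times> real) set"
    assume D: "short_intervals 0 b \<delta> D"
    define r where "r = (\<lambda>z::real\<times>real. (b - snd z, b - fst z))"
    have inj: "inj_on r D" by (auto simp: inj_on_def r_def prod_eq_iff)
    have "(\<Sum>(c, d)\<in>r ` D. norm (g d - g c)) < e"
    proof (rule d(2), intro conjI)
      show "finite (r ` D)" using D by simp
      show "\<forall>(c, d)\<in>r ` D. 0 \<le> c \<and> c < d \<and> d \<le> b" using D by (auto simp: r_def)
      show "pairwise (\<lambda>(c, d) (c', d'). disjnt {c<..<d} {c'<..<d'}) (r ` D)"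
        unfolding pairwise_def
      proof (intro ballI impI)
        fix z z' assume "z \<in> r ` D" "z' \<in> r ` D" "z \<noteq> z'"
        then obtain w w' where w: "w \<in> D" "w' \<in> D" "w \<noteq> w'" "z = r w" "z' = r w'" by blast
        then have dj: "disjnt {fst w<..<snd w} {fst w'<..<snd w'}"
          using D by (simp add: pairwise_def split_def)
        have "disjnt {fst z<..<snd z} {fst z'<..<snd z'}"
          unfolding disjnt_iff
        proof (intro allI notI)
          fix t assume "t \<in> {fst z<..<snd z} \<and> t \<in> {fst z'<..<snd z'}"
          then have "b - t \<in> {fst w<..<snd w} \<and> b - t \<in> {fst w'<..<snd w'}"
            using w by (auto simp: r_def)
          then show False using dj unfolding disjnt_iff by blast
        qed
        then show "(case z of (c, d) \<Rightarrow> \<lambda>(c', d'). disjnt {c<..<d} {c'<..<d'}) z'"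
          by (simp add: split_def)
      qed
      show "(\<Sum>(c, d)\<in>r ` D. d - c) < \<delta>"
        using D by (subst sum.reindex[OF inj]) (simp add: r_def split_def)
    qed
    also have "(\<Sum>(c, d)\<in>r ` D. norm (g d - g c)) = (\<Sum>(c, d)\<in>D. norm (g (b - d) - g (b - c)))"
      by (subst sum.reindex[OF inj]) (simp add: r_def split_def norm_minus_commute)
    finally show "(\<Sum>(c, d)\<in>D. norm (g (b - d) - g (b - c))) < e" .
  qed
qed

lemma negligible_reflect:
  fixes N :: "real set"
  assumes "negligible N" shows "negligible ((\<lambda>x. b - x) ` N)"
proof -
  have "(\<lambda>x. b - x) differentiable_on N"
    by (auto simp: differentiable_on_def intro!: derivative_intros)
  then show ?thesis by (intro negligible_differentiable_image_negligible assms) auto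
qed

lemma reflect_interval: "(\<lambda>x. b - x) ` {0..b} = {0..b::real}"
  by (auto simp: image_iff intro!: bexI[of _ "b - _"])

lemma has_vector_derivative_reflect:
  assumes "(y has_vector_derivative y') (at (b - x) within {0..b})"
  shows "((\<lambda>x. y (b - x)) has_vector_derivative - y') (at x within {0..b})"
proof -
  have "((\<lambda>x. b - x) has_vector_derivative -1) (at x within {0..b})"
    by (auto intro!: derivative_eq_intros)
  from vector_diff_chain_within[OF this, of y y'] assms show ?thesis
    by (simp add: reflect_interval o_def)
qed

lemma has_vector_derivative_reflect_at:
  assumes "(y has_vector_derivative y') (at (b - x))"
  shows "((\<lambda>x. y (b - x)) has_vector_derivative - y') (at x)"
proof -
  have "((\<lambda>x. b - x) has_vector_derivative -1) (at x)"
    by (auto intro!: derivative_eq_intros)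
  from vector_diff_chain_at[OF this assms] show ?thesis by (simp add: o_def)
qed

lemma absolutely_integrable_reflect_interval:
  fixes q :: "real \<Rightarrow> real"
  assumes "q absolutely_integrable_on {0<..<b}"
  shows "(\<lambda>x. q (b - x)) absolutely_integrable_on {0<..<b}"
proof -
  have "q absolutely_integrable_on ((\<lambda>x. b - x) ` {0..b})"
    using assms by (simp add: reflect_interval absolutely_integrable_on_Icc_iff_Ioo)
  then have "(\<lambda>x. \<bar>-1\<bar> *\<^sub>R q (b - x)) absolutely_integrable_on {0..b}"
    by (subst (asm) absolutely_integrable_change_of_variables_real[where h = "\<lambda>_. -1"])
      (auto intro!: derivative_eq_intros simp: inj_on_def)
  then show ?thesis by (simp add: absolutely_integrable_on_Icc_iff_Ioo)
qed

section \<open>Partial fractions and the transformation of boundary functions\<close>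

text \<open>The common denominator, with the orientation used in \<open>fdown\<close>: its values
  are positive below all elements of \<open>H\<close>.\<close>

definition hprod :: "real set \<Rightarrow> real poly" where
  "hprod H = (\<Prod>k\<in>H. [:k, -1:])"

text \<open>The numerator of \<open>\<Sum>k\<in>H. e k / (k - x)\<close> over the common denominator
  \<open>hprod H\<close>.\<close>

definition hsum :: "real set \<Rightarrow> (real \<Rightarrow> real) \<Rightarrow> real poly" where
  "hsum H e = (\<Sum>k\<in>H. smult (e k) (hprod (H - {k})))"

lemma poly_hprod: "poly (hprod H) x = (\<Prod>k\<in>H. k - x)"
  by (simp add: hprod_def poly_prod)

lemma poly_hprod_eq_0_iff: "finite H \<Longrightarrow> poly (hprod H) x = 0 \<longleftrightarrow> x \<in> H"
  by (simp add: poly_hprod)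

lemma hprod_nonzero: "hprod H \<noteq> 0"
proof
  assume "hprod H = 0"
  have "finite H \<Longrightarrow> \<exists>x. x \<notin> H" by (simp add: ex_new_if_finite infinite_UNIV_char_0)
  with \<open>hprod H = 0\<close> show False
    using poly_hprod_eq_0_iff[of H] by (cases "finite H") (auto simp: hprod_def)
qed

lemma degree_hprod: "degree (hprod H) = card H"
  unfolding hprod_def by (subst degree_prod_sum_eq) auto

lemma coeff_hprod_card: "coeff (hprod H) (card H) = (- 1) ^ card H"
proof -
  have "lead_coeff (hprod H) = (- 1) ^ card H"
    unfolding hprod_def by (simp add: lead_coeff_prod)
  then show ?thesis by (simp add: degree_hprod)
qed

lemma hprod_remove: "finite H \<Longrightarrow> k \<in> H \<Longrightarrow> hprod H = [:k, -1:] * hprod (H - {k})"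
  unfolding hprod_def by (rule prod.remove)

lemma poly_hsum: "poly (hsum H e) x = (\<Sum>k\<in>H. e k * (\<Prod>j\<in>H - {k}. j - x))"
  by (simp add: hsum_def poly_sum poly_hprod)

lemma poly_hsum_at:
  assumes "finite H" "k \<in> H"
  shows "poly (hsum H e) k = e k * (\<Prod>j\<in>H - {k}. j - k)"
proof -
  have "(\<Sum>i\<in>H. e i * (\<Prod>j\<in>H - {i}. j - k)) = (\<Sum>i\<in>H. if i = k then e k * (\<Prod>j\<in>H - {k}. j - k) else 0)"
  proof (rule sum.cong[OF refl])
    fix i assume "i \<in> H"
    show "e i * (\<Prod>j\<in>H - {i}. j - k) = (if i = k then e k * (\<Prod>j\<in>H - {k}. j - k) else 0)"
    proof (cases "i = k")
      case False
      then have "(\<Prod>j\<in>H - {i}. j - k) = 0" using assms by (intro prod_zero bexI[of _ k]) auto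
      then show ?thesis using False by simp
    qed simp
  qed
  then show ?thesis using assms by (simp add: poly_hsum)
qed

lemma poly_hsum_off:
  assumes "finite H" "x \<notin> H"
  shows "poly (hsum H e) x = poly (hprod H) x * (\<Sum>k\<in>H. e k / (k - x))"
  unfolding poly_hsum sum_distrib_left
proof (rule sum.cong[OF refl])
  fix k assume k: "k \<in> H"
  then have "k - x \<noteq> 0" using assms by auto
  then show "e k * (\<Prod>j\<in>H - {k}. j - x) = poly (hprod H) x * (e k / (k - x))"
    using prod.remove[OF assms(1) k, of "\<lambda>j. j - x"] by (simp add: poly_hprod)
qed

lemma degree_hsum: "degree (hsum H e) \<le> card H - 1"
proof (cases "finite H")
  case True
  then show ?thesis unfolding hsum_def
    by (intro degree_sum_le) (auto intro!: order_trans[OF degree_smult_le] simp: degree_hprod)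
qed (simp add: hsum_def)

lemma coeff_hsum:
  assumes "finite H"
  shows "coeff (hsum H e) (card H - 1) = (\<Sum>k\<in>H. e k) * (- 1) ^ (card H - 1)"
  unfolding hsum_def coeff_sum sum_distrib_right
proof (rule sum.cong[OF refl])
  fix k assume "k \<in> H"
  then have "card (H - {k}) = card H - 1" using assms by simp
  then show "coeff (smult (e k) (hprod (H - {k}))) (card H - 1) = e k * (- 1) ^ (card H - 1)"
    using coeff_hprod_card[of "H - {k}"] by simp
qed

lemma sum_Fract_same_denominator:
  assumes "d \<noteq> 0" shows "(\<Sum>k\<in>A. Fract (a k) d) = Fract (\<Sum>k\<in>A. a k) d"
proof (induction A rule: infinite_finite_induct)
  case (insert x F)
  then show ?case using assms by (simp add: add_fract eq_fract algebra_simps)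
qed (use assms in \<open>simp_all add: Zero_fract_def eq_fract\<close>)

lemma Fract_extend: "L \<noteq> 0 \<Longrightarrow> P \<noteq> 0 \<Longrightarrow> Fract [:d:] L = Fract (smult d P) (L * P :: real poly)"
  by (simp add: eq_fract mult.commute[of L P])

lemma Fract_clear: "D \<noteq> 0 \<Longrightarrow> Fract (smult c N) 1 = Fract N D * Fract (smult c D) (1 :: real poly)"
  by (simp add: eq_fract)

lemma herglotz_Fract:
  assumes "finite H"
  shows "herglotz h0 h H \<delta> = Fract ([:h, h0:] * hprod H + hsum H \<delta>) (hprod H)"
proof -
  have "(\<Sum>k\<in>H. Fract [:\<delta> k:] [:k, -1:]) = (\<Sum>k\<in>H. Fract (smult (\<delta> k) (hprod (H - {k}))) (hprod H))"
  proof (rule sum.cong[OF refl])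
    fix k assume "k \<in> H"
    then show "Fract [:\<delta> k:] [:k, -1:] = Fract (smult (\<delta> k) (hprod (H - {k}))) (hprod H)"
      unfolding hprod_remove[OF assms \<open>k \<in> H\<close>] by (intro Fract_extend hprod_nonzero) simp
  qed
  also have "\<dots> = Fract (hsum H \<delta>) (hprod H)"
    by (simp add: sum_Fract_same_denominator hprod_nonzero hsum_def)
  finally show ?thesis
    by (simp add: herglotz_def hprod_nonzero add_fract eq_fract)
qed

text \<open>Positive coefficients make every element of \<open>H1\<close> a genuine pole: the
  numerator does not vanish there, so it must be a zero of the other denominator. With the same
  poles, evaluation there gives the same coefficients, and the linear parts are left to
  compare.\<close>

lemma herglotz_unique:
  assumes fin: "finite H1" "finite H2" and pos: "\<forall>k\<in>H1. d1 k > 0" "\<forall>k\<in>H2. d2 k > 0"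
    and eq: "herglotz a1 b1 H1 d1 = herglotz a2 b2 H2 d2"
  shows "a1 = a2 \<and> H1 = H2"
proof -
  have sub: "A \<subseteq> B" if f: "finite A" "finite B" and pos: "\<forall>k\<in>A. u k > 0"
    and eq: "herglotz r p A u = herglotz s t B v" for A B :: "real set" and u v and r p s t
  proof
    fix k assume k: "k \<in> A"
    have "([:p, r:] * hprod A + hsum A u) * hprod B = ([:t, s:] * hprod B + hsum B v) * hprod A"
      using eq f by (simp add: herglotz_Fract eq_fract hprod_nonzero)
    then have "poly (([:p, r:] * hprod A + hsum A u) * hprod B) k = poly (([:t, s:] * hprod B + hsum B v) * hprod A) k"
      by simp
    moreover have "poly (hprod A) k = 0" using k f by (simp add: poly_hprod_eq_0_iff)
    moreover have "poly (hsum A u) k \<noteq> 0" using k f pos by (auto simp: poly_hsum_at)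
    ultimately have "poly (hprod B) k = 0" by auto
    then show "k \<in> B" using f by (simp add: poly_hprod_eq_0_iff)
  qed
  have H: "H1 = H2" using sub[OF fin pos(1) eq] sub[OF fin(2,1) pos(2) eq[symmetric]] by blast
  have neq: "[:b1, a1:] * hprod H1 + hsum H1 d1 = [:b2, a2:] * hprod H1 + hsum H1 d2"
    using eq fin by (simp add: H herglotz_Fract eq_fract hprod_nonzero)
  have "d1 k = d2 k" if k: "k \<in> H1" for k
  proof -
    have "poly (hprod H1) k = 0" using k fin by (simp add: poly_hprod_eq_0_iff)
    with arg_cong[OF neq, of "\<lambda>p. poly p k"] have "poly (hsum H1 d1) k = poly (hsum H1 d2) k" by simp
    moreover have "(\<Prod>j\<in>H1 - {k}. j - k) \<noteq> 0" using fin by simp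
    ultimately show ?thesis using k fin by (simp add: poly_hsum_at)
  qed
  then have "hsum H1 d1 = hsum H1 d2" by (simp add: hsum_def)
  then have "[:b1, a1:] * hprod H1 = [:b2, a2:] * hprod H1" using neq by simp
  then have "[:b1, a1:] = [:b2, a2:]" by (rule mult_right_cancel[OF hprod_nonzero, THEN iffD1])
  then show ?thesis using H by simp
qed

lemma herglotz_rep_unique:
  assumes "herglotz_rep f a b H d" "herglotz_rep f a' b' H' d'"
  shows "a = a' \<and> H = H'"
proof (rule herglotz_unique)
  show "herglotz a b H d = herglotz a' b' H' d'" using assms by (simp add: herglotz_rep_def)
qed (use assms in \<open>auto simp: herglotz_rep_def\<close>)

lemma herglotz_rep_slope:
  assumes "herglotz_rep f h0 h H \<delta>" shows "slope f = h0"
  unfolding slope_def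
proof (rule the_equality)
  fix h0' assume "\<exists>h H \<delta>. herglotz_rep f h0' h H \<delta>"
  then show "h0' = h0" using herglotz_rep_unique[OF assms] by blast
qed (use assms in blast)

lemma herglotz_rep_poles:
  assumes "herglotz_rep f h0 h H \<delta>" shows "poles f = H"
  unfolding poles_def
proof (rule the_equality)
  fix H' assume "\<exists>h0 h \<delta>. herglotz_rep f h0 h H' \<delta>"
  then show "H' = H" using herglotz_rep_unique[OF assms] by blast
qed (use assms in blast)

lemma herglotz_rep_fdown:
  assumes "herglotz_rep f h0 h H \<delta>"
  shows "fdown f = smult (if h0 > 0 then 1 / h0 else 1) (hprod H)"
  using assms herglotz_rep_slope[OF assms] herglotz_rep_poles[OF assms]
  by (auto simp: fdown_def hprod_def herglotz_rep_def)

lemma fup_RatI: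
  assumes "Fract p 1 = r * Fract (fdown (Rat r)) 1" shows "fup (Rat r) = p"
proof (simp only: fup.simps, rule the_equality)
  fix p' assume "Fract p' 1 = r * Fract (fdown (Rat r)) 1"
  then have "Fract p' 1 = Fract p 1" using assms by simp
  then show "p' = p" by (simp add: eq_fract)
qed (rule assms)

lemma herglotz_rep_fup:
  assumes "herglotz_rep f h0 h H \<delta>"
  shows "fup f = smult (if h0 > 0 then 1 / h0 else 1) ([:h, h0:] * hprod H + hsum H \<delta>)"
proof -
  have f: "f = Rat (herglotz h0 h H \<delta>)" "finite H" using assms by (auto simp: herglotz_rep_def)
  show ?thesis
    unfolding f(1)
    by (rule fup_RatI, unfold herglotz_rep_fdown[OF assms, unfolded f(1)])
      (unfold herglotz_Fract[OF f(2)], rule Fract_clear[OF hprod_nonzero])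
qed

lemma herglotz_rep_ind:
  assumes "herglotz_rep f h0 h H \<delta>"
  shows "ind f = (if h0 > 0 then 2 * int (card H) + 1 else 2 * int (card H))"
  using assms herglotz_rep_slope[OF assms] herglotz_rep_poles[OF assms]
  by (auto simp: ind_def herglotz_rep_def)

section \<open>Evaluation at complex points, and the zeros of Herglotz numerators\<close>

abbreviation cpoly :: "real poly \<Rightarrow> 'a::real_normed_field \<Rightarrow> 'a" where
  "cpoly p \<equiv> poly (map_poly of_real p)"

lemma cpoly_pCons [simp]: "cpoly (pCons a p) z = of_real a + z * cpoly p z"
  by (simp add: map_poly_pCons)

lemma cpoly_add: "cpoly (p + q) z = cpoly p z + cpoly q z"
  by (induction p q rule: poly_induct2) (simp_all add: algebra_simps)

lemma cpoly_smult: "cpoly (smult a p) z = of_real a * cpoly p z"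
  by (induction p) (simp_all add: algebra_simps)

lemma cpoly_minus: "cpoly (- p) z = - cpoly p z"
  using cpoly_smult[of "-1" p z] by simp

lemma cpoly_diff: "cpoly (p - q) z = cpoly p z - cpoly q z"
  using cpoly_add[of p "- q" z] by (simp add: cpoly_minus)

lemma cpoly_mult: "cpoly (p * q) z = cpoly p z * cpoly q z"
  by (induction p) (simp_all add: cpoly_add cpoly_smult algebra_simps)

lemma cpoly_sum: "cpoly (\<Sum>k\<in>A. p k) z = (\<Sum>k\<in>A. cpoly (p k) z)"
  by (induction A rule: infinite_finite_induct) (simp_all add: cpoly_add)

lemma cpoly_one [simp]: "cpoly 1 z = 1"
  unfolding one_pCons by simp

lemma cpoly_prod: "cpoly (\<Prod>k\<in>A. p k) z = (\<Prod>k\<in>A. cpoly (p k) z)"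
  by (induction A rule: infinite_finite_induct) (simp_all add: cpoly_mult)

lemma cpoly_of_real: "cpoly p (of_real x) = of_real (poly p x)"
  by (induction p) simp_all

lemma cpoly_hprod: "cpoly (hprod H) z = (\<Prod>k\<in>H. of_real k - z)"
  by (simp add: hprod_def cpoly_prod)

lemma cpoly_hsum_off:
  assumes "finite H" "z \<notin> of_real ` H"
  shows "cpoly (hsum H e) z = cpoly (hprod H) z * (\<Sum>k\<in>H. of_real (e k) / (of_real k - z))"
  unfolding hsum_def cpoly_sum sum_distrib_left
proof (rule sum.cong[OF refl])
  fix k assume k: "k \<in> H"
  then have "of_real k - z \<noteq> 0" using assms by auto
  then show "cpoly (smult (e k) (hprod (H - {k}))) z = cpoly (hprod H) z * (of_real (e k) / (of_real k - z))"
    using prod.remove[OF assms(1) k, of "\<lambda>j. of_real j - z"] by (simp add: cpoly_hprod cpoly_smult)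
qed

text \<open>
  A polynomial \<open>D (h\<^sub>0 + \<Sum> e\<^sub>k / (k - \<lambda>))\<close> with \<open>e\<^sub>k > 0\<close> has only simple real zeros: the factor in
  parentheses maps the upper half plane to itself and is increasing on the real line.
\<close>

lemma herglotz_numerator_nonreal:
  assumes H: "finite H" "H \<noteq> {}" and e: "\<forall>k\<in>H. e k > 0" and z: "Im z \<noteq> 0"
  shows "cpoly (smult h0 (hprod H) + hsum H e) z \<noteq> 0"
proof -
  have zH: "z \<notin> of_real ` H" using z by auto
  have D: "cpoly (hprod H) z \<noteq> 0" using zH H by (auto simp: cpoly_hprod)
  have "Im (\<Sum>k\<in>H. of_real (e k) / (of_real k - z)) = Im z * (\<Sum>k\<in>H. e k / (cmod (of_real k - z))\<^sup>2)"
    unfolding Im_sum sum_distrib_left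
    by (rule sum.cong[OF refl]) (simp add: Im_divide cmod_power2)
  moreover have "(\<Sum>k\<in>H. e k / (cmod (of_real k - z))\<^sup>2) > 0"
    using e zH H by (intro sum_pos) (auto intro!: divide_pos_pos)
  ultimately have "Im (of_real h0 + (\<Sum>k\<in>H. of_real (e k) / (of_real k - z))) \<noteq> 0"
    using z by simp
  then have "of_real h0 + (\<Sum>k\<in>H. of_real (e k) / (of_real k - z)) \<noteq> 0" by (metis zero_complex.sel(2))
  then have "cpoly (hprod H) z * (of_real h0 + (\<Sum>k\<in>H. of_real (e k) / (of_real k - z))) \<noteq> 0"
    using D by simp
  then show ?thesis using H zH by (simp add: cpoly_add cpoly_smult cpoly_hsum_off algebra_simps)
qed

text \<open>The explicit value of the derivative serves twice. It is nonzero, so the root is simple;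
  and its sign relative to \<open>hprod H\<close> makes the coefficients of the negative reciprocal
  positive.\<close>

lemma herglotz_numerator_pderiv:
  assumes H: "finite H" and e: "\<forall>k\<in>H. e k > 0" and nz: "H \<noteq> {} \<or> h0 \<noteq> 0"
    and r: "poly (smult h0 (hprod H) + hsum H e) r = 0"
  shows "\<exists>S>0. poly (pderiv (smult h0 (hprod H) + hsum H e)) r = poly (hprod H) r * S \<and> r \<notin> H"
proof -
  let ?G = "smult h0 (hprod H) + hsum H e"
  define g where "g = (\<lambda>x. h0 + (\<Sum>k\<in>H. e k / (k - x)))"
  define S where "S = (\<Sum>k\<in>H. e k / (k - r)\<^sup>2)"
  have G: "poly ?G x = poly (hprod H) x * g x" if "x \<notin> H" for x
    using that H by (simp add: poly_hsum_off g_def algebra_simps)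
  have rH: "r \<notin> H"
  proof
    assume rH: "r \<in> H"
    then have "poly (hprod H) r = 0" using H by (simp add: poly_hprod_eq_0_iff)
    then have "poly (hsum H e) r = 0" using r by simp
    moreover have "(\<Prod>j\<in>H - {r}. j - r) \<noteq> 0" using H by simp
    ultimately show False using rH H e by (auto simp: poly_hsum_at)
  qed
  have Dr: "poly (hprod H) r \<noteq> 0" using rH H by (simp add: poly_hprod_eq_0_iff)
  then have gr: "g r = 0" using G[OF rH] r by simp
  then have "H \<noteq> {}" using nz by (auto simp: g_def)
  then have "S > 0" unfolding S_def using H e rH by (intro sum_pos) (auto intro!: divide_pos_pos)
  have dg: "(g has_real_derivative S) (at r)"
  proof -
    have "((\<lambda>x. e k / (k - x)) has_real_derivative e k / (k - r)\<^sup>2) (at r)" if "k \<in> H" for k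
    proof -
      have "k - r \<noteq> 0" using that rH by auto
      then show ?thesis by (auto intro!: derivative_eq_intros simp: power2_eq_square)
    qed
    then have "((\<lambda>x. \<Sum>k\<in>H. e k / (k - x)) has_real_derivative (\<Sum>k\<in>H. e k / (k - r)\<^sup>2)) (at r)"
      by (rule DERIV_sum)
    from DERIV_add[OF DERIV_const[of h0] this] show ?thesis by (simp add: g_def S_def)
  qed
  have "((\<lambda>x. poly (hprod H) x * g x) has_real_derivative poly (hprod H) r * S) (at r)"
    using DERIV_mult[OF poly_DERIV[of "hprod H" r] dg] gr by (simp add: mult.commute)
  moreover have "eventually (\<lambda>x. poly (hprod H) x * g x = poly ?G x) (nhds r)"
  proof -
    have "eventually (\<lambda>x. x \<in> - H) (nhds r)"
      using rH H by (intro eventually_nhds_in_open) (auto simp: open_Compl finite_imp_closed)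
    then show ?thesis by (rule eventually_mono) (rule G[symmetric], simp)
  qed
  ultimately have "((\<lambda>x. poly ?G x) has_real_derivative poly (hprod H) r * S) (at r)"
    by (subst (asm) DERIV_cong_ev[OF refl _ refl]) auto
  then have "poly (pderiv ?G) r = poly (hprod H) r * S"
    using poly_DERIV DERIV_unique by blast
  then show ?thesis using \<open>S > 0\<close> rH by blast
qed

lemma poly_pderiv_at_simple_root:
  "poly (pderiv ([:r, -1:] * P)) r = - poly P (r :: real)"
  by (simp only: pderiv_mult poly_add poly_mult) (simp add: pderiv_pCons)

lemma poly_eq_smult_hprod:
  "smult c (\<Prod>z\<in>complex_of_real ` R. [:-z, 1:]) = map_poly of_real G \<Longrightarrow> c = of_real l \<Longrightarrow>
    G = smult (l * (- 1) ^ card R) (hprod R)"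
proof -
  assume *: "smult c (\<Prod>z\<in>complex_of_real ` R. [:-z, 1:]) = map_poly of_real G" "c = of_real l"
  have "poly G x = poly (smult (l * (- 1) ^ card R) (hprod R)) x" for x
  proof -
    have "complex_of_real (poly G x) = cpoly G (complex_of_real x)" by (simp add: cpoly_of_real)
    also have "\<dots> = of_real l * (\<Prod>z\<in>complex_of_real ` R. of_real x - z)"
      by (simp add: *(1)[symmetric] *(2) poly_prod)
    also have "\<dots> = of_real (l * (\<Prod>r\<in>R. x - r))"
      by (subst prod.reindex) (auto simp: inj_on_def)
    finally have "poly G x = l * (\<Prod>r\<in>R. x - r)" by (simp only: of_real_eq_iff)
    also have "(\<Prod>r\<in>R. x - r) = (\<Prod>r\<in>R. (-1) * (r - x))" by (intro prod.cong) auto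
    also have "\<dots> = (- 1) ^ card R * (\<Prod>r\<in>R. r - x)" by (simp only: prod.distrib prod_constant)
    finally show ?thesis by (simp add: poly_hprod)
  qed
  then show ?thesis by (simp only: poly_eq_poly_eq_iff[symmetric] fun_eq_iff) simp
qed

text \<open>There are neither nonreal nor multiple roots, so the complex factorization consists of
  distinct real linear factors, as many as the degree.\<close>

lemma herglotz_numerator_factorization:
  assumes H: "finite H" and e: "\<forall>k\<in>H. e k > 0" and nz: "H \<noteq> {} \<or> h0 \<noteq> 0"
    and G: "G = smult h0 (hprod H) + hsum H e" and G0: "G \<noteq> 0"
  obtains R where "finite R" "\<And>r. r \<in> R \<longleftrightarrow> poly G r = 0" "card R = degree G"
    "G = smult (lead_coeff G * (- 1) ^ card R) (hprod R)"
proof -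
  define R where "R = {r. poly G r = 0}"
  have finR: "finite R" unfolding R_def using G0 by (rule poly_roots_finite)
  define cG where "cG = map_poly complex_of_real G"
  have real_root: "z \<in> complex_of_real ` R" if "poly cG z = 0" for z
  proof -
    have "Im z = 0"
    proof (cases "H = {}")
      case True
      then show ?thesis using that nz by (simp add: cG_def G hsum_def hprod_def cpoly_add cpoly_smult)
    next
      case False
      then show ?thesis using herglotz_numerator_nonreal[OF H False e, of z h0] that by (auto simp: cG_def G)
    qed
    then have "z = complex_of_real (Re z)" by (simp add: complex_eq_iff)
    moreover from this have "poly G (Re z) = 0" using that by (metis cG_def cpoly_of_real of_real_eq_0_iff)
    ultimately show ?thesis by (auto simp: R_def)
  qed
  have Rroot: "poly cG (complex_of_real r) = 0" if "r \<in> R" for r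
    using that by (simp add: cG_def cpoly_of_real R_def)
  have roots: "{z. poly cG z = 0} = complex_of_real ` R"
    using real_root Rroot by blast
  have pd: "pderiv cG = map_poly complex_of_real (pderiv G)"
    by (intro poly_eqI) (simp add: cG_def coeff_pderiv coeff_map_poly)
  have sf: "rsquarefree cG"
    unfolding rsquarefree_roots
  proof (intro allI notI)
    fix z assume z: "poly cG z = 0 \<and> poly (pderiv cG) z = 0"
    then obtain r where r: "r \<in> R" "z = complex_of_real r" using real_root by blast
    have "poly (pderiv G) r = 0" using z r by (simp add: pd cpoly_of_real)
    moreover have "poly G r = 0" using r by (simp add: R_def)
    then obtain S where "S > 0" "poly (pderiv G) r = poly (hprod H) r * S" "r \<notin> H"
      using herglotz_numerator_pderiv[OF H e nz, of r] by (auto simp: G)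
    ultimately show False using H by (simp add: poly_hprod_eq_0_iff)
  qed
  have lc: "lead_coeff cG = complex_of_real (lead_coeff G)" "degree cG = degree G"
    by (simp_all add: cG_def degree_map_poly coeff_map_poly)
  have inj: "inj_on complex_of_real R" by (simp add: inj_on_def)
  have dec: "smult (lead_coeff cG) (\<Prod>z\<in>complex_of_real ` R. [:-z, 1:]) = cG"
    using complex_poly_decompose_rsquarefree[OF sf] by (simp add: roots)
  have cR: "card R = degree G"
  proof -
    have "degree (\<Prod>z\<in>complex_of_real ` R. [:-z, 1:]) = card (complex_of_real ` R)"
      by (subst degree_prod_sum_eq) auto
    then have "degree cG = card (complex_of_real ` R)"
      using arg_cong[OF dec, of degree] G0 lc by simp
    then show ?thesis using lc inj by (simp add: card_image)
  qed
  have "G = smult (lead_coeff G * (- 1) ^ card R) (hprod R)"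
    by (rule poly_eq_smult_hprod[OF dec[unfolded cG_def] lc(1)[unfolded cG_def]])
  then show thesis using that[of R] finR cR by (simp add: R_def)
qed

text \<open>Division of \<open>- hprod H\<close> by \<open>G\<close> leaves a constant or linear
  quotient, and the remainder is determined by its values at the roots of \<open>G\<close>. The last
  conclusion records the number of poles and the leading factor, from which the index and the
  normalization of \<open>fdown\<close> are read off later.\<close>

lemma inverse_herglotz:
  assumes H: "finite H" and e: "\<forall>k\<in>H. e k > 0" and h0: "h0 \<ge> 0" and nz: "H \<noteq> {} \<or> h0 > 0"
    and G: "G = smult h0 (hprod H) + hsum H e"
  obtains a b R d where "a \<ge> 0" "finite R" "\<forall>r\<in>R. d r > 0" "G \<noteq> 0"
    "Fract (- hprod H) G = herglotz a b R d"
    "if h0 > 0 then a = 0 \<and> G = smult h0 (hprod R) \<and> card R = card H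
     else a > 0 \<and> G = smult (1 / a) (hprod R) \<and> card H = card R + 1"
proof -
  define n where "n = card H"
  define s where "s = (\<Sum>k\<in>H. e k)"
  have s0: "s > 0" if "H \<noteq> {}" unfolding s_def using H e that by (intro sum_pos) auto
  have n0: "n > 0 \<longleftrightarrow> H \<noteq> {}" using H by (auto simp: n_def card_gt_0_iff)
  \<comment> \<open>\<open>m\<close> is the degree of \<open>G\<close>, and \<open>l\<close> the
    absolute value of its leading coefficient. For \<open>h0 = 0\<close> the leading term comes from
    \<open>hsum\<close>, one degree lower.\<close>
  define m where "m = (if h0 > 0 then n else n - 1)"
  define l where "l = (if h0 > 0 then h0 else s)"
  have l0: "l > 0" using s0 nz h0 by (auto simp: l_def)
  have nm: "n = (if h0 > 0 then m else m + 1)" using n0 nz h0 by (auto simp: m_def)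
  have dD: "degree (hprod H) = n" and cD: "coeff (hprod H) n = (- 1) ^ n"
    using degree_hprod[of H] coeff_hprod_card[of H] by (auto simp: n_def)
  have dS: "degree (hsum H e) \<le> n - 1" and cS: "coeff (hsum H e) (n - 1) = s * (- 1) ^ (n - 1)"
    using degree_hsum[of H e] coeff_hsum[OF H, of e] by (auto simp: n_def s_def)
  have dGle: "degree G \<le> m"
  proof (cases "h0 > 0")
    case True
    then show ?thesis unfolding G m_def using dD dS
      by (auto intro!: degree_add_le order_trans[OF degree_smult_le])
  next
    case False
    then show ?thesis unfolding G m_def using h0 dS by auto
  qed
  have cG: "coeff G m = l * (- 1) ^ m"
  proof (cases "h0 > 0")
    case True
    have "coeff (hsum H e) n = 0"
    proof (cases "n = 0")
      case True
      then show ?thesis using n0 by (simp add: hsum_def)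
    next
      case False
      then show ?thesis using dS by (intro coeff_eq_0) linarith
    qed
    then show ?thesis using True by (simp add: G m_def l_def cD)
  next
    case False
    then show ?thesis using h0 cS by (simp add: G m_def l_def)
  qed
  have dG: "degree G = m"
    using dGle cG l0 by (intro antisym le_degree) auto
  have G0: "G \<noteq> 0" using cG l0 by auto
  have nz': "H \<noteq> {} \<or> h0 \<noteq> 0" using nz by auto
  obtain R where R: "finite R" "\<And>r. r \<in> R \<longleftrightarrow> poly G r = 0" "card R = degree G"
    "G = smult (lead_coeff G * (- 1) ^ card R) (hprod R)"
    using herglotz_numerator_factorization[OF H e nz' G G0] by blast
  have GR: "G = smult l (hprod R)"
  proof -
    have "lead_coeff G * (- 1) ^ card R = l" using R(3) by (simp add: dG cG power_add[symmetric] mult.assoc)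
    then show ?thesis using R(4) by metis
  qed
  define P where "P = - hprod H"
  define B where "B = P div G"
  define M where "M = P mod G"
  have PBM: "P = B * G + M" by (simp add: B_def M_def)
  have dM: "M = 0 \<or> degree M < m" using degree_mod_less[OF G0, of P] by (simp add: M_def dG)
  have dP: "degree P = n" "P \<noteq> 0" using dD hprod_nonzero[of H] by (auto simp: P_def)
  have B: "B = [:coeff B 0, coeff B 1:] \<and> (if h0 > 0 then coeff B 1 = 0 else coeff B 1 = 1 / l)"
  proof -
    have dB: "degree B \<le> n - m"
    proof (cases "B = 0")
      case False
      then have "degree B + m = degree (B * G)" using G0 by (simp add: degree_mult_eq dG)
      also have "\<dots> = degree (P - M)" by (simp add: PBM)
      also have "\<dots> \<le> n" using dM dP nm by (intro degree_diff_le) (auto split: if_splits)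
      finally show ?thesis by simp
    qed simp
    then have dB1: "degree B \<le> 1" using nm by (auto split: if_splits)
    have Beq: "B = [:coeff B 0, coeff B 1:]"
    proof (rule poly_eqI)
      fix i
      show "coeff B i = coeff [:coeff B 0, coeff B 1:] i"
      proof (cases "i \<le> 1")
        case True
        then have "i = 0 \<or> i = 1" by auto
        then show ?thesis by auto
      next
        case False
        then have "coeff B i = 0" using dB1 by (intro coeff_eq_0) auto
        then show ?thesis using False by (auto simp: coeff_pCons split: nat.splits)
      qed
    qed
    have "coeff B 1 = 1 / l" if "\<not> h0 > 0"
    proof -
      have nm1: "n = Suc m" using nm that by simp
      have "coeff P (Suc m) = coeff (B * G) (Suc m) + coeff M (Suc m)" by (simp add: PBM)
      also have "coeff M (Suc m) = 0" using dM by (auto intro!: coeff_eq_0)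
      also have "coeff (B * G) (Suc m) = coeff B 1 * coeff G m + coeff B 0 * coeff G (Suc m)"
        by (subst Beq) (simp add: algebra_simps)
      also have "coeff G (Suc m) = 0" using dG by (intro coeff_eq_0) simp
      finally have "- ((- 1) ^ Suc m) = coeff B 1 * (l * (- 1) ^ m)"
        using cD nm1 by (simp add: P_def cG)
      then have "(- 1) ^ m * (coeff B 1 * l) = (- 1) ^ m * 1" by (simp add: algebra_simps)
      then have "coeff B 1 * l = 1" by (subst (asm) mult_cancel_left) simp
      then show ?thesis using l0 by (simp add: field_simps)
    qed
    moreover have "coeff B 1 = 0" if "h0 > 0"
      using dB nm that by (intro coeff_eq_0) auto
    ultimately show ?thesis using Beq by auto
  qed
  \<comment> \<open>The coefficients that interpolate the remainder at the roots of
    \<open>G\<close>. By the derivative formula each of them is \<open>1 / S\<close> with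
    \<open>S > 0\<close>.\<close>
  define d where "d = (\<lambda>r. - poly (hprod H) r / (l * (\<Prod>j\<in>R - {r}. j - r)))"
  have dpos: "d r > 0" if r: "r \<in> R" for r
  proof -
    obtain S where S: "S > 0" "poly (pderiv G) r = poly (hprod H) r * S" "r \<notin> H"
      using herglotz_numerator_pderiv[OF H e nz', of r] R(2)[of r] r by (auto simp: G)
    have "G = [:r, -1:] * smult l (hprod (R - {r}))"
      using GR hprod_remove[OF R(1) r] by simp
    then have "poly (pderiv G) r = - poly (smult l (hprod (R - {r}))) r"
      by (simp only: poly_pderiv_at_simple_root)
    then have eq: "l * (\<Prod>j\<in>R - {r}. j - r) = - (poly (hprod H) r * S)"
      using S(2) by (simp add: poly_hprod)
    have "poly (hprod H) r \<noteq> 0" using S(3) H by (simp add: poly_hprod_eq_0_iff)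
    then have "d r = 1 / S" unfolding d_def eq using S(1) by (simp add: field_simps)
    then show ?thesis using S(1) by simp
  qed
  have Meq: "M = smult l (hsum R d)"
  proof (cases "R = {}")
    case True
    then have "m = 0" using R(3) dG by simp
    then show ?thesis using dM True by (simp add: hsum_def)
  next
    case False
    show ?thesis
    proof (rule poly_eqI_degree[of R])
      have "card R > 0" using False R(1) by (simp add: card_gt_0_iff)
      then show "degree M < card R" using dM R(3) dG by auto
      show "degree (smult l (hsum R d)) < card R"
        using \<open>card R > 0\<close> degree_hsum[of R d] degree_smult_le[of l "hsum R d"] by linarith
      fix r assume r: "r \<in> R"
      have "poly G r = 0" using R(2) r by simp
      then have "poly M r = poly P r" using arg_cong[OF PBM, of "\<lambda>p. poly p r"] by simp
      also have "\<dots> = - poly (hprod H) r" by (simp add: P_def)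
      also have "\<dots> = l * (d r * (\<Prod>j\<in>R - {r}. j - r))"
      proof -
        have "(\<Prod>j\<in>R - {r}. j - r) \<noteq> 0" using R(1) by simp
        then show ?thesis using l0 by (simp add: d_def field_simps)
      qed
      also have "\<dots> = poly (smult l (hsum R d)) r" using poly_hsum_at[OF R(1) r] by simp
      finally show "poly M r = poly (smult l (hsum R d)) r" .
    qed
  qed
  have Fr: "Fract (- hprod H) G = herglotz (coeff B 1) (coeff B 0) R d"
  proof -
    have "- hprod H = B * smult l (hprod R) + smult l (hsum R d)"
      using PBM GR Meq by (simp add: P_def)
    then have "- hprod H = smult l (B * hprod R + hsum R d)" by (simp add: smult_add_right)
    then have "Fract (- hprod H) G = Fract (B * hprod R + hsum R d) (hprod R)"
      using GR G0 l0 hprod_nonzero[of R] by (simp add: eq_fract)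
    then show ?thesis using B herglotz_Fract[OF R(1)] by metis
  qed
  show thesis
  proof (rule that[OF _ R(1) _ G0 Fr])
    show "0 \<le> coeff B 1" using B l0 by (auto split: if_splits)
    show "\<forall>r\<in>R. d r > 0" using dpos by blast
    show "if h0 > 0 then coeff B 1 = 0 \<and> G = smult h0 (hprod R) \<and> card R = card H
     else coeff B 1 > 0 \<and> G = smult (1 / coeff B 1) (hprod R) \<and> card H = card R + 1"
      using B l0 GR R(3) dG nm by (auto simp: l_def n_def[symmetric] split: if_splits)
  qed
qed

lemma Fract_const_diff: "D \<noteq> 0 \<Longrightarrow> Fract N D - Fract [:t:] 1 = Fract (N - smult t D) (D :: real poly)"
  by (simp add: eq_fract)

lemma Fract_quotient:
  assumes "L \<noteq> 0" "G \<noteq> 0" "D \<noteq> (0 :: real poly)"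
  shows "Fract (- L) 1 / Fract (L * G) D = Fract (- D) G"
  using assms by (simp add: eq_fract)

lemma herglotz_diff_const: "herglotz a b R d - Fract [:t:] 1 = herglotz a (b - t) R d"
proof -
  have "Fract [:b, a:] 1 - Fract [:t:] 1 = Fract [:b - t, a:] (1 :: real poly)" by simp
  moreover have "x + s - y = (x - y) + s" for x s y :: "real poly fract" by simp
  ultimately show ?thesis unfolding herglotz_def by (simp only:)
qed

lemma herglotz_const_iff:
  assumes "D \<noteq> 0" "L \<noteq> 0"
  shows "Fract N D = Fract [:t:] 1 \<longleftrightarrow> N - smult t D = (0 :: real poly)"
  using assms by (simp add: eq_fract)

lemma class_R_cases:
  assumes "f \<in> class_R" "f \<noteq> Infty"
  obtains h0 h H \<delta> where "herglotz_rep f h0 h H \<delta>"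
  using assms by (auto simp: class_R_def)

lemma ind_Infty [simp]: "ind Infty = -1" by (simp add: ind_def)

lemma ind_nonneg_iff: "ind f \<ge> 0 \<longleftrightarrow> f \<noteq> Infty" by (simp add: ind_def)

lemma fdown_Infty [simp]: "fdown Infty = 0" by (simp add: fdown_def)

lemma constant_rep: "herglotz_rep (Rat (Fract [:t:] 1)) 0 t {} \<delta>"
  by (simp add: herglotz_rep_def herglotz_def)

lemma fdown_constant [simp]: "fdown (Rat (Fract [:t:] 1)) = 1"
  using herglotz_rep_fdown[OF constant_rep, of t] by (simp add: hprod_def)

lemma fup_constant [simp]: "fup (Rat (Fract [:t:] 1)) = [:t:]"
  using herglotz_rep_fup[OF constant_rep, of t] by (simp add: hprod_def hsum_def)

lemma ind_constant [simp]: "ind (Rat (Fract [:t:] 1)) = 0"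
  using herglotz_rep_ind[OF constant_rep, of t] by simp

lemma constant_class_R: "Rat (Fract [:t:] 1) \<in> class_R"
  using constant_rep[of t "\<lambda>_. 0"] unfolding class_R_def by blast

text \<open>
  \<open>f(\<lambda>) - f(\<mu>) = (\<lambda> - \<mu>) g(\<lambda>)\<close> with \<open>g(\<lambda>) = h\<^sub>0 + \<Sum> \<delta>\<^sub>k / ((h\<^sub>k - \<mu>) (h\<^sub>k - \<lambda>))\<close>, and the
  transform of \<open>f\<close> is \<open>- 1 / g - f(\<mu>)\<close>.
\<close>

lemma poly_eqI_infinite:
  fixes p q :: "'a :: idom poly"
  assumes "infinite {x. poly p x = poly q x}" shows "p = q"
proof (rule ccontr)
  assume "p \<noteq> q"
  then have "finite {x. poly (p - q) x = 0}" by (intro poly_roots_finite) simp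
  then show False using assms by simp
qed

lemma herglotz_difference_quotient:
  assumes H: "finite H" and \<mu>: "\<forall>k\<in>H. \<mu> < k"
    and tau: "t = poly ([:h, h0:] * hprod H + hsum H \<delta>) \<mu> / poly (hprod H) \<mu>"
  shows "[:h, h0:] * hprod H + hsum H \<delta> - smult t (hprod H)
    = [:- \<mu>, 1:] * (smult h0 (hprod H) + hsum H (\<lambda>k. \<delta> k / (k - \<mu>)))"
    (is "?l = ?r")
proof (rule poly_eqI_infinite)
  have "infinite (- H)" using H by (simp add: Compl_eq_Diff_UNIV Diff_infinite_finite infinite_UNIV_char_0)
  moreover have "- H \<subseteq> {x. poly ?l x = poly ?r x}"
  proof
    fix x assume "x \<in> - H"
    then have xH: "x \<notin> H" by simp
    have \<mu>H: "\<mu> \<notin> H" using \<mu> by auto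
    have "poly (hprod H) \<mu> \<noteq> 0" using \<mu>H H by (simp add: poly_hprod_eq_0_iff)
    then have t: "t = h + \<mu> * h0 + (\<Sum>k\<in>H. \<delta> k / (k - \<mu>))"
    proof -
      have "poly ([:h, h0:] * hprod H + hsum H \<delta>) \<mu> = poly (hprod H) \<mu> * (h + \<mu> * h0 + (\<Sum>k\<in>H. \<delta> k / (k - \<mu>)))"
        using poly_hsum_off[OF H \<mu>H, of \<delta>] by (simp add: algebra_simps)
      then show ?thesis using tau \<open>poly (hprod H) \<mu> \<noteq> 0\<close> by (metis nonzero_mult_div_cancel_left)
    qed
    have difference: "(\<Sum>k\<in>H. \<delta> k / (k - x)) - (\<Sum>k\<in>H. \<delta> k / (k - \<mu>)) = (x - \<mu>) * (\<Sum>k\<in>H. \<delta> k / (k - \<mu>) / (k - x))"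
      unfolding sum_subtractf[symmetric] sum_distrib_left
    proof (rule sum.cong[OF refl])
      fix k assume "k \<in> H"
      then have "k - x \<noteq> 0" "k - \<mu> \<noteq> 0" using xH \<mu>H by auto
      then show "\<delta> k / (k - x) - \<delta> k / (k - \<mu>) = (x - \<mu>) * (\<delta> k / (k - \<mu>) / (k - x))"
        by (simp add: field_simps)
    qed
    have "poly (hprod H) x * (h + x * h0 + (\<Sum>k\<in>H. \<delta> k / (k - x)) - t)
      = poly (hprod H) x * ((x - \<mu>) * (h0 + (\<Sum>k\<in>H. \<delta> k / (k - \<mu>) / (k - x))))"
    proof -
      have "a1 - a2 = (x - \<mu>) * s \<Longrightarrow> h + x * h0 + a1 - (h + \<mu> * h0 + a2) = (x - \<mu>) * (h0 + s)" for a1 a2 s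
        by (simp add: algebra_simps)
      from this[OF difference]
      show ?thesis unfolding t by (simp only:)
    qed
    then show "x \<in> {x. poly ?l x = poly ?r x}"
      using poly_hsum_off[OF H xH] by (simp add: algebra_simps)
  qed
  ultimately show "infinite {x. poly ?l x = poly ?r x}" using infinite_super by blast
qed

text \<open>The factor \<open>1 / h0\<close> in \<open>fdown\<close> is what lets the two polynomial
  identities hold without stray constants: \<open>fdown\<close> of the transform is
  \<open>smult c G\<close> with the same \<open>c\<close> as for \<open>f\<close>, whether the slope
  of \<open>f\<close> is positive or zero.\<close>

lemma Theta_class_R:
  assumes f: "f \<in> class_R" "f \<noteq> Infty" and \<mu>: "\<forall>k\<in>poles f. \<mu> < k"
    and tau: "t = poly (fup f) \<mu> / poly (fdown f) \<mu>"
  shows "Theta \<mu> t f \<in> class_R \<and> ind (Theta \<mu> t f) = ind f - 1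
    \<and> fup f - smult t (fdown f) = [:- \<mu>, 1:] * fdown (Theta \<mu> t f)
    \<and> fup (Theta \<mu> t f) = - fdown f - smult t (fdown (Theta \<mu> t f))
    \<and> poly (fdown (Theta \<mu> t f)) \<mu> \<ge> 0"
proof -
  obtain h0 h H \<delta> where rep: "herglotz_rep f h0 h H \<delta>" using f by (rule class_R_cases)
  then have H: "finite H" "h0 \<ge> 0" "\<forall>k\<in>H. \<delta> k > 0" and fR: "f = Rat (herglotz h0 h H \<delta>)"
    by (auto simp: herglotz_rep_def)
  have \<mu>H: "\<forall>k\<in>H. \<mu> < k" using \<mu> herglotz_rep_poles[OF rep] by simp
  define c where "c = (if h0 > 0 then 1 / h0 else 1)"
  have c0: "c > 0" using H by (simp add: c_def)
  define D where "D = hprod H"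
  define N where "N = [:h, h0:] * hprod H + hsum H \<delta>"
  define e where "e = (\<lambda>k. \<delta> k / (k - \<mu>))"
  have epos: "\<forall>k\<in>H. e k > 0" using H \<mu>H by (simp add: e_def)
  define G where "G = smult h0 (hprod H) + hsum H e"
  have D0: "D \<noteq> 0" by (simp add: D_def hprod_nonzero)
  have fd: "fdown f = smult c D" using herglotz_rep_fdown[OF rep] by (simp only: c_def D_def)
  have fu: "fup f = smult c N" using herglotz_rep_fup[OF rep] by (simp only: c_def N_def)
  have tau': "t = poly N \<mu> / poly D \<mu>" using tau c0 by (simp add: fd fu)
  have NG: "N - smult t D = [:- \<mu>, 1:] * G"
    using herglotz_difference_quotient[OF H(1) \<mu>H tau'[unfolded N_def D_def]]
    by (simp only: N_def D_def G_def e_def)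
  have fF: "herglotz h0 h H \<delta> = Fract N D" using herglotz_Fract[OF H(1)] by (simp only: N_def D_def)
  have first: "fup f - smult t (fdown f) = [:- \<mu>, 1:] * smult c G"
  proof -
    have "fup f - smult t (fdown f) = smult c (N - smult t D)"
      by (simp add: fd fu smult_diff_right mult.commute)
    then show ?thesis by (simp only: NG mult_smult_right)
  qed
  show ?thesis
  proof (cases "H \<noteq> {} \<or> h0 > 0")
    \<comment> \<open>Here \<open>f\<close> is the constant \<open>t\<close> and the transform is
      \<open>Infty\<close>; the convention 0 and -1 for its two polynomials is exactly the one that
      fits the identities.\<close>
    case False
    then have "H = {}" "h0 = 0" using H by auto
    then have G0: "G = 0" by (simp add: G_def hsum_def)
    then have "N - smult t D = 0" using NG by simp
    then have "herglotz h0 h H \<delta> = Fract [:t:] 1"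
      using D0 by (subst fF, subst herglotz_const_iff[where L = 1]) auto
    then have T: "Theta \<mu> t f = Infty" by (simp add: fR)
    have "D = 1" "c = 1" using \<open>H = {}\<close> \<open>h0 = 0\<close> by (simp_all add: D_def hprod_def c_def)
    moreover have "ind f = 0" using herglotz_rep_ind[OF rep] \<open>H = {}\<close> \<open>h0 = 0\<close> by simp
    ultimately show ?thesis using first G0 by (simp add: T fd class_R_def one_pCons)
  next
    case True
    obtain a b R d where R: "a \<ge> 0" "finite R" "\<forall>r\<in>R. d r > 0" "G \<noteq> 0"
      "Fract (- hprod H) G = herglotz a b R d"
      "if h0 > 0 then a = 0 \<and> G = smult h0 (hprod R) \<and> card R = card H
       else a > 0 \<and> G = smult (1 / a) (hprod R) \<and> card H = card R + 1"
      by (rule inverse_herglotz[OF H(1) epos H(2) True G_def])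
    have L0: "[:- \<mu>, 1:] \<noteq> 0" by simp
    have nc: "herglotz h0 h H \<delta> \<noteq> Fract [:t:] 1"
      unfolding fF herglotz_const_iff[OF D0 L0] NG using R(4) L0 by (simp only: mult_eq_0_iff) simp
    have "Fract [:\<mu>, -1:] 1 / (herglotz h0 h H \<delta> - Fract [:t:] 1) - Fract [:t:] 1 = herglotz a (b - t) R d"
    proof -
      have "Fract [:\<mu>, -1:] 1 / (herglotz h0 h H \<delta> - Fract [:t:] 1) = Fract (- [:- \<mu>, 1:]) 1 / Fract ([:- \<mu>, 1:] * G) D"
        by (simp only: fF Fract_const_diff[OF D0] NG) simp
      also have "\<dots> = Fract (- D) G" by (rule Fract_quotient[OF L0 R(4) D0])
      finally show ?thesis using R(5) by (simp only: D_def herglotz_diff_const)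
    qed
    then have T: "Theta \<mu> t f = Rat (herglotz a (b - t) R d)" using nc by (simp add: fR)
    have repT: "herglotz_rep (Theta \<mu> t f) a (b - t) R d"
      unfolding herglotz_rep_def using T R by simp
    have cls: "Theta \<mu> t f \<in> class_R" unfolding class_R_def using repT by blast
    have indT: "ind (Theta \<mu> t f) = ind f - 1"
    proof (cases "h0 > 0")
      case True
      then have "a = 0" "card R = card H" using R(6) by auto
      then show ?thesis unfolding herglotz_rep_ind[OF rep] herglotz_rep_ind[OF repT] using True by simp
    next
      case False
      then have "a > 0" "card H = card R + 1" using R(6) by auto
      then show ?thesis unfolding herglotz_rep_ind[OF rep] herglotz_rep_ind[OF repT] using False by simp
    qed
    have fdT: "fdown (Theta \<mu> t f) = smult c G"
    proof (cases "h0 > 0")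
      case True
      then have "a = 0" and G: "G = smult h0 (hprod R)" using R(6) by auto
      then show ?thesis unfolding herglotz_rep_fdown[OF repT] G using True by (simp add: c_def)
    next
      case False
      then have "a > 0" and G: "G = smult (1 / a) (hprod R)" using R(6) by auto
      then show ?thesis unfolding herglotz_rep_fdown[OF repT] G using False by (simp add: c_def)
    qed
    have fuT: "fup (Theta \<mu> t f) = - fdown f - smult t (fdown (Theta \<mu> t f))"
      unfolding T
    proof (rule fup_RatI)
      have "herglotz a (b - t) R d = Fract (- D) G - Fract [:t:] 1"
        using R(5) by (simp only: D_def herglotz_diff_const)
      also have "\<dots> = Fract (- D - smult t G) G" by (rule Fract_const_diff[OF R(4)])
      finally have "herglotz a (b - t) R d * Fract (fdown (Rat (herglotz a (b - t) R d))) 1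
          = Fract (- D - smult t G) G * Fract (smult c G) 1" using fdT T by simp
      also have "\<dots> = Fract (smult c (- D - smult t G)) 1" by (rule Fract_clear[OF R(4), symmetric])
      also have "smult c (- D - smult t G) = - fdown f - smult t (fdown (Rat (herglotz a (b - t) R d)))"
        using fdT T by (simp add: fd smult_diff_right mult.commute)
      finally show "Fract (- fdown f - smult t (fdown (Rat (herglotz a (b - t) R d)))) 1
        = herglotz a (b - t) R d * Fract (fdown (Rat (herglotz a (b - t) R d))) 1" by simp
    qed
    have "poly G \<mu> \<ge> 0"
      unfolding G_def poly_add poly_smult poly_hsum poly_hprod
      using H(2) epos \<mu>H by (intro add_nonneg_nonneg mult_nonneg_nonneg sum_nonneg prod_nonneg) (auto intro: less_imp_le)
    then have "poly (fdown (Theta \<mu> t f)) \<mu> \<ge> 0" using c0 by (simp add: fdT)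
    then show ?thesis using cls indT first fdT fuT by simp
  qed
qed

section \<open>Signs of a boundary function up to its first pole\<close>

lemma fdown_pos:
  assumes "f \<in> class_R" "f \<noteq> Infty" "\<forall>k\<in>poles f. x < k"
  shows "poly (fdown f) x > 0"
proof -
  obtain h0 h H \<delta> where rep: "herglotz_rep f h0 h H \<delta>" using assms by (elim class_R_cases)
  then have H: "finite H" "h0 \<ge> 0" by (auto simp: herglotz_rep_def)
  show ?thesis using assms(3) H
    by (auto simp: herglotz_rep_fdown[OF rep] herglotz_rep_poles[OF rep] poly_hprod intro!: prod_pos mult_pos_pos divide_pos_pos)
qed

lemma finite_poles: "f \<in> class_R \<Longrightarrow> f \<noteq> Infty \<Longrightarrow> finite (poles f)"
  by (elim class_R_cases) (auto simp: herglotz_rep_poles herglotz_rep_def)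

text \<open>At a pole the numerator keeps a nonzero residue term. Consequently the initial data of
  \<open>phi\<close> and \<open>psi\<close> never vanish simultaneously.\<close>

lemma fup_fdown_no_common_root:
  assumes "f \<in> class_R"
  shows "poly (fup f) x \<noteq> 0 \<or> poly (fdown f) x \<noteq> 0"
proof (cases "f = Infty")
  case False
  with assms obtain h0 h H \<delta> where rep: "herglotz_rep f h0 h H \<delta>" by (elim class_R_cases)
  then have H: "finite H" "h0 \<ge> 0" "\<forall>k\<in>H. \<delta> k > 0" by (auto simp: herglotz_rep_def)
  show ?thesis
  proof (cases "x \<in> H")
    case True
    then have "poly (hprod H) x = 0" using H by (simp add: poly_hprod_eq_0_iff)
    moreover have "(\<Prod>j\<in>H - {x}. j - x) \<noteq> 0" using H by simp
    moreover have "\<delta> x \<noteq> 0" using H True by auto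
    ultimately show ?thesis
      using True H poly_hsum_at[OF H(1) True, of \<delta>] by (simp add: herglotz_rep_fup[OF rep])
  next
    case False
    then show ?thesis using H by (simp add: herglotz_rep_fdown[OF rep] poly_hprod_eq_0_iff)
  qed
qed simp

text \<open>At the smallest pole all remaining factors \<open>j - k\<close> are positive. When the
  spectral parameter reaches such a pole, this sign makes the solution leave 0 downwards, or the
  characteristic function negative.\<close>

lemma first_pole:
  assumes f: "f \<in> class_R" "f \<noteq> Infty" "poles f \<noteq> {}"
  shows "poly (fdown f) (Min (poles f)) = 0 \<and> poly (fup f) (Min (poles f)) > 0"
proof -
  obtain h0 h H \<delta> where rep: "herglotz_rep f h0 h H \<delta>" using f by (elim class_R_cases)
  then have H: "finite H" "h0 \<ge> 0" "\<forall>k\<in>H. \<delta> k > 0" by (auto simp: herglotz_rep_def)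
  have pH: "poles f = H" by (rule herglotz_rep_poles[OF rep])
  define k where "k = Min H"
  have k: "k \<in> H" "\<forall>j\<in>H. k \<le> j" using H f(3) pH by (auto simp: k_def)
  have "poly (hprod H) k = 0" using H k by (simp add: poly_hprod_eq_0_iff)
  moreover have "(\<Prod>j\<in>H - {k}. j - k) > 0" using k by (intro prod_pos) force
  then have "poly (hsum H \<delta>) k > 0" using H k by (simp add: poly_hsum_at)
  ultimately show ?thesis
    using H by (simp add: pH k_def[symmetric] herglotz_rep_fup[OF rep] herglotz_rep_fdown[OF rep])
qed

text \<open>Far to the left the linear term is nonpositive, and \<open>k - x \<ge> 1\<close> bounds
  each fraction by its coefficient; this explains \<open>m\<close> and \<open>C\<close> in the
  proof.\<close>

lemma class_R_bounded_at_bot: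
  assumes f: "f \<in> class_R" "f \<noteq> Infty"
  shows "\<exists>C m. \<forall>x<m. (\<forall>k\<in>poles f. x < k) \<and> poly (fup f) x \<le> C * poly (fdown f) x"
proof -
  obtain h0 h H \<delta> where rep: "herglotz_rep f h0 h H \<delta>" using f by (elim class_R_cases)
  then have H: "finite H" "h0 \<ge> 0" "\<forall>k\<in>H. \<delta> k > 0" by (auto simp: herglotz_rep_def)
  have pH: "poles f = H" by (rule herglotz_rep_poles[OF rep])
  define m where "m = Min (insert 0 ((\<lambda>k. k - 1) ` H))"
  have m: "m \<le> 0" "\<And>k. k \<in> H \<Longrightarrow> m \<le> k - 1" using H by (auto simp: m_def)
  define C where "C = h + (\<Sum>k\<in>H. \<delta> k)"
  define c where "c = (if h0 > 0 then 1 / h0 else 1)"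
  have c0: "c > 0" using H by (simp add: c_def)
  have "(\<forall>k\<in>poles f. x < k) \<and> poly (fup f) x \<le> C * poly (fdown f) x" if x: "x < m" for x
  proof -
    have k1: "k - x \<ge> 1" if "k \<in> H" for k using m(2)[OF that] x by simp
    then have xH: "x \<notin> H" by force
    have D: "poly (hprod H) x \<ge> 0" unfolding poly_hprod using k1 by (intro prod_nonneg) force
    have "(\<Sum>k\<in>H. \<delta> k / (k - x)) \<le> (\<Sum>k\<in>H. \<delta> k)"
    proof (rule sum_mono)
      fix k assume k: "k \<in> H"
      have "\<delta> k / (k - x) \<le> \<delta> k / 1" using k1[OF k] H(3) k by (intro divide_left_mono) auto
      then show "\<delta> k / (k - x) \<le> \<delta> k" by simp
    qed
    moreover have "x * h0 \<le> 0" using x m(1) H(2) by (intro mult_nonpos_nonneg) auto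
    ultimately have "h + x * h0 + (\<Sum>k\<in>H. \<delta> k / (k - x)) \<le> C" by (simp add: C_def)
    then have "poly (hprod H) x * (h + x * h0 + (\<Sum>k\<in>H. \<delta> k / (k - x))) \<le> poly (hprod H) x * C"
      using D by (rule mult_left_mono)
    then have "poly ([:h, h0:] * hprod H + hsum H \<delta>) x \<le> C * poly (hprod H) x"
      using poly_hsum_off[OF H(1) xH, of \<delta>] by (simp add: algebra_simps)
    then have "c * poly ([:h, h0:] * hprod H + hsum H \<delta>) x \<le> c * (C * poly (hprod H) x)"
      using c0 by (intro mult_left_mono) auto
    then have "poly (fup f) x \<le> C * poly (fdown f) x"
      unfolding herglotz_rep_fup[OF rep] herglotz_rep_fdown[OF rep] c_def[symmetric] poly_smult
      by (simp only: mult.left_commute)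
    then show ?thesis using k1 pH by force
  qed
  then show ?thesis by blast
qed

section \<open>Solutions of the equation with an integrable potential\<close>

lemma is_solution_AE_deriv:
  assumes "is_solution q \<zeta> y y'"
  obtains N where "negligible N"
    "\<And>x. x \<in> {0<..<pi} - N \<Longrightarrow> (y' has_vector_derivative (of_real (q x) - \<zeta>) * y x) (at x)"
proof -
  have "AE x in lebesgue_on {0<..<pi}.
        \<exists>y''. (y' has_vector_derivative y'') (at x) \<and> - y'' + of_real (q x) * y x = \<zeta> * y x"
    using assms by (simp add: is_solution_def)
  then obtain N where N: "negligible N" "\<And>x. x \<in> {0<..<pi} - N \<Longrightarrow>
      \<exists>y''. (y' has_vector_derivative y'') (at x) \<and> - y'' + of_real (q x) * y x = \<zeta> * y x"
    by (subst (asm) AE_lebesgue_on_negligible_iff) auto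
  show thesis
  proof (rule that[OF N(1)])
    fix x assume "x \<in> {0<..<pi} - N"
    from N(2)[OF this] obtain y'' where y'': "(y' has_vector_derivative y'') (at x)"
      "- y'' + of_real (q x) * y x = \<zeta> * y x" by blast
    then have "y'' = (of_real (q x) - \<zeta>) * y x" by (simp add: algebra_simps)
    with y''(1) show "(y' has_vector_derivative (of_real (q x) - \<zeta>) * y x) (at x)" by simp
  qed
qed

lemma is_solutionI:
  assumes "\<And>x. x \<in> {0..pi} \<Longrightarrow> (y has_vector_derivative y' x) (at x within {0..pi})"
    and "ac 0 pi y'" and "negligible N"
    and "\<And>x. x \<in> {0<..<pi} - N \<Longrightarrow> (y' has_vector_derivative (of_real (q x) - \<zeta>) * y x) (at x)"
  shows "is_solution q \<zeta> y y'"
  unfolding is_solution_def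
proof (intro conjI)
  show "AE x in lebesgue_on {0<..<pi}.
        \<exists>y''. (y' has_vector_derivative y'') (at x) \<and> - y'' + of_real (q x) * y x = \<zeta> * y x"
  proof (subst AE_lebesgue_on_negligible_iff, simp, intro exI[of _ N] conjI ballI assms(3))
    fix x assume "x \<in> {0<..<pi} - N"
    from assms(4)[OF this]
    show "\<exists>y''. (y' has_vector_derivative y'') (at x) \<and> - y'' + of_real (q x) * y x = \<zeta> * y x"
      by (intro exI[of _ "(of_real (q x) - \<zeta>) * y x"]) (simp add: algebra_simps)
  qed
qed (use assms in auto)

text \<open>Scaling, the embedding of the reals, and real and imaginary parts are all instances.
  Through \<open>comm\<close> the spectral parameter may change together with the scalar
  field.\<close>

lemma is_solution_bounded_linear:
  assumes sol: "is_solution q \<zeta> y y'" and L: "bounded_linear L"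
    and comm: "\<And>r v. L ((of_real r - \<zeta>) * v) = (of_real r - \<xi>) * L v"
  shows "is_solution q \<xi> (\<lambda>x. L (y x)) (\<lambda>x. L (y' x))"
proof -
  obtain N where N: "negligible N"
    "\<And>x. x \<in> {0<..<pi} - N \<Longrightarrow> (y' has_vector_derivative (of_real (q x) - \<zeta>) * y x) (at x)"
    using is_solution_AE_deriv[OF sol] by blast
  show ?thesis
  proof (rule is_solutionI[OF _ _ N(1)])
    show "((\<lambda>x. L (y x)) has_vector_derivative L (y' x)) (at x within {0..pi})" if "x \<in> {0..pi}" for x
      by (rule bounded_linear.has_vector_derivative[OF L is_solution_deriv[OF sol that]])
    show "ac 0 pi (\<lambda>x. L (y' x))"
      by (rule ac_bounded_linear[OF is_solution_ac_deriv[OF sol] L])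
    show "((\<lambda>x. L (y' x)) has_vector_derivative (of_real (q x) - \<xi>) * L (y x)) (at x)"
      if "x \<in> {0<..<pi} - N" for x
      using bounded_linear.has_vector_derivative[OF L N(2)[OF that]] by (simp only: comm)
  qed
qed

lemma is_solution_cmult: "is_solution q \<zeta> y y' \<Longrightarrow> is_solution q \<zeta> (\<lambda>x. c * y x) (\<lambda>x. c * y' x)"
  by (rule is_solution_bounded_linear[where L = "\<lambda>v. c * v", OF _ bounded_linear_mult_right])
    (auto simp: algebra_simps)

lemma is_solution_of_real:
  assumes "is_solution q \<zeta> y y'"
  shows "is_solution q (of_real \<zeta> :: 'a :: real_normed_field) (\<lambda>x. of_real (y x)) (\<lambda>x. of_real (y' x))"
  by (rule is_solution_bounded_linear[OF assms bounded_linear_of_real]) simp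

lemma is_solution_Re:
  "is_solution q (complex_of_real \<zeta>) y y' \<Longrightarrow> is_solution q \<zeta> (\<lambda>x. Re (y x)) (\<lambda>x. Re (y' x))"
  by (rule is_solution_bounded_linear[OF _ bounded_linear_Re]) auto

lemma is_solution_Im:
  "is_solution q (complex_of_real \<zeta>) y y' \<Longrightarrow> is_solution q \<zeta> (\<lambda>x. Im (y x)) (\<lambda>x. Im (y' x))"
  by (rule is_solution_bounded_linear[OF _ bounded_linear_Im]) auto

lemma is_solution_diff:
  assumes y: "is_solution q \<zeta> y y'" and z: "is_solution q \<zeta> z z'"
  shows "is_solution q \<zeta> (\<lambda>x. y x - z x) (\<lambda>x. y' x - z' x)"
proof -
  obtain N where N: "negligible N"
    "\<And>x. x \<in> {0<..<pi} - N \<Longrightarrow> (y' has_vector_derivative (of_real (q x) - \<zeta>) * y x) (at x)"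
    using is_solution_AE_deriv[OF y] by blast
  obtain M where M: "negligible M"
    "\<And>x. x \<in> {0<..<pi} - M \<Longrightarrow> (z' has_vector_derivative (of_real (q x) - \<zeta>) * z x) (at x)"
    using is_solution_AE_deriv[OF z] by blast
  show ?thesis
  proof (rule is_solutionI)
    show "((\<lambda>x. y x - z x) has_vector_derivative y' x - z' x) (at x within {0..pi})" if "x \<in> {0..pi}" for x
      by (intro has_vector_derivative_diff is_solution_deriv[OF y that] is_solution_deriv[OF z that])
    show "ac 0 pi (\<lambda>x. y' x - z' x)"
      by (intro ac_diff is_solution_ac_deriv[OF y] is_solution_ac_deriv[OF z])
    show "negligible (N \<union> M)" using N(1) M(1) by simp
    show "((\<lambda>x. y' x - z' x) has_vector_derivative (of_real (q x) - \<zeta>) * (y x - z x)) (at x)"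
      if "x \<in> {0<..<pi} - (N \<union> M)" for x
      using has_vector_derivative_diff[OF N(2) M(2), of x] that by (simp add: right_diff_distrib)
  qed
qed

text \<open>Two differentiations produce two signs, which cancel, so the equation only sees the
  reflected potential.\<close>

lemma is_solution_reflect:
  fixes y :: "real \<Rightarrow> 'a :: real_normed_field"
  assumes sol: "is_solution q \<zeta> y y'"
  shows "is_solution (\<lambda>x. q (pi - x)) \<zeta> (\<lambda>x. y (pi - x)) (\<lambda>x. - y' (pi - x))"
proof -
  obtain N where N: "negligible N"
    "\<And>x. x \<in> {0<..<pi} - N \<Longrightarrow> (y' has_vector_derivative (of_real (q x) - \<zeta>) * y x) (at x)"
    using is_solution_AE_deriv[OF sol] by blast
  show ?thesis
  proof (rule is_solutionI)
    show "((\<lambda>x. y (pi - x)) has_vector_derivative - y' (pi - x)) (at x within {0..pi})" if "x \<in> {0..pi}" for x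
      using that by (intro has_vector_derivative_reflect is_solution_deriv[OF sol]) auto
    show "ac 0 pi (\<lambda>x. - y' (pi - x))"
      by (intro ac_minus ac_reflect is_solution_ac_deriv[OF sol])
    show "negligible ((\<lambda>x. pi - x) ` N)" by (rule negligible_reflect[OF N(1)])
    fix x assume x: "x \<in> {0<..<pi} - (\<lambda>x. pi - x) ` N"
    have "pi - x \<notin> N"
    proof
      assume "pi - x \<in> N"
      then have "pi - (pi - x) \<in> (\<lambda>x. pi - x) ` N" by (rule imageI)
      then show False using x by simp
    qed
    then have "pi - x \<in> {0<..<pi} - N" using x by auto
    from has_vector_derivative_minus[OF has_vector_derivative_reflect_at[OF N(2)[OF this]]]
    show "((\<lambda>x. - y' (pi - x)) has_vector_derivative (of_real (q (pi - x)) - \<zeta>) * y (pi - x)) (at x)"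
      by simp
  qed
qed

section \<open>Existence and energy estimates through the quasi-derivative\<close>

locale integrable_potential =
  fixes q :: "real \<Rightarrow> real"
  assumes q_int: "q absolutely_integrable_on {0<..<pi}"
begin

definition Q :: "real \<Rightarrow> real" where "Q x = integral {0..x} q"

lemma Q_0 [simp]: "Q 0 = 0" by (simp add: Q_def)

lemma ac_Q: "ac 0 pi Q"
  unfolding Q_def using q_int by (intro ac_indefinite_integral) (simp add: absolutely_integrable_on_Icc_iff_Ioo)

lemma continuous_Q: "continuous_on {0..pi} Q" by (rule ac_continuous_on[OF ac_Q])

lemma Q_AE_deriv:
  obtains N where "negligible N" "\<And>x. x \<in> {0<..<pi} - N \<Longrightarrow> (Q has_vector_derivative q x) (at x)"
proof -
  have "q integrable_on {0..pi}"
    using q_int set_lebesgue_integral_eq_integral(1) by (metis absolutely_integrable_on_Icc_iff_Ioo)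
  then show thesis using that unfolding Q_def[abs_def] by (rule lebesgue_differentiation_real)
qed

text \<open>
  The quasi-derivative \<open>y' - Q y\<close> turns the equation into a linear system with continuous
  coefficients, to which the classical existence and uniqueness arguments apply.
\<close>

lemma quasi_derivative:
  fixes y :: "real \<Rightarrow> real"
  assumes sol: "is_solution q \<zeta> y y'" and x: "x \<in> {0..pi}"
  shows "((\<lambda>x. y' x - Q x * y x) has_vector_derivative
      - (\<zeta> + (Q x)\<^sup>2) * y x - Q x * (y' x - Q x * y x)) (at x within {0..pi})"
proof -
  obtain N where N: "negligible N"
    "\<And>x. x \<in> {0<..<pi} - N \<Longrightarrow> (y' has_vector_derivative (of_real (q x) - \<zeta>) * y x) (at x)"
    using is_solution_AE_deriv[OF sol] by blast
  obtain M where M: "negligible M" "\<And>x. x \<in> {0<..<pi} - M \<Longrightarrow> (Q has_vector_derivative q x) (at x)"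
    using Q_AE_deriv by blast
  show ?thesis
  proof (rule ac_derivative_continuous[OF _ _ _ _ x])
    show "ac 0 pi (\<lambda>x. y' x - Q x * y x)"
      by (intro ac_diff ac_mult ac_Q is_solution_ac[OF sol] is_solution_ac_deriv[OF sol])
    show "negligible (N \<union> M)" using N(1) M(1) by simp
    show "continuous_on {0..pi} (\<lambda>x. - (\<zeta> + (Q x)\<^sup>2) * y x - Q x * (y' x - Q x * y x))"
      by (intro continuous_intros continuous_Q is_solution_continuous[OF sol])
    fix x assume x: "x \<in> {0<..<pi} - (N \<union> M)"
    have "(y has_vector_derivative y' x) (at x)"
      using is_solution_deriv[OF sol, of x] x by (simp add: at_within_Icc_at)
    from has_vector_derivative_diff[OF N(2) has_vector_derivative_mult[OF M(2) this]] x
    have "((\<lambda>x. y' x - Q x * y x) has_vector_derivative (q x - \<zeta>) * y x - (Q x * y' x + q x * y x)) (at x)"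
      by simp
    then show "((\<lambda>x. y' x - Q x * y x) has_vector_derivative
        - (\<zeta> + (Q x)\<^sup>2) * y x - Q x * (y' x - Q x * y x)) (at x)"
      by (simp add: algebra_simps power2_eq_square)
  qed
qed

text \<open>The way back from the system: \<open>y\<close> and \<open>u\<close> are continuously
  differentiable, hence absolutely continuous, and differentiating the term \<open>Q y\<close>
  brings \<open>q\<close> back almost everywhere.\<close>

lemma solution_of_quasi:
  fixes y :: "real \<Rightarrow> real"
  assumes y: "\<And>x. x \<in> {0..pi} \<Longrightarrow> (y has_vector_derivative u x + Q x * y x) (at x within {0..pi})"
    and u: "\<And>x. x \<in> {0..pi} \<Longrightarrow> (u has_vector_derivative - (\<zeta> + (Q x)\<^sup>2) * y x - Q x * u x) (at x within {0..pi})"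
  shows "is_solution q \<zeta> y (\<lambda>x. u x + Q x * y x)"
proof -
  obtain M where M: "negligible M" "\<And>x. x \<in> {0<..<pi} - M \<Longrightarrow> (Q has_vector_derivative q x) (at x)"
    using Q_AE_deriv by blast
  have c: "continuous_on {0..pi} y" "continuous_on {0..pi} u"
    by (rule continuous_on_vector_derivative[OF y], assumption)
      (rule continuous_on_vector_derivative[OF u], assumption)
  have acy: "ac 0 pi y" by (rule ac_C1[OF y]) (auto intro!: continuous_intros c continuous_Q)
  have acu: "ac 0 pi u" by (rule ac_C1[OF u]) (auto intro!: continuous_intros c continuous_Q)
  show ?thesis
  proof (rule is_solutionI[OF y _ M(1)])
    show "ac 0 pi (\<lambda>x. u x + Q x * y x)" by (intro ac_add ac_mult acy acu ac_Q)
    fix x assume x: "x \<in> {0<..<pi} - M"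
    have 1: "(y has_vector_derivative u x + Q x * y x) (at x)"
      using y[of x] x by (simp add: at_within_Icc_at)
    have 2: "(u has_vector_derivative - (\<zeta> + (Q x)\<^sup>2) * y x - Q x * u x) (at x)"
      using u[of x] x by (simp add: at_within_Icc_at)
    show "((\<lambda>x. u x + Q x * y x) has_vector_derivative (of_real (q x) - \<zeta>) * y x) (at x)"
      using has_vector_derivative_add[OF 2 has_vector_derivative_mult[OF M(2)[OF x] 1]]
      by (simp add: algebra_simps power2_eq_square)
  qed
qed

lemma solution_exists:
  fixes \<zeta> c d :: real
  shows "\<exists>y y'. is_solution q \<zeta> y y' \<and> y 0 = c \<and> y' 0 = d"
proof -
  obtain M where M: "M > 0" "\<And>x. x \<in> {0..pi} \<Longrightarrow> norm (Q x) \<le> M"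
    using continuous_on_interval_bounded[OF continuous_Q] by blast
  define A where "A = (\<lambda>x (v::real\<times>real). (snd v + Q x * fst v, - (\<zeta> + (Q x)\<^sup>2) * fst v - Q x * snd v))"
  have "\<exists>Y. Y 0 = (c, d) \<and> (\<forall>x\<in>{0..pi}. (Y has_vector_derivative A x (Y x)) (at x within {0..pi}))"
  proof (rule linear_ode_exists)
    show "A x (v - w) = A x v - A x w" for x v w
      by (simp add: A_def algebra_simps)
    fix x v assume x: "x \<in> {0..pi}"
    have Qx: "\<bar>Q x\<bar> \<le> M" using M(2)[OF x] by simp
    then have Q2: "(Q x)\<^sup>2 \<le> M\<^sup>2" by (simp add: abs_le_square_iff[symmetric])
    have f: "\<bar>fst v\<bar> \<le> norm v" and s: "\<bar>snd v\<bar> \<le> norm v"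
      using norm_fst_le[of "fst v" "snd v"] norm_snd_le[of "snd v" "fst v"] by simp_all
    have "norm (A x v) \<le> \<bar>snd v + Q x * fst v\<bar> + \<bar>- (\<zeta> + (Q x)\<^sup>2) * fst v - Q x * snd v\<bar>"
      unfolding A_def using norm_Pair_le by (metis real_norm_def)
    also have "\<dots> \<le> (\<bar>snd v\<bar> + \<bar>Q x\<bar> * \<bar>fst v\<bar>) + ((\<bar>\<zeta>\<bar> + (Q x)\<^sup>2) * \<bar>fst v\<bar> + \<bar>Q x\<bar> * \<bar>snd v\<bar>)"
    proof (rule add_mono)
      show "\<bar>snd v + Q x * fst v\<bar> \<le> \<bar>snd v\<bar> + \<bar>Q x\<bar> * \<bar>fst v\<bar>"
        by (metis abs_mult abs_triangle_ineq)
      have "\<bar>- (\<zeta> + (Q x)\<^sup>2) * fst v - Q x * snd v\<bar> \<le> \<bar>- (\<zeta> + (Q x)\<^sup>2) * fst v\<bar> + \<bar>Q x * snd v\<bar>"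
        by (rule abs_triangle_ineq4)
      also have "\<bar>- (\<zeta> + (Q x)\<^sup>2) * fst v\<bar> \<le> (\<bar>\<zeta>\<bar> + (Q x)\<^sup>2) * \<bar>fst v\<bar>"
      proof -
        have "\<bar>- (\<zeta> + (Q x)\<^sup>2)\<bar> \<le> \<bar>\<zeta>\<bar> + (Q x)\<^sup>2"
          using abs_triangle_ineq[of \<zeta> "(Q x)\<^sup>2"] by (simp only: abs_minus_cancel abs_power2)
        then show ?thesis unfolding abs_mult by (rule mult_right_mono) simp
      qed
      finally show "\<bar>- (\<zeta> + (Q x)\<^sup>2) * fst v - Q x * snd v\<bar> \<le> (\<bar>\<zeta>\<bar> + (Q x)\<^sup>2) * \<bar>fst v\<bar> + \<bar>Q x\<bar> * \<bar>snd v\<bar>"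
        by (simp add: abs_mult)
    qed
    also have "\<dots> \<le> (norm v + M * norm v) + ((\<bar>\<zeta>\<bar> + M\<^sup>2) * norm v + M * norm v)"
      using M(1) Qx Q2 f s by (intro add_mono mult_mono) auto
    finally show "norm (A x v) \<le> (1 + M + (\<bar>\<zeta>\<bar> + M\<^sup>2) + M) * norm v"
      by (simp add: algebra_simps)
  next
    fix Y :: "real \<Rightarrow> real \<times> real" assume "continuous_on {0..pi} Y"
    then show "continuous_on {0..pi} (\<lambda>x. A x (Y x))"
      unfolding A_def by (intro continuous_intros continuous_Q)
  qed
  then obtain Y where Y: "Y 0 = (c, d)"
    "\<And>x. x \<in> {0..pi} \<Longrightarrow> (Y has_vector_derivative A x (Y x)) (at x within {0..pi})" by blast
  have "is_solution q \<zeta> (\<lambda>x. fst (Y x)) (\<lambda>x. snd (Y x) + Q x * fst (Y x))"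
  proof (rule solution_of_quasi)
    show "((\<lambda>x. fst (Y x)) has_vector_derivative snd (Y x) + Q x * fst (Y x)) (at x within {0..pi})"
      if "x \<in> {0..pi}" for x
      using bounded_linear.has_vector_derivative[OF bounded_linear_fst Y(2)[OF that]] by (simp add: A_def)
    show "((\<lambda>x. snd (Y x)) has_vector_derivative - (\<zeta> + (Q x)\<^sup>2) * fst (Y x) - Q x * snd (Y x)) (at x within {0..pi})"
      if "x \<in> {0..pi}" for x
      using bounded_linear.has_vector_derivative[OF bounded_linear_snd Y(2)[OF that]] by (simp add: A_def)
  qed
  then show ?thesis using Y(1) by (intro exI conjI) (assumption, auto)
qed

text \<open>The forcing term \<open>r\<close> lets one estimate serve both uniqueness, where
  \<open>r = 0\<close>, and dependence on the spectral parameter. Including \<open>e\<^sup>2\<close>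
  in the energy absorbs the contribution of \<open>r\<close>, so that the homogeneous Gronwall bound
  applies.\<close>

lemma quasi_energy:
  fixes y u r :: "real \<Rightarrow> real"
  assumes y: "\<And>x. x \<in> {0..pi} \<Longrightarrow> (y has_vector_derivative u x + Q x * y x) (at x within {0..pi})"
    and u: "\<And>x. x \<in> {0..pi} \<Longrightarrow> (u has_vector_derivative - (\<zeta> + (Q x)\<^sup>2) * y x - Q x * u x + r x) (at x within {0..pi})"
    and r: "\<And>x. x \<in> {0..pi} \<Longrightarrow> \<bar>r x\<bar> \<le> e"
    and M: "\<And>x. x \<in> {0..pi} \<Longrightarrow> \<bar>Q x\<bar> \<le> M" and L: "\<bar>\<zeta>\<bar> \<le> L"
    and x: "x \<in> {0..pi}" and t: "t \<in> {0..pi}"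
  shows "(y x)\<^sup>2 + (u x)\<^sup>2 + e\<^sup>2 \<le> ((y t)\<^sup>2 + (u t)\<^sup>2 + e\<^sup>2) * exp ((2 + 4 * M + L + M\<^sup>2) * pi)"
proof -
  define K where "K = 2 + 4 * M + L + M\<^sup>2"
  have "M \<ge> 0" using M[OF x] by linarith
  then have "K \<ge> 0" using L by (simp add: K_def)
  define E where "E = (\<lambda>x. (y x)\<^sup>2 + (u x)\<^sup>2 + e\<^sup>2)"
  define E' where "E' = (\<lambda>x. 2 * y x * (u x + Q x * y x) + 2 * u x * (- (\<zeta> + (Q x)\<^sup>2) * y x - Q x * u x + r x))"
  have "E x \<le> E t * exp (K * \<bar>x - t\<bar>)"
  proof (rule gronwall_bound[OF _ _ x t])
    fix x assume x: "x \<in> {0..pi}"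
    show "(E has_vector_derivative E' x) (at x within {0..pi})"
    proof -
      have dy: "(y has_real_derivative u x + Q x * y x) (at x within {0..pi})"
        using y[OF x] by (simp add: has_real_derivative_iff_has_vector_derivative)
      have du: "(u has_real_derivative - (\<zeta> + (Q x)\<^sup>2) * y x - Q x * u x + r x) (at x within {0..pi})"
        using u[OF x] by (simp add: has_real_derivative_iff_has_vector_derivative)
      have "(E has_real_derivative E' x) (at x within {0..pi})"
        unfolding E_def
        by (rule DERIV_cong[OF DERIV_add[OF DERIV_add[OF DERIV_power[OF dy, of 2] DERIV_power[OF du, of 2]]
          DERIV_const[of "e\<^sup>2"]]]) (simp add: E'_def algebra_simps)
      then show ?thesis by (simp add: has_real_derivative_iff_has_vector_derivative)
    qed
    have Q2: "(Q x)\<^sup>2 \<le> M\<^sup>2" using M[OF x] \<open>M \<ge> 0\<close> by (simp add: abs_le_square_iff[symmetric])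
    have yu: "2 * (\<bar>y x\<bar> * \<bar>u x\<bar>) \<le> E x"
    proof -
      have "2 * \<bar>y x\<bar> * \<bar>u x\<bar> \<le> \<bar>y x\<bar>\<^sup>2 + \<bar>u x\<bar>\<^sup>2" by (rule sum_squares_bound)
      then have "2 * (\<bar>y x\<bar> * \<bar>u x\<bar>) \<le> (y x)\<^sup>2 + (u x)\<^sup>2" by (simp only: power2_abs mult.assoc)
      moreover have "0 \<le> e\<^sup>2" by simp
      ultimately show ?thesis unfolding E_def by linarith
    qed
    have ru: "2 * (\<bar>u x\<bar> * \<bar>r x\<bar>) \<le> E x"
    proof -
      have "2 * \<bar>u x\<bar> * \<bar>r x\<bar> \<le> \<bar>u x\<bar>\<^sup>2 + \<bar>r x\<bar>\<^sup>2" by (rule sum_squares_bound)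
      moreover have "\<bar>r x\<bar>\<^sup>2 \<le> e\<^sup>2" using r[OF x] by (intro power_mono) auto
      ultimately have "2 * \<bar>u x\<bar> * \<bar>r x\<bar> \<le> (u x)\<^sup>2 + e\<^sup>2" by (simp only: power2_abs)
      moreover have "0 \<le> (y x)\<^sup>2" by simp
      ultimately show ?thesis unfolding E_def mult.assoc[symmetric] by linarith
    qed
    have E0: "E x \<ge> 0" "(y x)\<^sup>2 \<le> E x" "(u x)\<^sup>2 \<le> E x" by (auto simp: E_def)
    have eq: "E' x = 2 * (y x * u x) + 2 * Q x * (y x)\<^sup>2 - (\<zeta> + (Q x)\<^sup>2) * (2 * (y x * u x)) - 2 * Q x * (u x)\<^sup>2 + 2 * (u x * r x)"
      unfolding E'_def power2_eq_square by (simp add: algebra_simps)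
    have "\<bar>E' x\<bar> \<le> \<bar>2 * (y x * u x)\<bar> + \<bar>2 * Q x * (y x)\<^sup>2\<bar> + \<bar>(\<zeta> + (Q x)\<^sup>2) * (2 * (y x * u x))\<bar>
        + \<bar>2 * Q x * (u x)\<^sup>2\<bar> + \<bar>2 * (u x * r x)\<bar>"
    proof -
      have tri: "\<bar>a + b - c - d + f\<bar> \<le> \<bar>a\<bar> + \<bar>b\<bar> + \<bar>c\<bar> + \<bar>d\<bar> + \<bar>f\<bar>" for a b c d f :: real
        by (smt (verit))
      show ?thesis unfolding eq by (rule tri)
    qed
    \<comment> \<open>These five summands are the origin of the constant \<open>K\<close>; products
      of \<open>y\<close> and \<open>u\<close> are estimated by
      \<open>2 * (\<bar>y x\<bar> * \<bar>u x\<bar>) \<le> E x\<close>.\<close>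
    also have "\<dots> \<le> E x + 2 * M * E x + (L + M\<^sup>2) * E x + 2 * M * E x + E x"
      unfolding abs_mult abs_numeral abs_power2
    proof (intro add_mono)
      show "2 * (\<bar>y x\<bar> * \<bar>u x\<bar>) \<le> E x" by (rule yu)
      show "2 * \<bar>Q x\<bar> * (y x)\<^sup>2 \<le> 2 * M * E x" using M[OF x] E0 by (intro mult_mono) auto
      show "2 * \<bar>Q x\<bar> * (u x)\<^sup>2 \<le> 2 * M * E x" using M[OF x] E0 by (intro mult_mono) auto
      have LM: "\<bar>\<zeta> + (Q x)\<^sup>2\<bar> \<le> L + M\<^sup>2" using L Q2 abs_triangle_ineq[of \<zeta> "(Q x)\<^sup>2"] by simp
      show "\<bar>\<zeta> + (Q x)\<^sup>2\<bar> * (2 * (\<bar>y x\<bar> * \<bar>u x\<bar>)) \<le> (L + M\<^sup>2) * E x"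
        by (rule mult_mono[OF LM yu]) (use LM in auto)
    qed (rule ru)
    also have "\<dots> = K * E x" by (simp add: K_def algebra_simps)
    finally show "\<bar>E' x\<bar> \<le> K * E x" .
  qed
  also have "\<dots> \<le> E t * exp (K * pi)"
    using x t \<open>K \<ge> 0\<close> by (intro mult_left_mono) (auto simp: E_def intro!: mult_left_mono)
  finally show ?thesis by (simp add: E_def K_def)
qed

end

text \<open>Before a first zero of \<open>Y\<close> the function \<open>Z\<close> does not decrease,
  so it stays nonnegative and keeps \<open>Y\<close> from decreasing; then \<open>Y\<close> is still
  at least \<open>Y 0\<close> at that zero, which is absurd.\<close>

lemma cooperative_system_positive:
  fixes Y Z \<alpha> \<beta> :: "real \<Rightarrow> real"
  assumes Y: "\<And>x. x \<in> {0..b} \<Longrightarrow> (Y has_real_derivative \<alpha> x * Z x) (at x within {0..b})"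
    and Z: "\<And>x. x \<in> {0..b} \<Longrightarrow> (Z has_real_derivative \<beta> x * Y x) (at x within {0..b})"
    and \<alpha>: "\<And>x. x \<in> {0..b} \<Longrightarrow> \<alpha> x \<ge> 0" and \<beta>: "\<And>x. x \<in> {0..b} \<Longrightarrow> \<beta> x \<ge> 0"
    and init: "Y 0 > 0" "Z 0 \<ge> 0" and x: "x \<in> {0..b}"
  shows "Y x > 0 \<and> Z x \<ge> 0"
proof -
  have cY: "continuous_on {0..b} Y" and cZ: "continuous_on {0..b} Z"
    by (rule DERIV_continuous_on[OF Y], assumption) (rule DERIV_continuous_on[OF Z], assumption)
  have dY: "(Y has_real_derivative \<alpha> x * Z x) (at x)" if "0 < x" "x < b" for x
    using Y[of x] that by (simp add: at_within_Icc_at)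
  have dZ: "(Z has_real_derivative \<beta> x * Y x) (at x)" if "0 < x" "x < b" for x
    using Z[of x] that by (simp add: at_within_Icc_at)
  have mono: "Z t \<ge> 0 \<and> Y t \<ge> Y 0" if t: "t \<in> {0..b}" and pos: "\<And>s. 0 < s \<Longrightarrow> s < t \<Longrightarrow> Y s > 0" for t
  proof -
    have Zp: "Z s \<ge> 0" if s: "0 \<le> s" "s \<le> t" for s
    proof -
      have "Z 0 \<le> Z s"
      proof (rule DERIV_nonneg_imp_increasing_open[OF s(1)])
        fix r assume r: "0 < r" "r < s"
        have "\<beta> r * Y r \<ge> 0" using \<beta>[of r] pos[of r] r s t by (intro mult_nonneg_nonneg) auto
        then show "\<exists>y. (Z has_real_derivative y) (at r) \<and> 0 \<le> y" using dZ[of r] r s t by auto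
      qed (rule continuous_on_subset[OF cZ], use s t in auto)
      then show ?thesis using init by simp
    qed
    have "0 \<le> t" using t by simp
    have "Y 0 \<le> Y t"
    proof (rule DERIV_nonneg_imp_increasing_open[OF \<open>0 \<le> t\<close>])
      fix r assume r: "0 < r" "r < t"
      have "\<alpha> r * Z r \<ge> 0" using \<alpha>[of r] Zp[of r] r t by (intro mult_nonneg_nonneg) auto
      then show "\<exists>y. (Y has_real_derivative y) (at r) \<and> 0 \<le> y" using dY[of r] r t by auto
    qed (rule continuous_on_subset[OF cY], use t in auto)
    then show ?thesis using Zp[of t] t by simp
  qed
  have pos: "Y t > 0" if t: "t \<in> {0..b}" for t
  proof (rule ccontr)
    assume "\<not> Y t > 0"
    define S where "S = {s \<in> {0..b}. Y s \<le> 0}"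
    have "closed S" unfolding S_def
      using continuous_on_closed_Collect_le[OF cY continuous_on_const, of 0] by simp
    moreover have "S \<noteq> {}" "bdd_below S" using t \<open>\<not> Y t > 0\<close> by (auto simp: S_def)
    ultimately have "Inf S \<in> S" by (intro closed_contains_Inf)
    have "Y s > 0" if "0 < s" "s < Inf S" for s
    proof (rule ccontr)
      assume "\<not> Y s > 0"
      then have "s \<in> S" using that \<open>Inf S \<in> S\<close> by (auto simp: S_def)
      then have "Inf S \<le> s" using \<open>bdd_below S\<close> by (rule cInf_lower)
      then show False using that by simp
    qed
    then have "Y (Inf S) \<ge> Y 0" using mono[of "Inf S"] \<open>Inf S \<in> S\<close> by (auto simp: S_def)
    then show False using \<open>Inf S \<in> S\<close> init by (auto simp: S_def)
  qed
  have "Z x \<ge> 0 \<and> Y x \<ge> Y 0"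
  proof (rule mono[OF x])
    fix s assume "0 < s" "s < x"
    then show "Y s > 0" using x by (intro pos) auto
  qed
  then show ?thesis using pos[OF x] by blast
qed

section \<open>Uniqueness, dependence on the parameter, and positivity near minus infinity\<close>

context integrable_potential
begin

lemma Q_bounded: obtains M where "M > 0" "\<And>x. x \<in> {0..pi} \<Longrightarrow> \<bar>Q x\<bar> \<le> M"
proof -
  obtain M where "M > 0" "\<And>x. x \<in> {0..pi} \<Longrightarrow> norm (Q x) \<le> M"
    using continuous_on_interval_bounded[OF continuous_Q] by blast
  then show thesis by (intro that[of M]) auto
qed

lemma solution_zero:
  fixes y :: "real \<Rightarrow> real"
  assumes sol: "is_solution q \<zeta> y y'" and t: "t \<in> {0..pi}" "y t = 0" "y' t = 0" and x: "x \<in> {0..pi}"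
  shows "y x = 0 \<and> y' x = 0"
proof -
  obtain M where M: "M > 0" "\<And>x. x \<in> {0..pi} \<Longrightarrow> \<bar>Q x\<bar> \<le> M" using Q_bounded by blast
  define u where "u = (\<lambda>x. y' x - Q x * y x)"
  have "(y x)\<^sup>2 + (u x)\<^sup>2 + 0\<^sup>2 \<le> ((y t)\<^sup>2 + (u t)\<^sup>2 + 0\<^sup>2) * exp ((2 + 4 * M + \<bar>\<zeta>\<bar> + M\<^sup>2) * pi)"
  proof (rule quasi_energy[where r = "\<lambda>_. 0" and \<zeta> = \<zeta>])
    show "(y has_vector_derivative u x + Q x * y x) (at x within {0..pi})" if "x \<in> {0..pi}" for x
      using is_solution_deriv[OF sol that] by (simp add: u_def)
    show "(u has_vector_derivative - (\<zeta> + (Q x)\<^sup>2) * y x - Q x * u x + 0) (at x within {0..pi})" if "x \<in> {0..pi}" for x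
      using quasi_derivative[OF sol that] by (simp add: u_def)
  qed (use M x t in auto)
  then have "(y x)\<^sup>2 + (u x)\<^sup>2 \<le> 0" using t by (simp add: u_def)
  then have "y x = 0 \<and> u x = 0" by (simp add: sum_power2_le_zero_iff)
  then show ?thesis by (simp add: u_def)
qed

lemma solution_unique:
  fixes y z :: "real \<Rightarrow> real"
  assumes y: "is_solution q \<zeta> y y'" and z: "is_solution q \<zeta> z z'"
    and t: "t \<in> {0..pi}" "y t = z t" "y' t = z' t" and x: "x \<in> {0..pi}"
  shows "y x = z x \<and> y' x = z' x"
  using solution_zero[OF is_solution_diff[OF y z] t(1) _ _ x] t by simp

text \<open>The difference of the solutions for \<open>l\<close> and \<open>m\<close> solves the
  equation for \<open>l\<close> with forcing term \<open>- (l - m) * y m x\<close>. The bound is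
  uniform in \<open>x\<close>, as is required later to preserve positivity on the whole
  interval.\<close>

lemma solution_dependence:
  fixes y y' :: "real \<Rightarrow> real \<Rightarrow> real"
  assumes sol: "\<And>l. is_solution q l (y l) (y' l)"
    and cont: "isCont (\<lambda>l. y l 0) m" "isCont (\<lambda>l. y' l 0) m" and e: "e > 0"
  obtains d where "d > 0"
    "\<And>l x. \<bar>l - m\<bar> < d \<Longrightarrow> x \<in> {0..pi} \<Longrightarrow> \<bar>y l x - y m x\<bar> < e \<and> \<bar>y' l x - y' m x\<bar> < e"
proof -
  obtain M where M: "M > 0" "\<And>x. x \<in> {0..pi} \<Longrightarrow> \<bar>Q x\<bar> \<le> M" using Q_bounded by blast
  obtain B where B: "B > 0" "\<And>x. x \<in> {0..pi} \<Longrightarrow> norm (y m x) \<le> B"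
    using continuous_on_interval_bounded[OF is_solution_continuous(1)[OF sol[of m]]] by blast
  define L where "L = \<bar>m\<bar> + 1"
  define E where "E = exp ((2 + 4 * M + L + M\<^sup>2) * pi)"
  define u where "u = (\<lambda>l x. y' l x - Q x * y l x)"
  define w where "w = (\<lambda>l. ((y l 0 - y m 0)\<^sup>2 + (y' l 0 - y' m 0)\<^sup>2 + ((l - m) * B)\<^sup>2) * E)"
  have bound: "(y l x - y m x)\<^sup>2 + (u l x - u m x)\<^sup>2 \<le> w l" if l: "\<bar>l - m\<bar> \<le> 1" and x: "x \<in> {0..pi}" for l x
  proof -
    have "(y l x - y m x)\<^sup>2 + (u l x - u m x)\<^sup>2 + (\<bar>l - m\<bar> * B)\<^sup>2
      \<le> ((y l 0 - y m 0)\<^sup>2 + (u l 0 - u m 0)\<^sup>2 + (\<bar>l - m\<bar> * B)\<^sup>2) * exp ((2 + 4 * M + L + M\<^sup>2) * pi)"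
    proof (rule quasi_energy[where r = "\<lambda>x. - (l - m) * y m x" and \<zeta> = l])
      fix x assume x: "x \<in> {0..pi}"
      show "((\<lambda>x. y l x - y m x) has_vector_derivative (u l x - u m x) + Q x * (y l x - y m x)) (at x within {0..pi})"
        using has_vector_derivative_diff[OF is_solution_deriv[OF sol[of l] x] is_solution_deriv[OF sol[of m] x]]
        by (simp add: u_def algebra_simps)
      show "((\<lambda>x. u l x - u m x) has_vector_derivative
          - (l + (Q x)\<^sup>2) * (y l x - y m x) - Q x * (u l x - u m x) + - (l - m) * y m x) (at x within {0..pi})"
        using has_vector_derivative_diff[OF quasi_derivative[OF sol[of l] x] quasi_derivative[OF sol[of m] x]]
        unfolding u_def by (simp add: algebra_simps)
      show "\<bar>- (l - m) * y m x\<bar> \<le> \<bar>l - m\<bar> * B"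
        unfolding abs_mult abs_minus_cancel using B(2)[OF x] by (intro mult_left_mono) auto
    qed (use M x l in \<open>auto simp: L_def\<close>)
    moreover have "(\<bar>l - m\<bar> * B)\<^sup>2 = ((l - m) * B)\<^sup>2" by (simp add: power_mult_distrib)
    moreover have "0 \<le> ((l - m) * B)\<^sup>2" by simp
    moreover have "u l 0 - u m 0 = y' l 0 - y' m 0" by (simp add: u_def)
    ultimately show ?thesis unfolding w_def E_def by (simp only:)
  qed
  \<comment> \<open>Recovering \<open>y'\<close> from the quasi-derivative costs a further
    \<open>M\<close> times the bound on \<open>y\<close>; \<open>M + 2\<close> leaves room for a
    strict inequality.\<close>
  define e1 where "e1 = e / (M + 2)"
  have e1: "e1 > 0" using e M(1) by (simp add: e1_def)
  have "isCont w m" unfolding w_def by (intro continuous_intros cont)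
  then have "w \<midarrow>m\<rightarrow> 0" by (simp add: isCont_def w_def)
  then have "eventually (\<lambda>l. w l < e1\<^sup>2) (at m)" using e1 by (intro order_tendstoD(2)) auto
  then obtain d where d: "d > 0" "\<And>l. l \<noteq> m \<Longrightarrow> dist l m < d \<Longrightarrow> w l < e1\<^sup>2"
    by (auto simp: eventually_at)
  show thesis
  proof (rule that[of "min d 1"])
    show "min d 1 > 0" using d by simp
    fix l x assume l: "\<bar>l - m\<bar> < min d 1" and x: "x \<in> {0..pi}"
    have "w l < e1\<^sup>2"
    proof (cases "l = m")
      case True then show ?thesis using e1 by (simp add: w_def)
    next
      case False then show ?thesis using d(2)[of l] l by (simp add: dist_real_def)
    qed
    then have lt: "(y l x - y m x)\<^sup>2 + (u l x - u m x)\<^sup>2 < e1\<^sup>2" using bound[of l x] l x by simp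
    have "(y l x - y m x)\<^sup>2 < e1\<^sup>2" using lt zero_le_power2[of "u l x - u m x"] by linarith
    then have 1: "\<bar>y l x - y m x\<bar> < e1" using e1 power2_less_imp_less[of "\<bar>y l x - y m x\<bar>" e1] by simp
    have "(u l x - u m x)\<^sup>2 < e1\<^sup>2" using lt zero_le_power2[of "y l x - y m x"] by linarith
    then have 2: "\<bar>u l x - u m x\<bar> < e1" using e1 power2_less_imp_less[of "\<bar>u l x - u m x\<bar>" e1] by simp
    have e1e: "e1 * (M + 2) = e" using M(1) by (simp add: e1_def)
    have "e1 * 1 \<le> e1 * (M + 2)" using e1 M(1) by (intro mult_left_mono) auto
    then have "e1 \<le> e" using e1e by simp
    have "y' l x - y' m x = (u l x - u m x) + Q x * (y l x - y m x)" by (simp add: u_def algebra_simps)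
    then have "\<bar>y' l x - y' m x\<bar> \<le> \<bar>u l x - u m x\<bar> + \<bar>Q x\<bar> * \<bar>y l x - y m x\<bar>"
      using abs_triangle_ineq[of "u l x - u m x" "Q x * (y l x - y m x)"] by (simp only: abs_mult)
    also have "\<dots> < e1 + (M + 1) * e1"
    proof (rule add_strict_mono[OF 2])
      have "\<bar>Q x\<bar> * \<bar>y l x - y m x\<bar> \<le> M * e1" using M(2)[OF x] M(1) 1 by (intro mult_mono) auto
      then show "\<bar>Q x\<bar> * \<bar>y l x - y m x\<bar> < (M + 1) * e1" using e1 by (simp add: algebra_simps)
    qed
    also have "\<dots> = e" using e1e by (simp add: algebra_simps)
    finally show "\<bar>y l x - y m x\<bar> < e \<and> \<bar>y' l x - y' m x\<bar> < e" using 1 \<open>e1 \<le> e\<close> by simp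
  qed
qed

text \<open>
  For \<open>\<lambda> \<rightarrow> - \<infinity>\<close> the quasi-derivative \<open>z = y' - (Q + a) y\<close> with a linear function \<open>a\<close> leads to
  \<open>y' = z + (Q + a) y\<close>, \<open>z' = (- \<lambda> - a' - (Q + a)\<^sup>2) y - (Q + a) z\<close>, which preserves positivity.
\<close>

lemma solution_positive_at_bot:
  fixes C E :: real
  obtains m where "\<And>l y y'. l < m \<Longrightarrow> is_solution q l y y' \<Longrightarrow> y 0 > 0 \<Longrightarrow> y' 0 \<ge> - C * y 0 \<Longrightarrow>
      (\<forall>x\<in>{0..pi}. y x > 0) \<and> y' pi > E * (y pi :: real)"
proof -
  obtain M where M: "M > 0" "\<And>x. x \<in> {0..pi} \<Longrightarrow> \<bar>Q x\<bar> \<le> M" using Q_bounded by blast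
  \<comment> \<open>The slope of the linear function is fitted to both ends:
    \<open>P 0 = - C\<close> gives \<open>z 0 \<ge> 0\<close>, and \<open>P pi \<ge> E + 1\<close>
    turns \<open>z pi \<ge> 0\<close> into the claim at the right end.\<close>
  define b where "b = (E + M + 1 + C) / pi"
  define P where "P = (\<lambda>x. Q x + (b * x - C))"
  have cP: "continuous_on {0..pi} P" unfolding P_def by (intro continuous_intros continuous_Q)
  obtain W where W: "W > 0" "\<And>x. x \<in> {0..pi} \<Longrightarrow> norm (P x) \<le> W"
    using continuous_on_interval_bounded[OF cP] by blast
  define p where "p = (\<lambda>x. integral {0..x} P)"
  have dp: "(p has_real_derivative P x) (at x within {0..pi})" if "x \<in> {0..pi}" for x
    unfolding p_def using integral_has_vector_derivative[OF cP that]
    by (simp add: has_real_derivative_iff_has_vector_derivative)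
  have p0: "p 0 = 0" by (simp add: p_def)
  show thesis
  proof (rule that[of "- b - W\<^sup>2"])
    fix l y y' assume l: "l < - b - W\<^sup>2" and sol: "is_solution q l y y'"
      and y0: "y 0 > 0" and y'0: "y' 0 \<ge> - C * (y 0 :: real)"
    define z where "z = (\<lambda>x. y' x - P x * y x)"
    \<comment> \<open>The coefficient of \<open>y\<close> in the derivative of \<open>z\<close>; the
      threshold \<open>- b - W\<^sup>2\<close> for \<open>l\<close> is what makes it
      nonnegative.\<close>
    define \<kappa> where "\<kappa> = (\<lambda>x. - (l + b + (P x)\<^sup>2))"
    have \<kappa>: "\<kappa> x \<ge> 0" if "x \<in> {0..pi}" for x
    proof -
      have "(P x)\<^sup>2 \<le> W\<^sup>2" using W(2)[OF that] W(1) by (simp add: abs_le_square_iff[symmetric])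
      then show ?thesis using l by (simp add: \<kappa>_def)
    qed
    have dy: "(y has_real_derivative z x + P x * y x) (at x within {0..pi})" if "x \<in> {0..pi}" for x
      using is_solution_deriv[OF sol that] by (simp add: z_def has_real_derivative_iff_has_vector_derivative)
    have dz: "(z has_real_derivative \<kappa> x * y x - P x * z x) (at x within {0..pi})" if x: "x \<in> {0..pi}" for x
    proof -
      have 1: "((\<lambda>x. y' x - Q x * y x) has_real_derivative - (l + (Q x)\<^sup>2) * y x - Q x * (y' x - Q x * y x)) (at x within {0..pi})"
        using quasi_derivative[OF sol x] by (simp add: has_real_derivative_iff_has_vector_derivative)
      have 2: "((\<lambda>x. b * x - C) has_real_derivative b) (at x within {0..pi})"
        by (auto intro!: derivative_eq_intros)
      have "z = (\<lambda>x. (y' x - Q x * y x) - (b * x - C) * y x)"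
        by (simp add: z_def P_def fun_eq_iff algebra_simps)
      moreover have "((\<lambda>x. (y' x - Q x * y x) - (b * x - C) * y x) has_real_derivative \<kappa> x * y x - P x * z x) (at x within {0..pi})"
        by (rule DERIV_cong[OF DERIV_diff[OF 1 DERIV_mult[OF 2 dy[OF x]]]])
          (simp add: z_def P_def \<kappa>_def algebra_simps power2_eq_square)
      ultimately show ?thesis by simp
    qed
    \<comment> \<open>The diagonal terms \<open>P y\<close> and \<open>- P z\<close> have opposite
      signs; the factors \<open>exp (- p x)\<close> and \<open>exp (p x)\<close> remove them and
      leave a cooperative system.\<close>
    have res: "y x * exp (- p x) > 0 \<and> z x * exp (p x) \<ge> 0" if x: "x \<in> {0..pi}" for x
    proof (rule cooperative_system_positive[OF _ _ _ _ _ _ x])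
      fix x assume x: "x \<in> {0..pi}"
      have e1: "((\<lambda>x. exp (- p x)) has_real_derivative exp (- p x) * (- P x)) (at x within {0..pi})"
        by (rule DERIV_chain2[OF DERIV_exp DERIV_minus[OF dp[OF x]]])
      have e2: "((\<lambda>x. exp (p x)) has_real_derivative exp (p x) * P x) (at x within {0..pi})"
        by (rule DERIV_chain2[OF DERIV_exp dp[OF x]])
      have ee: "exp (- (2 * p x)) * exp (p x) = exp (- p x)" "exp (2 * p x) * exp (- p x) = exp (p x)"
        by (simp_all flip: exp_add)
      have "z x * exp (- p x) = exp (- (2 * p x)) * (z x * exp (p x))"
        using ee(1) by (simp only: mult.left_commute)
      then show "((\<lambda>x. y x * exp (- p x)) has_real_derivative exp (- (2 * p x)) * (z x * exp (p x))) (at x within {0..pi})"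
        by (intro DERIV_cong[OF DERIV_mult[OF dy[OF x] e1]]) (simp add: algebra_simps)
      have "\<kappa> x * y x * exp (p x) = (\<kappa> x * exp (2 * p x)) * (y x * exp (- p x))"
        using ee(2) by (metis mult.assoc mult.left_commute)
      then show "((\<lambda>x. z x * exp (p x)) has_real_derivative (\<kappa> x * exp (2 * p x)) * (y x * exp (- p x))) (at x within {0..pi})"
        by (intro DERIV_cong[OF DERIV_mult[OF dz[OF x] e2]]) (simp add: algebra_simps)
      show "0 \<le> exp (- (2 * p x))" "0 \<le> \<kappa> x * exp (2 * p x)" using \<kappa>[OF x] by simp_all
    next
      show "y 0 * exp (- p 0) > 0" using y0 by (simp add: p0)
      show "z 0 * exp (p 0) \<ge> 0" using y'0 by (simp add: p0 z_def P_def)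
    qed
    have ypos: "\<forall>x\<in>{0..pi}. y x > 0" using res by (simp add: zero_less_mult_iff)
    moreover have "y' pi > E * y pi"
    proof -
      have "z pi \<ge> 0" using res[of pi] by (simp add: zero_le_mult_iff)
      then have "y' pi \<ge> P pi * y pi" by (simp add: z_def)
      moreover have "P pi > E"
      proof -
        have "b * pi = E + M + 1 + C" by (simp add: b_def)
        then show ?thesis using M(2)[of pi] by (simp add: P_def)
      qed
      then have "P pi * y pi > E * y pi" using ypos by (intro mult_strict_right_mono) auto
      ultimately show ?thesis by simp
    qed
    ultimately show "(\<forall>x\<in>{0..pi}. y x > 0) \<and> y' pi > E * y pi" by blast
  qed
qed

end

section \<open>Positivity of the lowest eigenfunction\<close>

context integrable_potential
begin

text \<open>The characteristic function \<open>W\<close> is positive near minus infinity and has no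
  zero below \<open>l0\<close>, so it cannot be negative anywhere up to \<open>l0\<close>. A failure
  at or below \<Lambda> would produce a negative value of \<open>W\<close> for finite
  \<open>F\<close>. For \<open>F = Infty\<close> one has \<open>W l = y l pi\<close>, and a failure
  only produces a zero; hence the strict inequality \<open>\<Lambda> < l0\<close> in that
  case.\<close>

lemma ground_state_positive:
  fixes y y' :: "real \<Rightarrow> real \<Rightarrow> real"
  assumes f: "f \<in> class_R" "f \<noteq> Infty" and F: "F \<in> class_R"
    and sol: "\<And>l. is_solution q l (y l) (y' l)"
    and init: "\<And>l. y l 0 = poly (fdown f) l" "\<And>l. y' l 0 = - poly (fup f) l"
    and nz: "\<And>l. l < l0 \<Longrightarrow> poly (fdown F) l * y' l pi - poly (fup F) l * y l pi \<noteq> 0"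
    and \<Lambda>: "if F = Infty then \<Lambda> < l0 else \<Lambda> \<le> l0"
  shows "(\<forall>k\<in>poles f. \<Lambda> < k) \<and> (F \<noteq> Infty \<longrightarrow> (\<forall>k\<in>poles F. \<Lambda> < k)) \<and> (\<forall>x\<in>{0..pi}. y \<Lambda> x > 0)"
proof -
  define W where "W = (\<lambda>l. poly (fdown F) l * y' l pi - poly (fup F) l * y l pi)"
  define good where "good = (\<lambda>l. (\<forall>k\<in>poles f. l < k) \<and> (\<forall>x\<in>{0..pi}. y l x > 0))"
  have dep: "\<exists>d>0. \<forall>l x. \<bar>l - m\<bar> < d \<longrightarrow> x \<in> {0..pi} \<longrightarrow> \<bar>y l x - y m x\<bar> < e \<and> \<bar>y' l x - y' m x\<bar> < e"
    if "e > 0" for m e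
  proof -
    have "isCont (\<lambda>l. y l 0) m" "isCont (\<lambda>l. y' l 0) m"
      unfolding init by (intro continuous_intros poly_isCont)+
    from solution_dependence[of y y' m e, OF sol this that] show ?thesis by metis
  qed
  have lim: "((\<lambda>l. y l x) \<longlongrightarrow> y m x) (at m)" "((\<lambda>l. y' l x) \<longlongrightarrow> y' m x) (at m)" if x: "x \<in> {0..pi}" for x m
  proof -
    have *: "\<exists>d>0. \<forall>l. l \<noteq> m \<and> dist l m < d \<longrightarrow> dist (y l x) (y m x) < e \<and> dist (y' l x) (y' m x) < e" if "e > 0" for e
      using dep[OF that, of m] x unfolding dist_real_def by blast
    show "((\<lambda>l. y l x) \<longlongrightarrow> y m x) (at m)" "((\<lambda>l. y' l x) \<longlongrightarrow> y' m x) (at m)"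
      unfolding LIM_def using * by blast+
  qed
  have contW: "isCont W m" for m
    unfolding W_def isCont_def using lim[of pi m]
    by (intro tendsto_intros) (auto intro: isContD poly_isCont)
  \<comment> \<open>At a pole of \<open>F\<close> the term with \<open>fdown F\<close> drops out,
    and the positive residue decides the sign.\<close>
  have pole_neg: "W p < 0" if "F \<noteq> Infty" "poles F \<noteq> {}" "p = Min (poles F)" "good p" for p
  proof -
    have "poly (fdown F) p = 0" "poly (fup F) p > 0" using first_pole[OF F that(1,2)] that(3) by auto
    moreover have "y p pi > 0" using that(4) by (simp add: good_def)
    ultimately show ?thesis by (simp add: W_def)
  qed
  obtain m where m: "\<And>l. l < m \<Longrightarrow> good l \<and> W l > 0"
  proof -
    obtain C m1 where C: "\<And>l. l < m1 \<Longrightarrow> (\<forall>k\<in>poles f. l < k) \<and> poly (fup f) l \<le> C * poly (fdown f) l"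
      using class_R_bounded_at_bot[OF f] by blast
    obtain E m2 where E: "\<And>l. l < m2 \<Longrightarrow> F \<noteq> Infty \<Longrightarrow> (\<forall>k\<in>poles F. l < k) \<and> poly (fup F) l \<le> E * poly (fdown F) l"
      using class_R_bounded_at_bot[OF F] by blast
    obtain m3 where m3: "\<And>l y y'. l < m3 \<Longrightarrow> is_solution q l y y' \<Longrightarrow> y 0 > 0 \<Longrightarrow> y' 0 \<ge> - C * y 0 \<Longrightarrow>
        (\<forall>x\<in>{0..pi}. y x > 0) \<and> y' pi > E * (y pi :: real)"
      using solution_positive_at_bot[of C E] by blast
    show thesis
    proof (rule that[of "min m1 (min m2 m3)"])
      fix l assume "l < min m1 (min m2 m3)"
      then have l: "l < m1" "l < m2" "l < m3" by auto
      have y0: "y l 0 > 0" unfolding init using C[OF l(1)] by (intro fdown_pos[OF f]) auto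
      have "y' l 0 \<ge> - C * y l 0" unfolding init using C[OF l(1)] by simp
      from m3[OF l(3) sol y0 this] have pos: "\<forall>x\<in>{0..pi}. y l x > 0" and yE: "y' l pi > E * y l pi" by auto
      have "W l > 0"
      proof (cases "F = Infty")
        case True
        then show ?thesis using pos by (simp add: W_def)
      next
        case False
        have d: "poly (fdown F) l > 0" using E[OF l(2) False] by (intro fdown_pos[OF F False]) auto
        have "poly (fup F) l * y l pi \<le> E * poly (fdown F) l * y l pi"
          using E[OF l(2) False] pos by (intro mult_right_mono) (auto simp: less_imp_le)
        also have "\<dots> = poly (fdown F) l * (E * y l pi)" by simp
        also have "\<dots> < poly (fdown F) l * y' l pi" using d yE by (intro mult_strict_left_mono)
        finally show ?thesis by (simp add: W_def)
      qed
      then show "good l \<and> W l > 0" using pos C[OF l(1)] by (simp add: good_def)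
    qed
  qed
  \<comment> \<open>The zero found lies strictly below \<open>l0\<close>: at \<open>l0\<close> it
    would coincide with \<open>t\<close>, where \<open>W\<close> is negative.\<close>
  have no_neg: False if t: "W t < 0" "t \<le> l0" for t
  proof -
    define s where "s = min m t - 1"
    have s: "s < m" "s \<le> t" by (auto simp: s_def)
    have "\<exists>c. s \<le> c \<and> c \<le> t \<and> W c = 0"
      using m[OF s(1)] t s contW by (intro IVT2) auto
    then obtain c where c: "c \<le> t" "W c = 0" by blast
    then have "c < l0" using t by (metis less_eq_real_def order_less_trans less_irrefl)
    from nz[OF this] c(2) show False by (simp add: W_def)
  qed
  \<comment> \<open>The positive minimum of \<open>y p\<close> on the compact interval and the
    finitely many gaps to the poles of \<open>f\<close> bound the admissible change of the
    parameter.\<close>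
  have good_open: "\<exists>d>0. \<forall>l. \<bar>l - p\<bar> < d \<longrightarrow> good l" if p: "good p" for p
  proof -
    have "continuous_on {0..pi} (y p)" using is_solution_continuous(1)[OF sol] .
    then obtain x0 where x0: "x0 \<in> {0..pi}" "\<And>x. x \<in> {0..pi} \<Longrightarrow> y p x0 \<le> y p x"
      using continuous_attains_inf[of "{0..pi}" "y p"] by auto
    have "y p x0 > 0" using p x0 by (simp add: good_def)
    from dep[OF this, of p] obtain d where d: "d > 0"
      "\<And>l x. \<bar>l - p\<bar> < d \<Longrightarrow> x \<in> {0..pi} \<Longrightarrow> \<bar>y l x - y p x\<bar> < y p x0" by blast
    have fin: "finite (poles f)" by (rule finite_poles[OF f])
    define d' where "d' = Min (insert d ((\<lambda>k. k - p) ` poles f))"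
    have d': "d' > 0" "d' \<le> d" "\<And>k. k \<in> poles f \<Longrightarrow> d' \<le> k - p"
      using fin d(1) p by (auto simp: d'_def good_def)
    have "good l" if l: "\<bar>l - p\<bar> < d'" for l
      unfolding good_def
    proof (intro conjI ballI)
      fix k assume "k \<in> poles f" then show "l < k" using d'(3)[of k] l by linarith
    next
      fix x assume x: "x \<in> {0..pi}"
      show "y l x > 0" using d(2)[of l x] x0(2)[OF x] l d'(2) x by linarith
    qed
    then show ?thesis using d'(1) by blast
  qed
  \<comment> \<open>At a first failure \<open>y s\<close> is still nonnegative, as a limit. A zero
    with nonzero slope at 0 or in the interior would produce negative values next to it, and one
    with slope 0 would make the solution vanish identically. What remains is a zero at
    \<open>pi\<close> with negative slope.\<close>
  have boundary: "(\<forall>k\<in>poles f. s < k) \<and> y s pi = 0 \<and> y' s pi < 0"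
    if below: "\<And>l. l < s \<Longrightarrow> good l" and ng: "\<not> good s" for s
  proof -
    have nonneg: "y s x \<ge> 0" if x: "x \<in> {0..pi}" for x
    proof (rule tendsto_lowerbound)
      show "((\<lambda>l. y l x) \<longlongrightarrow> y s x) (at_left s)"
        using lim(1)[OF x] by (rule filterlim_mono[OF _ order_refl at_le]) auto
      show "eventually (\<lambda>l. 0 \<le> y l x) (at_left s)"
        using below x by (intro eventually_at_leftI[of "s - 1"]) (auto simp: good_def intro: less_imp_le)
    qed simp
    have dy: "(y s has_real_derivative y' s x) (at x within {0..pi})" if "x \<in> {0..pi}" for x
      using is_solution_deriv[OF sol that] by (simp add: has_real_derivative_iff_has_vector_derivative)
    have le: "s \<le> k" if "k \<in> poles f" for k
    proof (rule ccontr)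
      assume "\<not> s \<le> k"
      then have "good ((s + k) / 2)" by (intro below) simp
      then show False using that \<open>\<not> s \<le> k\<close> by (force simp: good_def)
    qed
    have pl: "\<forall>k\<in>poles f. s < k"
    proof (rule ccontr)
      assume "\<not> (\<forall>k\<in>poles f. s < k)"
      then obtain k where k: "k \<in> poles f" "k \<le> s" by (auto simp: not_less)
      then have "k = s" using le[OF k(1)] by simp
      then have sp: "s \<in> poles f" using k(1) by simp
      then have "s = Min (poles f)" using le finite_poles[OF f] by (intro Min_eqI[symmetric]) auto
      then have "y s 0 = 0" "y' s 0 < 0" using first_pole[OF f] sp by (auto simp: init)
      have "(y s has_real_derivative y' s 0) (at 0 within {0..pi})" by (rule dy) simp
      from has_real_derivative_neg_dec_right[OF this \<open>y' s 0 < 0\<close>] obtain d where d: "d > 0"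
        "\<And>h. h > 0 \<Longrightarrow> 0 + h \<in> {0..pi} \<Longrightarrow> h < d \<Longrightarrow> y s (0 + h) < y s 0" by blast
      define h where "h = min (d / 2) pi"
      have "h > 0" "h < d" "h \<le> pi" using d(1) by (auto simp: h_def)
      then show False using d(2)[of h] nonneg[of h] \<open>y s 0 = 0\<close> by simp
    qed
    have y0: "y s 0 > 0" unfolding init by (rule fdown_pos[OF f pl])
    obtain x where x: "x \<in> {0..pi}" "y s x = 0" using ng pl nonneg by (force simp: good_def)
    have nd: "y' s x \<noteq> 0" using solution_zero[OF sol x(1,2), of 0] y0 by auto
    have "x > 0" using x y0 by (cases "x = 0") auto
    have neg: "y' s x < 0"
    proof (rule ccontr)
      assume "\<not> y' s x < 0"
      then have "y' s x > 0" using nd by simp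
      from has_real_derivative_pos_inc_left[OF dy[OF x(1)] this] obtain d where d: "d > 0"
        "\<And>h. h > 0 \<Longrightarrow> x - h \<in> {0..pi} \<Longrightarrow> h < d \<Longrightarrow> y s (x - h) < y s x" by blast
      define h where "h = min (d / 2) x"
      have "h > 0" "h < d" "h \<le> x" using d(1) \<open>x > 0\<close> by (auto simp: h_def)
      then show False using d(2)[of h] nonneg[of "x - h"] x by simp
    qed
    have "x = pi"
    proof (rule ccontr)
      assume "x \<noteq> pi"
      then have xp: "x < pi" using x by simp
      from has_real_derivative_neg_dec_right[OF dy[OF x(1)] neg] obtain d where d: "d > 0"
        "\<And>h. h > 0 \<Longrightarrow> x + h \<in> {0..pi} \<Longrightarrow> h < d \<Longrightarrow> y s (x + h) < y s x" by blast
      define h where "h = min (d / 2) (pi - x)"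
      have "h > 0" "h < d" "h \<le> pi - x" using d(1) xp by (auto simp: h_def)
      then show False using d(2)[of h] nonneg[of "x + h"] x by simp
    qed
    then show ?thesis using pl x neg by simp
  qed
  have good\<Lambda>: "\<forall>l\<le>\<Lambda>. good l"
  proof (rule ccontr)
    assume n\<Lambda>: "\<not> (\<forall>l\<le>\<Lambda>. good l)"
    define S where "S = {l. \<forall>k\<le>l. good k}"
    have S_le: "l \<le> \<Lambda>" if "l \<in> S" for l using that n\<Lambda> by (force simp: S_def)
    have Sne: "m - 1 \<in> S" using m by (auto simp: S_def)
    have bdd: "bdd_above S" using S_le by (intro bdd_aboveI) blast
    define s where "s = Sup S"
    have s\<Lambda>: "s \<le> \<Lambda>" unfolding s_def using Sne S_le by (intro cSup_least) auto
    have below: "good l" if lt: "l < s" for l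
    proof -
      obtain r where "r \<in> S" "l < r" using lt less_cSup_iff[OF _ bdd, of l] Sne unfolding s_def by blast
      then show ?thesis by (simp add: S_def)
    qed
    have "\<not> good s"
    proof
      assume "good s"
      from good_open[OF this] obtain d where d: "d > 0" "\<And>l. \<bar>l - s\<bar> < d \<Longrightarrow> good l" by blast
      have "s + d / 2 \<in> S"
        unfolding S_def
      proof (clarify)
        fix k assume "k \<le> s + d / 2"
        then show "good k" using below[of k] d(2)[of k] d(1) by (cases "k < s") auto
      qed
      then have "s + d / 2 \<le> s" unfolding s_def by (rule cSup_upper[OF _ bdd])
      then show False using d(1) by simp
    qed
    from boundary[OF below this] have sp: "\<forall>k\<in>poles f. s < k" "y s pi = 0" "y' s pi < 0" by auto
    show False
    proof (cases "F = Infty")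
      case True
      then have "W s = 0" using sp by (simp add: W_def)
      then show False using nz[of s] s\<Lambda> \<Lambda> True by (simp add: W_def)
    next
      case False
      have sl0: "s \<le> l0" using s\<Lambda> \<Lambda> False by simp
      have finF: "finite (poles F)" by (rule finite_poles[OF F False])
      show False
      proof (cases "\<exists>p\<in>poles F. p < s")
        case True
        define p where "p = Min (poles F)"
        obtain k where k: "k \<in> poles F" "k < s" using True by blast
        then have "p \<le> k" using finF by (simp add: p_def)
        then have "p < s" using k(2) by simp
        then have "W p < 0" using True below by (intro pole_neg[OF False _ p_def]) auto
        then show False using no_neg[of p] \<open>p < s\<close> sl0 by simp
      next
        case no: False
        show False
        proof (cases "s \<in> poles F")
          case False
          have "\<forall>k\<in>poles F. s < k"
          proof
            fix k assume "k \<in> poles F"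
            then have "k \<noteq> s" "\<not> k < s" using False no by auto
            then show "s < k" by simp
          qed
          then have "poly (fdown F) s > 0" by (rule fdown_pos[OF F \<open>F \<noteq> Infty\<close>])
          then have "W s < 0" using sp by (simp add: W_def mult_pos_neg)
          then show False using no_neg[of s] sl0 by simp
        next
          \<comment> \<open>\<open>fdown F\<close> and \<open>y s pi\<close> both vanish at
            \<open>s\<close>, so \<open>W s = 0\<close> decides nothing. Slightly to the left of
            \<open>s\<close> both terms of \<open>W\<close> are negative.\<close>
          case True
          then have "s = Min (poles F)" using no finF by (intro Min_eqI[symmetric]) (auto simp: not_less)
          then have fs: "poly (fup F) s > 0" using first_pole[OF F False] True by auto
          have "eventually (\<lambda>l. poly (fup F) l > 0) (at s)"
            using fs poly_isCont[of s "fup F"] by (intro order_tendstoD(1)) (auto simp: isCont_def)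
          moreover have "eventually (\<lambda>l. y' l pi < 0) (at s)"
            using sp(3) lim(2)[of pi s] by (intro order_tendstoD(2)) auto
          ultimately have "eventually (\<lambda>l. poly (fup F) l > 0 \<and> y' l pi < 0) (at s)"
            by (rule eventually_conj)
          then obtain d where d: "d > 0" "\<And>l. l \<noteq> s \<Longrightarrow> dist l s < d \<Longrightarrow> poly (fup F) l > 0 \<and> y' l pi < 0"
            unfolding eventually_at by blast
          define t where "t = s - d / 2"
          have t: "t < s" "poly (fup F) t > 0" "y' t pi < 0" using d by (auto simp: t_def dist_real_def)
          have "\<forall>k\<in>poles F. t < k" using no t(1) by (metis not_less order_less_le_trans)
          then have "poly (fdown F) t > 0" by (rule fdown_pos[OF F False])
          moreover have "y t pi > 0" using below[OF t(1)] by (simp add: good_def)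
          ultimately have "poly (fdown F) t * y' t pi < 0" "poly (fup F) t * y t pi > 0"
            using t by (auto intro: mult_pos_neg mult_pos_pos)
          then have "W t < 0" unfolding W_def by linarith
          then show False using no_neg[of t] t(1) sl0 by simp
        qed
      qed
    qed
  qed
  have "\<forall>k\<in>poles F. \<Lambda> < k" if "F \<noteq> Infty"
  proof (rule ccontr)
    assume "\<not> (\<forall>k\<in>poles F. \<Lambda> < k)"
    then obtain k where k: "k \<in> poles F" "k \<le> \<Lambda>" by (auto simp: not_less)
    have finF: "finite (poles F)" by (rule finite_poles[OF F that])
    define p where "p = Min (poles F)"
    have "p \<le> \<Lambda>" using k finF by (auto simp: p_def intro: order_trans[OF Min_le])
    then have "W p < 0" using good\<Lambda> k by (intro pole_neg[OF that _ p_def]) auto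
    then show False using no_neg[of p] \<open>p \<le> \<Lambda>\<close> \<Lambda> that by simp
  qed
  then show ?thesis using good\<Lambda> by (auto simp: good_def)
qed

end

section \<open>The Darboux transformation\<close>

lemma is_solution_zero_deriv:
  assumes "is_solution q \<zeta> y y'" "\<And>x. x \<in> {0..pi} \<Longrightarrow> y x = 0" "x \<in> {0..pi}"
  shows "y' x = 0"
proof -
  have 1: "(y has_vector_derivative y' x) (at x within cbox 0 pi)"
    using is_solution_deriv[OF assms(1,3)] by (simp add: cbox_interval)
  have 2: "(y has_vector_derivative 0) (at x within cbox 0 pi)"
    unfolding box_real
    by (rule has_vector_derivative_transform[OF assms(3) _ has_vector_derivative_const]) (rule assms(2))
  show ?thesis
    by (rule vector_derivative_unique_within_closed_interval[OF _ _ 1 2]) (use assms(3) in auto)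
qed

text \<open>\<open>w\<close> solves the Riccati equation of \<open>p\<close> at \<Lambda>, and
  \<open>r\<close> is \<open>p - 2 w'\<close> with the derivative eliminated. The function
  \<open>- w\<close> satisfies the same hypotheses with \<open>p\<close> and \<open>r\<close>
  exchanged, so the inverse transformation is another instance.\<close>

lemma darboux_transform:
  fixes y :: "real \<Rightarrow> 'a :: {real_normed_field, banach}"
  assumes w: "ac 0 pi w" "negligible N"
    "\<And>x. x \<in> {0<..<pi} - N \<Longrightarrow> (w has_vector_derivative p x - \<Lambda> - (w x)\<^sup>2) (at x)"
    "\<And>x. x \<in> {0<..<pi} - N \<Longrightarrow> r x = 2 * \<Lambda> + 2 * (w x)\<^sup>2 - p x"
    and sol: "is_solution p \<zeta> y y'"
  shows "is_solution r \<zeta> (\<lambda>x. y' x - of_real (w x) * y x)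
    (\<lambda>x. (of_real \<Lambda> - \<zeta>) * y x - of_real (w x) * (y' x - of_real (w x) * y x))"
proof -
  obtain M where M: "negligible M"
    "\<And>x. x \<in> {0<..<pi} - M \<Longrightarrow> (y' has_vector_derivative (of_real (p x) - \<zeta>) * y x) (at x)"
    using is_solution_AE_deriv[OF sol] by blast
  define z where "z = (\<lambda>x. y' x - of_real (w x) * y x)"
  define z' where "z' = (\<lambda>x. (of_real \<Lambda> - \<zeta>) * y x - of_real (w x) * z x)"
  have ac_y: "ac 0 pi y" "ac 0 pi y'" using is_solution_ac[OF sol] is_solution_ac_deriv[OF sol] .
  have ac_z: "ac 0 pi z" unfolding z_def by (intro ac_diff ac_mult ac_of_real w ac_y)
  have ac_z': "ac 0 pi z'" unfolding z'_def by (intro ac_diff ac_mult ac_of_real ac_const w ac_y ac_z)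
  have NM: "negligible (N \<union> M)" using w(2) M(1) by simp
  have dy: "(y has_vector_derivative y' x) (at x)" if "x \<in> {0<..<pi}" for x
    using is_solution_deriv[OF sol, of x] that by (simp add: at_within_Icc_at)
  have dw: "((\<lambda>x. of_real (w x) :: 'a) has_vector_derivative of_real (p x - \<Lambda> - (w x)\<^sup>2)) (at x)"
    if "x \<in> {0<..<pi} - N" for x
    by (rule bounded_linear.has_vector_derivative[OF bounded_linear_of_real w(3)[OF that]])
  have dz: "(z has_vector_derivative z' x) (at x within {0..pi})" if x: "x \<in> {0..pi}" for x
  proof (rule ac_derivative_continuous[OF ac_z NM ac_continuous_on[OF ac_z'] _ x])
    fix x assume x: "x \<in> {0<..<pi} - (N \<union> M)"
    have "(z has_vector_derivative (of_real (p x) - \<zeta>) * y x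
        - (of_real (w x) * y' x + of_real (p x - \<Lambda> - (w x)\<^sup>2) * y x)) (at x)"
      unfolding z_def
      by (intro has_vector_derivative_diff has_vector_derivative_mult M(2) dw dy) (use x in auto)
    moreover have "(of_real (p x) - \<zeta>) * y x - (of_real (w x) * y' x + of_real (p x - \<Lambda> - (w x)\<^sup>2) * y x) = z' x"
      by (simp add: z'_def z_def algebra_simps power2_eq_square)
    ultimately show "(z has_vector_derivative z' x) (at x)" by (simp only:)
  qed
  have "is_solution r \<zeta> z z'"
  proof (rule is_solutionI[OF dz ac_z' NM])
    fix x assume x: "x \<in> {0<..<pi} - (N \<union> M)"
    have dzx: "(z has_vector_derivative z' x) (at x)"
      using dz[of x] x by (simp add: at_within_Icc_at)
    have "(z' has_vector_derivative (of_real \<Lambda> - \<zeta>) * y' x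
        - (of_real (w x) * z' x + of_real (p x - \<Lambda> - (w x)\<^sup>2) * z x)) (at x)"
      unfolding z'_def
      by (intro has_vector_derivative_diff has_vector_derivative_mult has_vector_derivative_mult_right
        dw dy dzx[unfolded z'_def]) (use x in auto)
    moreover have "(of_real \<Lambda> - \<zeta>) * y' x - (of_real (w x) * z' x + of_real (p x - \<Lambda> - (w x)\<^sup>2) * z x)
      = (of_real (r x) - \<zeta>) * z x"
    proof -
      have rx: "r x = 2 * \<Lambda> + 2 * (w x)\<^sup>2 - p x" using x by (intro w(4)) auto
      have y'x: "y' x = z x + of_real (w x) * y x" by (simp add: z_def)
      show ?thesis unfolding rx y'x z'_def by (simp add: algebra_simps power2_eq_square)
    qed
    ultimately show "(z' has_vector_derivative (of_real (r x) - \<zeta>) * z x) (at x)" by (simp only:)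
  qed
  then show ?thesis unfolding z'_def z_def .
qed

text \<open>The polynomial relations between a boundary function and its transform, detached from
  rational functions. The two signs matter when the spectral parameter is \<Lambda> itself;
  \<open>fdown g\<close> may vanish there, as it does for \<open>g = Infty\<close>.\<close>

definition boundary_transform :: "real \<Rightarrow> real \<Rightarrow> boundary_fun \<Rightarrow> boundary_fun \<Rightarrow> bool" where
  "boundary_transform \<Lambda> t f g \<longleftrightarrow>
    (if f = Infty then fdown g = 1 \<and> fup g = [:- t:]
     else fup f - smult t (fdown f) = [:- \<Lambda>, 1:] * fdown g \<and> fup g = - fdown f - smult t (fdown g) \<and>
       poly (fdown f) \<Lambda> > 0 \<and> poly (fdown g) \<Lambda> \<ge> 0)"

lemma boundary_transform_finite:
  assumes "boundary_transform \<Lambda> t f g" "f \<noteq> Infty"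
  shows "cpoly (fup f) z = of_real t * cpoly (fdown f) z + (z - of_real \<Lambda>) * cpoly (fdown g) z"
    and "cpoly (fup g) z = - cpoly (fdown f) z - of_real t * cpoly (fdown g) z"
proof -
  have *: "fup f - smult t (fdown f) = [:- \<Lambda>, 1:] * fdown g" "fup g = - fdown f - smult t (fdown g)"
    using assms by (auto simp: boundary_transform_def)
  have "cpoly (fup f - smult t (fdown f)) z = cpoly ([:- \<Lambda>, 1:] * fdown g) z" by (simp only: *(1))
  then show "cpoly (fup f) z = of_real t * cpoly (fdown f) z + (z - of_real \<Lambda>) * cpoly (fdown g) z"
    by (simp add: cpoly_diff cpoly_smult cpoly_mult algebra_simps del: mult_pCons_left)
  show "cpoly (fup g) z = - cpoly (fdown f) z - of_real t * cpoly (fdown g) z"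
    by (simp add: *(2) cpoly_diff cpoly_smult cpoly_minus)
qed

text \<open>\<open>a\<close> and \<open>b\<close> stand for the values of \<open>y\<close> and
  \<open>y'\<close> at 0, \<open>u\<close> and \<open>u'\<close> for those of the transform, with
  \<open>w = - t\<close> there. The two boundary forms agree up to sign if \<open>f\<close> is
  finite, and up to the factor \<open>z - \<Lambda>\<close> for a Dirichlet condition.\<close>

lemma boundary_transform_left_iff:
  assumes bt: "boundary_transform \<Lambda> t f g" and ne: "z \<noteq> of_real \<Lambda>"
    and u: "u = b + of_real t * a" and u': "u' = (of_real \<Lambda> - z) * a + of_real t * u"
  shows "cpoly (fdown g) z * u' + cpoly (fup g) z * u = 0 \<longleftrightarrow> cpoly (fdown f) z * b + cpoly (fup f) z * a = 0"
proof (cases "f = Infty")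
  case True
  then have "fdown g = 1" "fup g = [:- t:]" using bt by (auto simp: boundary_transform_def)
  then have "cpoly (fdown g) z * u' + cpoly (fup g) z * u = (of_real \<Lambda> - z) * a" by (simp add: u')
  moreover have "cpoly (fdown f) z * b + cpoly (fup f) z * a = - a" using True by (simp add: cpoly_minus)
  ultimately show ?thesis using ne by simp
next
  case False
  have "cpoly (fdown g) z * u' + cpoly (fup g) z * u = - (cpoly (fdown f) z * b + cpoly (fup f) z * a)"
    unfolding boundary_transform_finite[OF bt False] u' u by (simp add: algebra_simps)
  then show ?thesis by (metis neg_equal_0_iff_equal)
qed

text \<open>Negating \<open>a\<close> and \<open>u'\<close>, as the reflection of the interval does
  up to a common sign, turns this into the left case.\<close>

lemma boundary_transform_right_iff:
  assumes bt: "boundary_transform \<Lambda> t f g" and ne: "z \<noteq> of_real \<Lambda>"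
    and u: "u = b - of_real t * a" and u': "u' = (of_real \<Lambda> - z) * a - of_real t * u"
  shows "cpoly (fdown g) z * u' - cpoly (fup g) z * u = 0 \<longleftrightarrow> cpoly (fdown f) z * b - cpoly (fup f) z * a = 0"
proof -
  have "cpoly (fdown g) z * (- u') + cpoly (fup g) z * u = 0 \<longleftrightarrow> cpoly (fdown f) z * b + cpoly (fup f) z * (- a) = 0"
    by (rule boundary_transform_left_iff[OF bt ne]) (simp_all add: u u' algebra_simps)
  moreover have "cpoly (fdown g) z * (- u') + cpoly (fup g) z * u = - (cpoly (fdown g) z * u' - cpoly (fup g) z * u)"
    by simp
  ultimately show ?thesis by (simp only: neg_equal_0_iff_equal mult_minus_right diff_conv_add_uminus)
qed

text \<open>A substitute for the correspondence of boundary forms at \<Lambda>: the identity for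
  \<open>fup g\<close> expresses \<open>z\<close> through \<open>z' - t * z\<close>, which is the
  value of \<open>z' + w z\<close> at 0, and the signs of the two denominators give
  \<open>c \<ge> 0\<close>.\<close>

lemma boundary_transform_at:
  assumes bt: "boundary_transform \<Lambda> t f g" and bc: "poly (fdown g) \<Lambda> * z' + poly (fup g) \<Lambda> * z = 0"
  shows "if f = Infty then z' - t * z = 0 else \<exists>c\<ge>0. z = c * (z' - t * z)"
proof (cases "f = Infty")
  case True
  then show ?thesis using bt bc by (simp add: boundary_transform_def)
next
  case False
  have pos: "poly (fdown f) \<Lambda> > 0" "poly (fdown g) \<Lambda> \<ge> 0"
    using bt False by (auto simp: boundary_transform_def)
  have eq: "poly (fup g) \<Lambda> = - poly (fdown f) \<Lambda> - t * poly (fdown g) \<Lambda>"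
    using bt False by (simp add: boundary_transform_def)
  have "poly (fdown f) \<Lambda> * z = poly (fdown g) \<Lambda> * (z' - t * z)"
    using bc unfolding eq by (simp add: algebra_simps)
  then have "z = (poly (fdown g) \<Lambda> / poly (fdown f) \<Lambda>) * (z' - t * z)"
    using pos by (simp add: field_simps)
  moreover have "poly (fdown g) \<Lambda> / poly (fdown f) \<Lambda> \<ge> 0" using pos by simp
  ultimately show ?thesis using False by auto
qed

text \<open>\<open>deriv_down_sq\<close> is the Wronskian of the two polynomials, so the multiples
  of \<open>t\<close> drop out. The additional product of denominators is what later cancels a
  boundary term from the integral of the squared transform.\<close>

lemma boundary_transform_deriv_down_sq:
  assumes bt: "boundary_transform \<Lambda> t f g"
  shows "poly (deriv_down_sq f) x = (if f = Infty then 0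
    else poly (fdown f) x * poly (fdown g) x + (x - \<Lambda>) * poly (deriv_down_sq g) x)"
    and "f = Infty \<Longrightarrow> deriv_down_sq g = 0"
proof -
  show "deriv_down_sq g = 0" if "f = Infty"
    using bt that by (simp add: boundary_transform_def deriv_down_sq_def pderiv_pCons pderiv_1)
  show "poly (deriv_down_sq f) x = (if f = Infty then 0
    else poly (fdown f) x * poly (fdown g) x + (x - \<Lambda>) * poly (deriv_down_sq g) x)"
  proof (cases "f = Infty")
    case False
    then have *: "fup f = smult t (fdown f) + [:- \<Lambda>, 1:] * fdown g" "fup g = - fdown f - smult t (fdown g)"
      using bt by (auto simp: boundary_transform_def algebra_simps)
    have p: "pderiv [:- \<Lambda>, 1:] = 1" by (simp add: pderiv_pCons)
    have "poly (pderiv (fup f)) x = t * poly (pderiv (fdown f)) x + (x - \<Lambda>) * poly (pderiv (fdown g)) x + poly (fdown g) x"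
      unfolding *(1) pderiv_add pderiv_smult pderiv_mult p poly_add poly_smult poly_mult by simp
    moreover have "poly (fup f) x = t * poly (fdown f) x + (x - \<Lambda>) * poly (fdown g) x"
      unfolding *(1) poly_add poly_smult poly_mult by simp
    moreover have "poly (pderiv (fup g)) x = - poly (pderiv (fdown f)) x - t * poly (pderiv (fdown g)) x"
      unfolding *(2) pderiv_diff pderiv_smult pderiv_minus poly_diff poly_smult poly_minus by simp
    moreover have "poly (fup g) x = - poly (fdown f) x - t * poly (fdown g) x"
      unfolding *(2) by simp
    ultimately show ?thesis using False
      by (simp only: deriv_down_sq_def poly_diff poly_mult if_False) (simp add: algebra_simps)
  qed (simp add: deriv_down_sq_def)
qed

lemma Theta_boundary_transform:
  assumes f: "f \<in> class_R" and \<Lambda>: "f \<noteq> Infty \<Longrightarrow> \<forall>k\<in>poles f. \<Lambda> < k"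
    and t: "f \<noteq> Infty \<Longrightarrow> t = poly (fup f) \<Lambda> / poly (fdown f) \<Lambda>"
  shows "boundary_transform \<Lambda> t f (Theta \<Lambda> t f) \<and> Theta \<Lambda> t f \<in> class_R
    \<and> ind f - ind (Theta \<Lambda> t f) = (if f = Infty then -1 else 1)"
proof (cases "f = Infty")
  case True
  then show ?thesis by (simp add: boundary_transform_def constant_class_R del: fup.simps(2))
next
  case False
  then show ?thesis
    using Theta_class_R[OF f False \<Lambda>[OF False] t[OF False]] fdown_pos[OF f False \<Lambda>[OF False]]
    by (simp add: boundary_transform_def)
qed

section \<open>Eigenvalues as zeros of the characteristic function, and the factor
  \<open>beta\<close>\<close>

lemma proportional_pair:
  fixes a b u u' :: real
  assumes "a * u' + b * u = 0" "a \<noteq> 0 \<or> b \<noteq> 0"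
  obtains k where "u = k * a" "u' = - k * b"
proof (cases "a = 0")
  case True
  then have "b \<noteq> 0" "u = 0" using assms by auto
  then show thesis using True by (intro that[of "- u' / b"]) auto
next
  case False
  then show thesis using assms(1) by (intro that[of "u / a"]) (auto simp: field_simps eq_neg_iff_add_eq_0)
qed

text \<open>For a real parameter the real and imaginary parts satisfy the equation and both boundary
  conditions separately, and one of them is nontrivial.\<close>

lemma real_eigenfunction:
  assumes "complex_of_real l \<in> eigenvalues q f F"
  obtains y y' :: "real \<Rightarrow> real" and x where "is_solution q l y y'" "x \<in> {0..pi}" "y x \<noteq> 0"
    "poly (fdown f) l * y' 0 + poly (fup f) l * y 0 = 0"
    "poly (fdown F) l * y' pi - poly (fup F) l * y pi = 0"
proof -
  obtain y y' x where y: "is_solution q (complex_of_real l) y y'" "x \<in> {0..pi}" "y x \<noteq> 0"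
    "cpoly (fdown f) (complex_of_real l) * y' 0 + cpoly (fup f) (complex_of_real l) * y 0 = 0"
    "cpoly (fdown F) (complex_of_real l) * y' pi - cpoly (fup F) (complex_of_real l) * y pi = 0"
    using assms by (auto simp: eigenvalues_def)
  have bc: "complex_of_real (poly (fdown f) l) * y' 0 + complex_of_real (poly (fup f) l) * y 0 = 0"
    "complex_of_real (poly (fdown F) l) * y' pi - complex_of_real (poly (fup F) l) * y pi = 0"
    using y(4,5) by (simp_all only: cpoly_of_real)
  have "Re (y x) \<noteq> 0 \<or> Im (y x) \<noteq> 0" using y(3) by (simp add: complex_eq_iff)
  then show thesis
  proof
    assume "Re (y x) \<noteq> 0"
    show thesis
      by (rule that[OF is_solution_Re[OF y(1)] y(2) \<open>Re (y x) \<noteq> 0\<close>])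
        (use arg_cong[OF bc(1), of Re] arg_cong[OF bc(2), of Re] in simp_all)
  next
    assume "Im (y x) \<noteq> 0"
    show thesis
      by (rule that[OF is_solution_Im[OF y(1)] y(2) \<open>Im (y x) \<noteq> 0\<close>])
        (use arg_cong[OF bc(1), of Im] arg_cong[OF bc(2), of Im] in simp_all)
  qed
qed

lemma of_real_eigenvalue:
  fixes y :: "real \<Rightarrow> real"
  assumes "is_solution q l y y'" "x \<in> {0..pi}" "y x \<noteq> 0"
    "poly (fdown f) l * y' 0 + poly (fup f) l * y 0 = 0"
    "poly (fdown F) l * y' pi - poly (fup F) l * y pi = 0"
  shows "complex_of_real l \<in> eigenvalues q f F"
proof -
  have "complex_of_real (poly (fdown f) l) * of_real (y' 0) + of_real (poly (fup f) l) * of_real (y 0) = 0"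
    "complex_of_real (poly (fdown F) l) * of_real (y' pi) - of_real (poly (fup F) l) * of_real (y pi) = 0"
    using assms(4,5) by (simp_all flip: of_real_mult of_real_add of_real_diff)
  then show ?thesis
    unfolding eigenvalues_def mem_Collect_eq cpoly_of_real
    using is_solution_of_real[OF assms(1), where 'a = complex] assms(2,3) by (intro exI conjI bexI) auto
qed

abbreviation phi_deriv :: "(real \<Rightarrow> real) \<Rightarrow> boundary_fun \<Rightarrow> real \<Rightarrow> real \<Rightarrow> real" where
  "phi_deriv q f l \<equiv> snd (phi_pair q f l)"

abbreviation psi_deriv :: "(real \<Rightarrow> real) \<Rightarrow> boundary_fun \<Rightarrow> real \<Rightarrow> real \<Rightarrow> real" where
  "psi_deriv q F l \<equiv> snd (psi_pair q F l)"

context integrable_potential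
begin

lemma reflected: "integrable_potential (\<lambda>x. q (pi - x))"
  by unfold_locales (rule absolutely_integrable_reflect_interval[OF q_int])

lemma solution_exists_at_pi:
  fixes \<zeta> c d :: real
  shows "\<exists>y y'. is_solution q \<zeta> y y' \<and> y pi = c \<and> y' pi = d"
proof -
  interpret r: integrable_potential "\<lambda>x. q (pi - x)" by (rule reflected)
  obtain y y' where y: "is_solution (\<lambda>x. q (pi - x)) \<zeta> y y'" "y 0 = c" "y' 0 = - d"
    using r.solution_exists[of \<zeta> c "- d"] by blast
  have "is_solution q \<zeta> (\<lambda>x. y (pi - x)) (\<lambda>x. - y' (pi - x))"
    using is_solution_reflect[OF y(1)] by simp
  then show ?thesis using y(2,3) by (intro exI[of _ "\<lambda>x. y (pi - x)"] exI[of _ "\<lambda>x. - y' (pi - x)"]) simp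
qed

lemma phi_solution:
  "is_solution q l (phi q f l) (phi_deriv q f l)"
  "phi q f l 0 = poly (fdown f) l" "phi_deriv q f l 0 = - poly (fup f) l"
proof -
  let ?P = "\<lambda>p. is_solution q l (fst p) (snd p) \<and> fst p 0 = poly (fdown f) l \<and> snd p 0 = - poly (fup f) l"
  obtain y y' where "is_solution q l y y' \<and> y 0 = poly (fdown f) l \<and> y' 0 = - poly (fup f) l"
    using solution_exists by blast
  then have "?P (y, y')" by simp
  then have "\<exists>p. ?P p" by (rule exI)
  then have "?P (SOME p. ?P p)" by (rule someI_ex)
  then have "?P (phi_pair q f l)" by (simp only: phi_pair_def split_def)
  then show "is_solution q l (phi q f l) (phi_deriv q f l)"
    "phi q f l 0 = poly (fdown f) l" "phi_deriv q f l 0 = - poly (fup f) l"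
    by (simp_all add: phi_def)
qed

lemma psi_solution:
  "is_solution q l (psi q F l) (psi_deriv q F l)"
  "psi q F l pi = poly (fdown F) l" "psi_deriv q F l pi = poly (fup F) l"
proof -
  let ?P = "\<lambda>p. is_solution q l (fst p) (snd p) \<and> fst p pi = poly (fdown F) l \<and> snd p pi = poly (fup F) l"
  obtain y y' where "is_solution q l y y' \<and> y pi = poly (fdown F) l \<and> y' pi = poly (fup F) l"
    using solution_exists_at_pi by blast
  then have "?P (y, y')" by simp
  then have "\<exists>p. ?P p" by (rule exI)
  then have "?P (SOME p. ?P p)" by (rule someI_ex)
  then have "?P (psi_pair q F l)" by (simp only: psi_pair_def split_def)
  then show "is_solution q l (psi q F l) (psi_deriv q F l)"
    "psi q F l pi = poly (fdown F) l" "psi_deriv q F l pi = poly (fup F) l"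
    by (simp_all add: psi_def)
qed

lemma phi_nontrivial:
  assumes "f \<in> class_R" obtains x where "x \<in> {0..pi}" "phi q f l x \<noteq> 0"
proof -
  have "\<not> (\<forall>x\<in>{0..pi}. phi q f l x = 0)"
  proof
    assume *: "\<forall>x\<in>{0..pi}. phi q f l x = 0"
    then have "phi_deriv q f l 0 = 0" using is_solution_zero_deriv[OF phi_solution(1), where x = 0] by auto
    moreover have "phi q f l 0 = 0" using * by auto
    ultimately show False using fup_fdown_no_common_root[OF assms, of l] by (simp add: phi_solution)
  qed
  then show thesis using that by blast
qed

lemma solution_eq_multiple_phi:
  fixes u :: "real \<Rightarrow> real"
  assumes f: "f \<in> class_R" and u: "is_solution q l u u'"
    and bc: "poly (fdown f) l * u' 0 + poly (fup f) l * u 0 = 0"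
  obtains k where "\<And>x. x \<in> {0..pi} \<Longrightarrow> u x = k * phi q f l x \<and> u' x = k * phi_deriv q f l x"
proof -
  obtain k where k: "u 0 = k * poly (fdown f) l" "u' 0 = - k * poly (fup f) l"
    using proportional_pair[OF bc] fup_fdown_no_common_root[OF f, of l] by blast
  show thesis
  proof (rule that[of k])
    fix x assume "x \<in> {0..pi}"
    then show "u x = k * phi q f l x \<and> u' x = k * phi_deriv q f l x"
      by (intro solution_unique[OF u is_solution_cmult[OF phi_solution(1)], where t = 0]) (simp_all add: k phi_solution)
  qed
qed

text \<open>Every solution that meets the left condition is a multiple of \<open>phi\<close>, and
  \<open>phi\<close> is nontrivial; so only the right condition on \<open>phi\<close> is left to
  test.\<close>

lemma eigenvalue_iff:
  assumes f: "f \<in> class_R"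
  shows "complex_of_real l \<in> eigenvalues q f F \<longleftrightarrow>
    poly (fdown F) l * phi_deriv q f l pi - poly (fup F) l * phi q f l pi = 0"
proof
  assume "complex_of_real l \<in> eigenvalues q f F"
  then obtain u u' :: "real \<Rightarrow> real" and x where u: "is_solution q l u u'" "x \<in> {0..pi}" "u x \<noteq> 0"
    "poly (fdown f) l * u' 0 + poly (fup f) l * u 0 = 0"
    "poly (fdown F) l * u' pi - poly (fup F) l * u pi = 0"
    using real_eigenfunction by blast
  obtain k where k: "\<And>x. x \<in> {0..pi} \<Longrightarrow> u x = k * phi q f l x \<and> u' x = k * phi_deriv q f l x"
    using solution_eq_multiple_phi[OF f u(1,4)] by blast
  have "k \<noteq> 0" using k[OF u(2)] u(3) by auto
  moreover have "k * (poly (fdown F) l * phi_deriv q f l pi - poly (fup F) l * phi q f l pi) = 0"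
    using u(5) k[of pi] by (simp add: algebra_simps)
  ultimately show "poly (fdown F) l * phi_deriv q f l pi - poly (fup F) l * phi q f l pi = 0" by simp
next
  assume *: "poly (fdown F) l * phi_deriv q f l pi - poly (fup F) l * phi q f l pi = 0"
  obtain x where "x \<in> {0..pi}" "phi q f l x \<noteq> 0" using phi_nontrivial[OF f] by blast
  then show "complex_of_real l \<in> eigenvalues q f F"
    by (intro of_real_eigenvalue[OF phi_solution(1)]) (use * in \<open>simp_all add: phi_solution\<close>)
qed

lemma beta_eqI:
  assumes f: "f \<in> class_R" and b: "b \<noteq> 0" "\<And>x. x \<in> {0..pi} \<Longrightarrow> psi q F l x = b * phi q f l x"
  shows "beta q f F l = b"
  unfolding beta_def
proof (rule the_equality)
  obtain x where x: "x \<in> {0..pi}" "phi q f l x \<noteq> 0" using phi_nontrivial[OF f] by blast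
  fix c assume "c \<noteq> 0 \<and> (\<forall>x\<in>{0..pi}. psi q F l x = c * phi q f l x)"
  then show "c = b" using b(2)[OF x(1)] x by auto
qed (use b in auto)

text \<open>At an eigenvalue \<open>phi\<close> meets the right condition too, so its data at
  \<open>pi\<close> are proportional to those of \<open>psi\<close>; as \<open>phi\<close> is
  nontrivial, the factor can be inverted.\<close>

lemma psi_eq_beta_phi:
  assumes f: "f \<in> class_R" and F: "F \<in> class_R" and l: "complex_of_real l \<in> eigenvalues q f F"
  shows "beta q f F l \<noteq> 0" and "\<And>x. x \<in> {0..pi} \<Longrightarrow> psi q F l x = beta q f F l * phi q f l x"
    and "\<And>x. x \<in> {0..pi} \<Longrightarrow> psi_deriv q F l x = beta q f F l * phi_deriv q f l x"
proof -
  have bc: "poly (fdown F) l * phi_deriv q f l pi + - poly (fup F) l * phi q f l pi = 0"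
    using l eigenvalue_iff[OF f] by simp
  have nz: "poly (fdown F) l \<noteq> 0 \<or> - poly (fup F) l \<noteq> 0" using fup_fdown_no_common_root[OF F, of l] by auto
  obtain k where k: "phi q f l pi = k * poly (fdown F) l" "phi_deriv q f l pi = - k * - poly (fup F) l"
    by (rule proportional_pair[OF bc nz]) blast
  have eq: "phi q f l x = k * psi q F l x \<and> phi_deriv q f l x = k * psi_deriv q F l x" if "x \<in> {0..pi}" for x
    using that
    by (intro solution_unique[OF phi_solution(1) is_solution_cmult[OF psi_solution(1)], where t = pi])
      (simp_all add: k psi_solution)
  obtain x where "x \<in> {0..pi}" "phi q f l x \<noteq> 0" using phi_nontrivial[OF f] by blast
  then have k0: "k \<noteq> 0" using eq by auto
  have b: "beta q f F l = 1 / k"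
    by (rule beta_eqI[OF f]) (use k0 eq in auto)
  show "beta q f F l \<noteq> 0" using b k0 by simp
  show "psi q F l x = beta q f F l * phi q f l x" if "x \<in> {0..pi}" for x
    using b k0 eq[OF that] by simp
  show "psi_deriv q F l x = beta q f F l * phi_deriv q f l x" if "x \<in> {0..pi}" for x
    using b k0 eq[OF that] by simp
qed

end

text \<open>What the transformation uses of \<open>v\<close>: it has no zeros, and its logarithmic
  derivatives at the ends fit the boundary functions. The cases \<open>v = phi\<close> and
  \<open>v = psi\<close> are thereby treated together.\<close>

locale darboux = integrable_potential +
  fixes v v' :: "real \<Rightarrow> real" and \<Lambda> :: real and f F fh Fh :: boundary_fun
  assumes v_sol: "is_solution q \<Lambda> v v'" and v_nz: "\<And>x. x \<in> {0..pi} \<Longrightarrow> v x \<noteq> 0"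
    and f_R: "f \<in> class_R" and F_R: "F \<in> class_R" and fh_R: "fh \<in> class_R" and Fh_R: "Fh \<in> class_R"
    and left: "boundary_transform \<Lambda> (- v' 0 / v 0) f fh"
    and right: "boundary_transform \<Lambda> (v' pi / v pi) F Fh"
    and not_both: "f \<noteq> Infty \<or> F \<noteq> Infty"
begin

definition w :: "real \<Rightarrow> real" where "w x = v' x / v x"

definition qh :: "real \<Rightarrow> real" where "qh x = q x - 2 * deriv (\<lambda>t. v' t / v t) x"

lemma ac_w: "ac 0 pi w"
  unfolding w_def[abs_def]
  by (intro ac_divide is_solution_ac[OF v_sol] is_solution_ac_deriv[OF v_sol] v_nz)

lemma w_AE_deriv:
  obtains N where "negligible N"
    "\<And>x. x \<in> {0<..<pi} - N \<Longrightarrow> (w has_vector_derivative q x - \<Lambda> - (w x)\<^sup>2) (at x)"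
    "\<And>x. x \<in> {0<..<pi} - N \<Longrightarrow> qh x = 2 * \<Lambda> + 2 * (w x)\<^sup>2 - q x"
proof -
  obtain N where N: "negligible N"
    "\<And>x. x \<in> {0<..<pi} - N \<Longrightarrow> (v' has_vector_derivative (of_real (q x) - \<Lambda>) * v x) (at x)"
    using is_solution_AE_deriv[OF v_sol] by blast
  have d: "(w has_real_derivative q x - \<Lambda> - (w x)\<^sup>2) (at x)" if x: "x \<in> {0<..<pi} - N" for x
  proof -
    have 1: "(v' has_real_derivative (q x - \<Lambda>) * v x) (at x)"
      using N(2)[OF x] by (simp add: has_real_derivative_iff_has_vector_derivative)
    have 2: "(v has_real_derivative v' x) (at x)"
      using is_solution_deriv[OF v_sol, of x] x
      by (simp add: at_within_Icc_at has_real_derivative_iff_has_vector_derivative)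
    have nz: "v x \<noteq> 0" using v_nz[of x] x by auto
    show ?thesis
      unfolding w_def[abs_def]
      by (rule DERIV_cong[OF DERIV_divide[OF 1 2 nz]]) (use nz in \<open>simp add: field_simps power2_eq_square\<close>)
  qed
  show thesis
  proof (rule that[OF N(1)])
    fix x assume x: "x \<in> {0<..<pi} - N"
    show "(w has_vector_derivative q x - \<Lambda> - (w x)\<^sup>2) (at x)"
      using d[OF x] by (simp add: has_real_derivative_iff_has_vector_derivative)
    have "deriv (\<lambda>t. v' t / v t) x = q x - \<Lambda> - (w x)\<^sup>2"
      using DERIV_imp_deriv[OF d[OF x]] by (simp add: w_def[abs_def])
    then show "qh x = 2 * \<Lambda> + 2 * (w x)\<^sup>2 - q x" by (simp add: qh_def)
  qed
qed

text \<open>By the Riccati equation \<open>qh\<close> is almost everywhere a continuous function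
  minus \<open>q\<close>, so the integrability of \<open>w'\<close> need not be discussed.\<close>

lemma qh_int: "qh absolutely_integrable_on {0<..<pi}"
proof -
  obtain N where N: "negligible N"
    "\<And>x. x \<in> {0<..<pi} - N \<Longrightarrow> (w has_vector_derivative q x - \<Lambda> - (w x)\<^sup>2) (at x)"
    "\<And>x. x \<in> {0<..<pi} - N \<Longrightarrow> qh x = 2 * \<Lambda> + 2 * (w x)\<^sup>2 - q x"
    using w_AE_deriv by blast
  have "continuous_on {0..pi} (\<lambda>x. 2 * \<Lambda> + 2 * (w x)\<^sup>2)"
    using ac_continuous_on[OF ac_w] by (intro continuous_intros)
  then have "(\<lambda>x. 2 * \<Lambda> + 2 * (w x)\<^sup>2) absolutely_integrable_on {0..pi}"
    by (rule absolutely_integrable_continuous_real)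
  then have "(\<lambda>x. 2 * \<Lambda> + 2 * (w x)\<^sup>2) absolutely_integrable_on {0<..<pi}"
    by (rule absolutely_integrable_on_Icc_iff_Ioo[THEN iffD1])
  then have "(\<lambda>x. 2 * \<Lambda> + 2 * (w x)\<^sup>2 - q x) absolutely_integrable_on {0<..<pi}"
    using q_int by (rule set_integral_diff(1))
  then show ?thesis by (rule absolutely_integrable_spike[OF _ N(1)]) (rule N(3))
qed

sublocale hat: integrable_potential qh by unfold_locales (rule qh_int)

definition tr :: "(real \<Rightarrow> 'a) \<Rightarrow> (real \<Rightarrow> 'a) \<Rightarrow> real \<Rightarrow> 'a::{real_normed_field, banach}" where
  "tr y y' x = y' x - of_real (w x) * y x"

text \<open>The derivative of \<open>tr\<close>, with \<open>y''\<close> and \<open>w'\<close>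
  eliminated by the equation and the Riccati equation.\<close>

definition tr' :: "'a \<Rightarrow> (real \<Rightarrow> 'a) \<Rightarrow> (real \<Rightarrow> 'a) \<Rightarrow> real \<Rightarrow> 'a::{real_normed_field, banach}" where
  "tr' \<zeta> y y' x = (of_real \<Lambda> - \<zeta>) * y x - of_real (w x) * tr y y' x"

lemma tr_solution:
  assumes "is_solution q \<zeta> y y'" shows "is_solution qh \<zeta> (tr y y') (tr' \<zeta> y y')"
proof -
  obtain N where N: "negligible N"
    "\<And>x. x \<in> {0<..<pi} - N \<Longrightarrow> (w has_vector_derivative q x - \<Lambda> - (w x)\<^sup>2) (at x)"
    "\<And>x. x \<in> {0<..<pi} - N \<Longrightarrow> qh x = 2 * \<Lambda> + 2 * (w x)\<^sup>2 - q x"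
    using w_AE_deriv by blast
  show ?thesis
    using darboux_transform[OF ac_w N assms] unfolding tr'_def[abs_def] tr_def[abs_def] .
qed

lemma inverse_tr_solution:
  fixes z z' :: "real \<Rightarrow> 'a :: {real_normed_field, banach}"
  assumes "is_solution qh \<zeta> z z'"
  shows "is_solution q \<zeta> (\<lambda>x. z' x + of_real (w x) * z x)
    (\<lambda>x. (of_real \<Lambda> - \<zeta>) * z x + of_real (w x) * (z' x + of_real (w x) * z x))"
proof -
  obtain N where N: "negligible N"
    "\<And>x. x \<in> {0<..<pi} - N \<Longrightarrow> (w has_vector_derivative q x - \<Lambda> - (w x)\<^sup>2) (at x)"
    "\<And>x. x \<in> {0<..<pi} - N \<Longrightarrow> qh x = 2 * \<Lambda> + 2 * (w x)\<^sup>2 - q x"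
    using w_AE_deriv by blast
  have "is_solution q \<zeta> (\<lambda>x. z' x - of_real (- w x) * z x)
    (\<lambda>x. (of_real \<Lambda> - \<zeta>) * z x - of_real (- w x) * (z' x - of_real (- w x) * z x))"
  proof (rule darboux_transform[OF ac_minus[OF ac_w] N(1) _ _ assms])
    fix x assume x: "x \<in> {0<..<pi} - N"
    show "((\<lambda>x. - w x) has_vector_derivative qh x - \<Lambda> - (- w x)\<^sup>2) (at x)"
    proof -
      have "qh x - \<Lambda> - (- w x)\<^sup>2 = - (q x - \<Lambda> - (w x)\<^sup>2)" using N(3)[OF x] by simp
      then show ?thesis using has_vector_derivative_minus[OF N(2)[OF x]] by (simp only:)
    qed
    show "q x = 2 * \<Lambda> + 2 * (- w x)\<^sup>2 - qh x" using N(3)[OF x] by simp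
  qed
  then show ?thesis by simp
qed

text \<open>If \<open>tr\<close> vanishes identically, so does its derivative \<open>tr'\<close>,
  which then reduces to \<open>(\<Lambda> - \<zeta>) * y\<close>.\<close>

lemma tr_zero:
  fixes y y' :: "real \<Rightarrow> 'a :: {real_normed_field, banach}"
  assumes "is_solution q \<zeta> y y'" "\<zeta> \<noteq> of_real \<Lambda>" "\<And>x. x \<in> {0..pi} \<Longrightarrow> tr y y' x = 0" "x \<in> {0..pi}"
  shows "y x = 0"
proof -
  have "tr' \<zeta> y y' x = 0" by (rule is_solution_zero_deriv[OF tr_solution[OF assms(1)] assms(3,4)])
  then show ?thesis using assms(2) assms(3)[OF assms(4)] by (simp add: tr'_def)
qed

lemma tr_boundary_iff:
  fixes y y' :: "real \<Rightarrow> 'a :: {real_normed_field, banach}"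
  assumes "\<zeta> \<noteq> of_real \<Lambda>"
  shows "cpoly (fdown fh) \<zeta> * tr' \<zeta> y y' 0 + cpoly (fup fh) \<zeta> * tr y y' 0 = 0 \<longleftrightarrow>
      cpoly (fdown f) \<zeta> * y' 0 + cpoly (fup f) \<zeta> * y 0 = 0"
    and "cpoly (fdown Fh) \<zeta> * tr' \<zeta> y y' pi - cpoly (fup Fh) \<zeta> * tr y y' pi = 0 \<longleftrightarrow>
      cpoly (fdown F) \<zeta> * y' pi - cpoly (fup F) \<zeta> * y pi = 0"
  by (rule boundary_transform_left_iff[OF left assms]; simp add: tr_def tr'_def w_def)
    (rule boundary_transform_right_iff[OF right assms]; simp add: tr_def tr'_def w_def)

lemma eigenvalues_hat_iff:
  assumes ne: "\<zeta> \<noteq> complex_of_real \<Lambda>"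
  shows "\<zeta> \<in> eigenvalues qh fh Fh \<longleftrightarrow> \<zeta> \<in> eigenvalues q f F"
proof
  assume "\<zeta> \<in> eigenvalues q f F"
  then obtain y y' x where y: "is_solution q \<zeta> y y'" "x \<in> {0..pi}" "y x \<noteq> 0"
    "cpoly (fdown f) \<zeta> * y' 0 + cpoly (fup f) \<zeta> * y 0 = 0"
    "cpoly (fdown F) \<zeta> * y' pi - cpoly (fup F) \<zeta> * y pi = 0"
    unfolding eigenvalues_def mem_Collect_eq by blast
  have nz: "\<exists>x\<in>{0..pi}. tr y y' x \<noteq> 0" using tr_zero[OF y(1) ne _ y(2)] y(3) by blast
  show "\<zeta> \<in> eigenvalues qh fh Fh"
    unfolding eigenvalues_def mem_Collect_eq
    by (intro exI conjI, rule tr_solution[OF y(1)], rule nz, rule iffD2[OF tr_boundary_iff(1)[OF ne, where y = y and y' = y'] y(4)],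
      rule iffD2[OF tr_boundary_iff(2)[OF ne, where y = y and y' = y'] y(5)])
next
  assume "\<zeta> \<in> eigenvalues qh fh Fh"
  then obtain z z' x where z: "is_solution qh \<zeta> z z'" "x \<in> {0..pi}" "z x \<noteq> 0"
    "cpoly (fdown fh) \<zeta> * z' 0 + cpoly (fup fh) \<zeta> * z 0 = 0"
    "cpoly (fdown Fh) \<zeta> * z' pi - cpoly (fup Fh) \<zeta> * z pi = 0"
    unfolding eigenvalues_def mem_Collect_eq by blast
  \<comment> \<open>The inverse transformation up to normalization: applying \<open>tr\<close> again
    multiplies \<open>z\<close> and \<open>z'\<close> by \<open>\<Lambda> - \<zeta>\<close>, a
    factor that the homogeneous boundary conditions tolerate.\<close>
  define y where "y = (\<lambda>x. z' x + of_real (w x) * z x)"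
  define y' where "y' = (\<lambda>x. (of_real \<Lambda> - \<zeta>) * z x + of_real (w x) * y x)"
  have y: "is_solution q \<zeta> y y'" unfolding y'_def y_def by (rule inverse_tr_solution[OF z(1)])
  have t: "tr y y' x = (of_real \<Lambda> - \<zeta>) * z x" "tr' \<zeta> y y' x = (of_real \<Lambda> - \<zeta>) * z' x" for x
    by (simp_all add: tr'_def tr_def y'_def) (simp add: y_def algebra_simps)
  have nz: "\<exists>x\<in>{0..pi}. y x \<noteq> 0"
  proof (rule ccontr)
    assume "\<not> (\<exists>x\<in>{0..pi}. y x \<noteq> 0)"
    then have y0: "\<And>x. x \<in> {0..pi} \<Longrightarrow> y x = 0" by blast
    then have "y' x = 0" using is_solution_zero_deriv[OF y _ z(2)] by blast
    then have "tr y y' x = 0" using y0[OF z(2)] by (simp add: tr_def)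
    then show False using t(1)[of x] ne z(3) by simp
  qed
  have l: "cpoly (fdown f) \<zeta> * y' 0 + cpoly (fup f) \<zeta> * y 0 = 0"
  proof (subst tr_boundary_iff(1)[OF ne, symmetric])
    have "(of_real \<Lambda> - \<zeta>) * (cpoly (fdown fh) \<zeta> * z' 0 + cpoly (fup fh) \<zeta> * z 0) = 0" using z(4) by simp
    then show "cpoly (fdown fh) \<zeta> * tr' \<zeta> y y' 0 + cpoly (fup fh) \<zeta> * tr y y' 0 = 0"
      unfolding t by (simp add: algebra_simps)
  qed
  have r: "cpoly (fdown F) \<zeta> * y' pi - cpoly (fup F) \<zeta> * y pi = 0"
  proof (subst tr_boundary_iff(2)[OF ne, symmetric])
    have "(of_real \<Lambda> - \<zeta>) * (cpoly (fdown Fh) \<zeta> * z' pi - cpoly (fup Fh) \<zeta> * z pi) = 0" using z(5) by simp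
    then show "cpoly (fdown Fh) \<zeta> * tr' \<zeta> y y' pi - cpoly (fup Fh) \<zeta> * tr y y' pi = 0"
      unfolding t by (simp add: algebra_simps)
  qed
  show "\<zeta> \<in> eigenvalues q f F"
    unfolding eigenvalues_def mem_Collect_eq by (intro exI conjI, rule y, rule nz, rule l, rule r)
qed

text \<open>
  A solution \<open>z\<close> of the transformed equation at \<open>\<Lambda>\<close> satisfies \<open>z' + w z = c v\<close>, so that
  \<open>(c z v)' = (c v)\<^sup>2\<close>, whereas the boundary conditions force \<open>c z v\<close> to be nonnegative at \<open>0\<close>
  and nonpositive at \<open>\<pi>\<close>.
\<close>

lemma Lambda_not_eigenvalue_hat: "complex_of_real \<Lambda> \<notin> eigenvalues qh fh Fh"
proof
  assume "complex_of_real \<Lambda> \<in> eigenvalues qh fh Fh"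
  then obtain z z' :: "real \<Rightarrow> real" and x where z: "is_solution qh \<Lambda> z z'" "x \<in> {0..pi}" "z x \<noteq> 0"
    "poly (fdown fh) \<Lambda> * z' 0 + poly (fup fh) \<Lambda> * z 0 = 0"
    "poly (fdown Fh) \<Lambda> * z' pi - poly (fup Fh) \<Lambda> * z pi = 0"
    using real_eigenfunction by blast
  define u where "u = (\<lambda>x. z' x + w x * z x)"
  define c where "c = u 0 / v 0"
  have v0: "v 0 \<noteq> 0" by (rule v_nz) simp
  have usol: "is_solution q \<Lambda> u (\<lambda>x. w x * u x)"
    using inverse_tr_solution[OF z(1)] by (simp add: u_def)
  have ucv: "u x = c * v x" if "x \<in> {0..pi}" for x
    using solution_unique[OF usol is_solution_cmult[OF v_sol, of c], where t = 0 and x = x] that v0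
    by (simp add: c_def w_def)
  have L: "if f = Infty then u 0 = 0 else \<exists>a\<ge>0. z 0 = a * u 0"
  proof -
    have "z' 0 - (- v' 0 / v 0) * z 0 = u 0" by (simp add: u_def w_def)
    then show ?thesis using boundary_transform_at[OF left z(4)] by (simp only:)
  qed
  have R: "if F = Infty then u pi = 0 else \<exists>a\<ge>0. z pi = - a * u pi"
  proof -
    have bc: "poly (fdown Fh) \<Lambda> * z' pi + poly (fup Fh) \<Lambda> * (- z pi) = 0" using z(5) by simp
    have e: "z' pi - v' pi / v pi * (- z pi) = u pi" by (simp add: u_def w_def)
    have *: "if F = Infty then u pi = 0 else \<exists>a\<ge>0. - z pi = a * u pi"
      using boundary_transform_at[OF right bc] unfolding e .
    have "z pi = - a * u pi" if "- z pi = a * u pi" for a using that by simp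
    then show ?thesis using * by (auto split: if_splits)
  qed
  have dzv: "((\<lambda>x. z x * v x) has_real_derivative c * (v x)\<^sup>2) (at x within {0..pi})" if x: "x \<in> {0..pi}" for x
  proof -
    have "(z has_real_derivative z' x) (at x within {0..pi})" "(v has_real_derivative v' x) (at x within {0..pi})"
      using is_solution_deriv[OF z(1) x] is_solution_deriv[OF v_sol x]
      by (simp_all add: has_real_derivative_iff_has_vector_derivative)
    from DERIV_mult[OF this]
    have "((\<lambda>x. z x * v x) has_real_derivative z' x * v x + v' x * z x) (at x within {0..pi})" .
    moreover have "z' x * v x + v' x * z x = c * (v x)\<^sup>2"
    proof -
      have "v' x = w x * v x" using v_nz[OF x] by (simp add: w_def)
      then have "z' x * v x + v' x * z x = u x * v x" by (simp add: u_def algebra_simps)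
      then show ?thesis using ucv[OF x] by (simp add: power2_eq_square)
    qed
    ultimately show ?thesis by (simp only:)
  qed
  have c0: "c = 0"
  proof (rule ccontr)
    assume c: "c \<noteq> 0"
    define k where "k = (\<lambda>x. c * (z x * v x))"
    have dk: "(k has_real_derivative c * (c * (v x)\<^sup>2)) (at x within {0..pi})" if "x \<in> {0..pi}" for x
      unfolding k_def by (rule DERIV_cmult[OF dzv[OF that]])
    have "k 0 < k pi"
    proof (rule DERIV_pos_imp_increasing_open[of 0 pi k])
      fix x assume x: "0 < x" "x < pi"
      have "c * (c * (v x)\<^sup>2) = (c * v x)\<^sup>2" by (simp add: power2_eq_square)
      moreover have "c * v x \<noteq> 0" using c v_nz[of x] x by simp
      ultimately have "c * (c * (v x)\<^sup>2) > 0" by simp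
      then show "\<exists>D. (k has_real_derivative D) (at x) \<and> 0 < D"
        using dk[of x] x by (auto simp: at_within_Icc_at)
    next
      show "continuous_on {0..pi} k" by (rule DERIV_continuous_on[OF dk])
    qed simp
    moreover have "k 0 \<ge> 0"
    proof -
      have "u 0 \<noteq> 0" using ucv[of 0] c v0 by simp
      then obtain a where a: "a \<ge> 0" "z 0 = a * u 0" using L by (auto split: if_splits)
      have "k 0 = a * (c * v 0)\<^sup>2" using a(2) ucv[of 0] by (simp add: k_def power2_eq_square)
      then show ?thesis using a(1) by simp
    qed
    moreover have "k pi \<le> 0"
    proof -
      have "u pi \<noteq> 0" using ucv[of pi] c v_nz[of pi] by simp
      then obtain a where a: "a \<ge> 0" "z pi = - a * u pi" using R by (auto split: if_splits)
      have "k pi = - (a * (c * v pi)\<^sup>2)" using a(2) ucv[of pi] by (simp add: k_def power2_eq_square)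
      then show ?thesis using a(1) by simp
    qed
    ultimately show False by simp
  qed
  have u0: "u x = 0" if "x \<in> {0..pi}" for x using ucv[OF that] c0 by simp
  obtain d where d: "\<And>x. x \<in> {0..pi} \<Longrightarrow> z x * v x = d"
  proof -
    have "\<exists>d. \<forall>x\<in>{0..pi}. z x * v x = d"
      by (rule has_field_derivative_zero_constant) (use dzv c0 in auto)
    then show thesis using that by blast
  qed
  \<comment> \<open>For \<open>c = 0\<close> the product \<open>z v\<close> is constant and
    \<open>u\<close> vanishes. At an end with a finite boundary function \<open>L\<close> or
    \<open>R\<close> then gives \<open>z = 0\<close>, and there is at least one such end.\<close>
  have "z 0 = 0 \<or> z pi = 0" using L R u0[of 0] u0[of pi] not_both by (auto split: if_splits)
  then have "d = 0" using d[of 0] d[of pi] by auto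
  then show False using d[OF z(2)] z(3) v_nz[OF z(2)] by simp
qed

lemma integral_tr_squared:
  fixes y y' :: "real \<Rightarrow> real"
  assumes y: "is_solution q l y y'"
  shows "integral {0..pi} (\<lambda>x. (tr y y' x)\<^sup>2)
    = (l - \<Lambda>) * integral {0..pi} (\<lambda>x. (y x)\<^sup>2) + y pi * tr y y' pi - y 0 * tr y y' 0"
proof -
  note z = tr_solution[OF y]
  have cy: "continuous_on {0..pi} y" and cz: "continuous_on {0..pi} (tr y y')"
    using is_solution_continuous(1)[OF y] is_solution_continuous(1)[OF z] .
  have I: "(\<lambda>x. (y x)\<^sup>2) integrable_on {0..pi}" "(\<lambda>x. (tr y y' x)\<^sup>2) integrable_on {0..pi}"
    by (intro integrable_continuous_real continuous_intros cy cz)+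
  have "((\<lambda>x. (tr y y' x)\<^sup>2 - (l - \<Lambda>) * (y x)\<^sup>2) has_integral (y pi * tr y y' pi - y 0 * tr y y' 0)) {0..pi}"
  proof (rule fundamental_theorem_of_calculus)
    fix x assume x: "x \<in> {0..pi}"
    have "((\<lambda>x. y x * tr y y' x) has_vector_derivative (y x * tr' l y y' x + y' x * tr y y' x)) (at x within {0..pi})"
      by (intro has_vector_derivative_mult is_solution_deriv[OF y x] is_solution_deriv[OF z x])
    moreover have "y x * tr' l y y' x + y' x * tr y y' x = (tr y y' x)\<^sup>2 - (l - \<Lambda>) * (y x)\<^sup>2"
      by (simp add: tr'_def tr_def algebra_simps power2_eq_square)
    ultimately show "((\<lambda>x. y x * tr y y' x) has_vector_derivative (tr y y' x)\<^sup>2 - (l - \<Lambda>) * (y x)\<^sup>2) (at x within {0..pi})"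
      by (simp only:)
  qed simp
  then have "integral {0..pi} (\<lambda>x. (tr y y' x)\<^sup>2 - (l - \<Lambda>) * (y x)\<^sup>2) = y pi * tr y y' pi - y 0 * tr y y' 0"
    by (rule integral_unique)
  moreover have "integral {0..pi} (\<lambda>x. (tr y y' x)\<^sup>2 - (l - \<Lambda>) * (y x)\<^sup>2)
    = integral {0..pi} (\<lambda>x. (tr y y' x)\<^sup>2) - (l - \<Lambda>) * integral {0..pi} (\<lambda>x. (y x)\<^sup>2)"
    using I by (subst Henstock_Kurzweil_Integration.integral_diff) (auto intro: integrable_on_mult_right)
  ultimately show ?thesis by simp
qed

lemma boundary_finite_at:
  assumes "boundary_transform \<Lambda> t g gh" "g \<noteq> Infty"
  shows "poly (fup g) l = t * poly (fdown g) l + (l - \<Lambda>) * poly (fdown gh) l"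
    and "poly (fup gh) l = - poly (fdown g) l - t * poly (fdown gh) l"
  using boundary_transform_finite[OF assms, of l] by simp_all

text \<open>The transforms of \<open>phi\<close> and \<open>psi\<close> are multiples of the new
  \<open>phi\<close> and \<open>psi\<close>, with factors fixed by the initial data. The boundary
  terms in the integral of the squared transform are precisely the amounts by which the two
  polynomial terms change.\<close>

lemma norming_const_hat:
  assumes l: "complex_of_real l \<in> eigenvalues q f F" "l \<noteq> \<Lambda>"
  shows "norming_const qh fh Fh l = (if f = Infty then l - \<Lambda> else 1 / (l - \<Lambda>)) * norming_const q f F l"
proof -
  let ?p = "phi q f l" and ?p' = "phi_deriv q f l" and ?s = "psi q F l" and ?s' = "psi_deriv q F l"
  define b where "b = beta q f F l"
  have b0: "b \<noteq> 0" and bp: "\<And>x. x \<in> {0..pi} \<Longrightarrow> ?s x = b * ?p x" "\<And>x. x \<in> {0..pi} \<Longrightarrow> ?s' x = b * ?p' x"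
    using psi_eq_beta_phi[OF f_R F_R l(1)] by (simp_all add: b_def)
  define m where "m = l - \<Lambda>"
  have m0: "m \<noteq> 0" using l(2) by (simp add: m_def)
  \<comment> \<open>For finite boundary functions the transform of \<open>phi\<close> at 0 is
    \<open>- m\<close> times the value of \<open>fdown fh\<close>, and that of \<open>psi\<close> at
    \<open>pi\<close> is \<open>m\<close> times the value of \<open>fdown Fh\<close>. At Dirichlet
    ends these transforms take the values 1 and -1, whereas the new initial value is 1.\<close>
  define s where "s = (if f = Infty then 1 else - (1 / m))"
  define r where "r = (if F = Infty then -1 else 1 / m)"
  have sr0: "s \<noteq> 0" "r \<noteq> 0" using m0 by (auto simp: s_def r_def)
  let ?z = "tr ?p ?p'"
  have psol: "is_solution q l ?p ?p'" and ssol: "is_solution q l ?s ?s'"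
    by (rule phi_solution, rule psi_solution)
  have w0: "w 0 = - (- v' 0 / v 0)" and wpi: "w pi = v' pi / v pi" by (simp_all add: w_def)
  have phat: "phi qh fh l x = s * ?z x" if x: "x \<in> {0..pi}" for x
  proof -
    define t where "t = - v' 0 / v 0"
    have w0t: "w 0 = - t" by (simp add: w0 t_def)
    have "poly (fdown fh) l = s * tr ?p ?p' 0 \<and> - poly (fup fh) l = s * tr' l ?p ?p' 0"
    proof (cases "f = Infty")
      case True
      then have "fdown fh = 1" "fup fh = [:- t:]" using left by (auto simp: boundary_transform_def t_def)
      then show ?thesis using True by (simp add: tr_def tr'_def phi_solution s_def w0t)
    next
      case False
      note bf = boundary_finite_at[OF left False, of l, folded t_def m_def]
      have z0: "tr ?p ?p' 0 = - m * poly (fdown fh) l"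
        by (simp add: tr_def phi_solution w0t bf(1) algebra_simps)
      moreover have "tr' l ?p ?p' 0 = m * poly (fup fh) l"
        unfolding tr'_def z0 by (simp add: phi_solution w0t bf(2) m_def algebra_simps)
      ultimately show ?thesis using False m0 by (simp add: s_def)
    qed
    then have "phi qh fh l x = s * tr ?p ?p' x \<and> phi_deriv qh fh l x = s * tr' l ?p ?p' x"
      using x by (intro hat.solution_unique[OF hat.phi_solution(1) is_solution_cmult[OF tr_solution[OF psol]], where t = 0])
        (simp_all add: hat.phi_solution)
    then show ?thesis by simp
  qed
  have zs: "tr ?s ?s' x = b * ?z x" if "x \<in> {0..pi}" for x
    using bp[OF that] by (simp add: tr_def algebra_simps)
  define t where "t = v' pi / v pi"
  have wt: "w pi = t" by (simp add: wpi t_def)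
  have zpi: "tr ?s ?s' pi = m * poly (fdown Fh) l" if "F \<noteq> Infty"
    by (simp add: tr_def psi_solution wt boundary_finite_at[OF right that, of l, folded t_def m_def] algebra_simps)
  have shat: "psi qh Fh l x = r * tr ?s ?s' x" if x: "x \<in> {0..pi}" for x
  proof -
    have "poly (fdown Fh) l = r * tr ?s ?s' pi \<and> poly (fup Fh) l = r * tr' l ?s ?s' pi"
    proof (cases "F = Infty")
      case True
      then have "fdown Fh = 1" "fup Fh = [:- t:]" using right by (auto simp: boundary_transform_def t_def)
      then show ?thesis using True by (simp add: tr_def tr'_def psi_solution r_def wt)
    next
      case False
      have "tr' l ?s ?s' pi = m * poly (fup Fh) l"
        unfolding tr'_def zpi[OF False]
        by (simp add: psi_solution wt boundary_finite_at[OF right False, of l, folded t_def m_def] m_def algebra_simps)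
      then show ?thesis using zpi[OF False] False m0 by (simp add: r_def)
    qed
    then have "psi qh Fh l x = r * tr ?s ?s' x \<and> psi_deriv qh Fh l x = r * tr' l ?s ?s' x"
      using x by (intro hat.solution_unique[OF hat.psi_solution(1) is_solution_cmult[OF tr_solution[OF ssol]], where t = pi])
        (simp_all add: hat.psi_solution)
    then show ?thesis by simp
  qed
  have bhat: "beta qh fh Fh l = r * b / s"
  proof (rule hat.beta_eqI[OF fh_R])
    show "r * b / s \<noteq> 0" using sr0 b0 by simp
    show "psi qh Fh l x = r * b / s * phi qh fh l x" if "x \<in> {0..pi}" for x
      using sr0 by (simp add: shat[OF that] zs[OF that] phat[OF that])
  qed
  have int: "integral {0..pi} (\<lambda>x. (phi qh fh l x)\<^sup>2)
    = s\<^sup>2 * (m * integral {0..pi} (\<lambda>x. (?p x)\<^sup>2) + ?p pi * ?z pi - ?p 0 * ?z 0)"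
  proof -
    have "integral {0..pi} (\<lambda>x. (phi qh fh l x)\<^sup>2) = integral {0..pi} (\<lambda>x. s\<^sup>2 * (?z x)\<^sup>2)"
      by (intro Henstock_Kurzweil_Integration.integral_cong) (simp add: phat power_mult_distrib)
    then show ?thesis using integral_tr_squared[OF psol] by (simp add: m_def)
  qed
  \<comment> \<open>This identity and its counterpart at \<open>pi\<close> each absorb one boundary
    term of \<open>int\<close>, so that all three summands of the norming constant acquire the same
    factor \<open>s\<^sup>2 * m\<close>.\<close>
  have left_id: "poly (deriv_down_sq fh) l - s\<^sup>2 * (?p 0 * ?z 0) = s\<^sup>2 * m * poly (deriv_down_sq f) l"
  proof (cases "f = Infty")
    case True
    then show ?thesis
      using boundary_transform_deriv_down_sq(1)[OF left, of l] boundary_transform_deriv_down_sq(2)[OF left True]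
      by (simp add: phi_solution)
  next
    case False
    have z0: "?z 0 = - m * poly (fdown fh) l"
      using phat[of 0] False m0 by (simp add: hat.phi_solution s_def field_simps)
    have dd: "poly (deriv_down_sq f) l = poly (fdown f) l * poly (fdown fh) l + m * poly (deriv_down_sq fh) l"
      using boundary_transform_deriv_down_sq(1)[OF left, of l] False by (simp add: m_def)
    have s2: "s\<^sup>2 = 1 / m\<^sup>2" using False by (simp add: s_def power_divide)
    have "D - 1 / m\<^sup>2 * (A * (- m * B)) = 1 / m\<^sup>2 * m * (A * B + m * D)" for A B D
      using m0 by (simp add: power2_eq_square field_simps)
    then show ?thesis unfolding dd z0 phi_solution s2 .
  qed
  have right_id: "1 / (beta qh fh Fh l)\<^sup>2 * poly (deriv_down_sq Fh) l + s\<^sup>2 * (?p pi * ?z pi)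
      = s\<^sup>2 * m * (1 / b\<^sup>2 * poly (deriv_down_sq F) l)"
  proof (cases "F = Infty")
    case True
    have "?p pi = 0" using bp(1)[of pi] b0 True by (simp add: psi_solution)
    then show ?thesis
      using True boundary_transform_deriv_down_sq(1)[OF right, of l] boundary_transform_deriv_down_sq(2)[OF right True]
      by simp
  next
    case False
    have p: "?p pi = poly (fdown F) l / b" using bp(1)[of pi] b0 by (simp add: psi_solution field_simps)
    have z: "?z pi = m * poly (fdown Fh) l / b" using zs[of pi] zpi[OF False] b0 by (simp add: field_simps)
    have dd: "poly (deriv_down_sq F) l = poly (fdown F) l * poly (fdown Fh) l + m * poly (deriv_down_sq Fh) l"
      using boundary_transform_deriv_down_sq(1)[OF right, of l] False by (simp add: m_def)
    have bb: "1 / (beta qh fh Fh l)\<^sup>2 = s\<^sup>2 * m\<^sup>2 / b\<^sup>2"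
      using False m0 b0 by (simp add: bhat r_def power_divide power_mult_distrib)
    have "s\<^sup>2 * m\<^sup>2 / b\<^sup>2 * D + s\<^sup>2 * (A / b * (m * B / b)) = s\<^sup>2 * m * (1 / b\<^sup>2 * (A * B + m * D))" for A B D
      using b0 by (simp add: power2_eq_square field_simps)
    then show ?thesis unfolding bb dd p z .
  qed
  have "norming_const qh fh Fh l = s\<^sup>2 * m * norming_const q f F l"
  proof -
    have "s\<^sup>2 * (m * i + pz - p0) + fh + FH = s\<^sup>2 * m * (i + f + FF)"
      if "fh - s\<^sup>2 * p0 = s\<^sup>2 * m * f" "FH + s\<^sup>2 * pz = s\<^sup>2 * m * FF" for i pz p0 fh FH f FF
      using that by (simp add: algebra_simps)
    from this[OF left_id right_id] show ?thesis unfolding norming_const_def int b_def[symmetric] .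
  qed
  \<comment> \<open>This factor is \<open>l - \<Lambda>\<close> to the power \<open>- I\<close> of
    the final claim.\<close>
  moreover have "s\<^sup>2 * m = (if f = Infty then l - \<Lambda> else 1 / (l - \<Lambda>))"
    using m0 by (simp add: s_def m_def[symmetric] power2_eq_square)
  ultimately show ?thesis by simp
qed

end

text \<open>Off \<Lambda> the two spectra agree, and \<Lambda> does not belong to the new one. It
  belongs to the old one exactly if both boundary functions are finite, and then it is the lowest
  eigenvalue; hence the shift \<open>j\<close>.\<close>

lemma T_hat_spectral:
  fixes lam gam :: "nat \<Rightarrow> real" and v v' :: "real \<Rightarrow> real"
  assumes D: "darboux q v v' \<Lambda> f F fh Fh" and sd: "spectral_data q f F lam gam"
    and \<Lambda>: "\<Lambda> = (if f \<noteq> Infty \<and> F \<noteq> Infty then lam 0 else lam 0 - 2)"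
    and j: "j = (if f \<noteq> Infty \<and> F \<noteq> Infty then 1 else 0)"
  shows "spectral_data (\<lambda>x. q x - 2 * deriv (\<lambda>t. v' t / v t) x) fh Fh (\<lambda>n. lam (n + j))
      (\<lambda>n. gam (n + j) / (lam (n + j) - \<Lambda>) powi (if f = Infty then -1 else 1))"
proof -
  interpret darboux q v v' \<Lambda> f F fh Fh by (rule D)
  have qh: "(\<lambda>x. q x - 2 * deriv (\<lambda>t. v' t / v t) x) = qh" by (simp add: qh_def fun_eq_iff)
  have mono: "strict_mono lam" and eig: "range (\<lambda>n. complex_of_real (lam n)) = eigenvalues q f F"
    and gam: "\<And>n. gam n = norming_const q f F (lam n)"
    using sd by (auto simp: spectral_data_def)
  have gt: "lam (n + j) > \<Lambda>" for n
    using strict_mono_leD[OF mono, of 0 n] strict_monoD[OF mono, of 0 "Suc n"] by (auto simp: \<Lambda> j)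
  have iff: "lam n \<noteq> \<Lambda> \<longleftrightarrow> (\<exists>k. n = k + j)" for n
  proof
    assume "lam n \<noteq> \<Lambda>"
    then show "\<exists>k. n = k + j" by (cases n) (auto simp: \<Lambda> j split: if_splits)
  next
    assume "\<exists>k. n = k + j"
    then show "lam n \<noteq> \<Lambda>" using gt by force
  qed
  have "range (\<lambda>n. complex_of_real (lam (n + j))) = eigenvalues qh fh Fh"
  proof (intro set_eqI iffI)
    fix \<zeta> assume "\<zeta> \<in> range (\<lambda>n. complex_of_real (lam (n + j)))"
    then obtain n where n: "\<zeta> = complex_of_real (lam (n + j))" by blast
    then have "\<zeta> \<noteq> complex_of_real \<Lambda>" using gt[of n] by simp
    moreover have "\<zeta> \<in> eigenvalues q f F" using n eig by blast
    ultimately show "\<zeta> \<in> eigenvalues qh fh Fh" using eigenvalues_hat_iff by blast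
  next
    fix \<zeta> assume \<zeta>: "\<zeta> \<in> eigenvalues qh fh Fh"
    then have ne: "\<zeta> \<noteq> complex_of_real \<Lambda>" using Lambda_not_eigenvalue_hat by blast
    then have "\<zeta> \<in> eigenvalues q f F" using \<zeta> eigenvalues_hat_iff by blast
    then obtain n where n: "\<zeta> = complex_of_real (lam n)" using eig by blast
    then have "lam n \<noteq> \<Lambda>" using ne by auto
    then obtain k where "n = k + j" using iff by blast
    then show "\<zeta> \<in> range (\<lambda>n. complex_of_real (lam (n + j)))" using n by blast
  qed
  moreover have "strict_mono (\<lambda>n. lam (n + j))"
    using mono by (simp add: strict_mono_def)
  moreover have "gam (n + j) / (lam (n + j) - \<Lambda>) powi (if f = Infty then -1 else 1) = norming_const qh fh Fh (lam (n + j))" for n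
  proof -
    have "complex_of_real (lam (n + j)) \<in> eigenvalues q f F" using eig by blast
    moreover have "lam (n + j) \<noteq> \<Lambda>" using gt[of n] by simp
    ultimately show ?thesis
      using norming_const_hat[of "lam (n + j)"] by (simp add: gam power_int_minus field_simps)
  qed
  ultimately show ?thesis unfolding spectral_data_def qh by simp
qed

text \<open>With a Dirichlet condition at 0 the solution \<open>phi\<close> vanishes there and
  cannot be used. The reflected problem has its finite boundary function at the left end, and
  \<open>psi\<close> takes over the role of \<open>phi\<close>.\<close>

lemma (in integrable_potential) ground_state:
  fixes lam gam :: "nat \<Rightarrow> real"
  assumes f: "f \<in> class_R" and F: "F \<in> class_R" and nb: "f \<noteq> Infty \<or> F \<noteq> Infty"
    and sd: "spectral_data q f F lam gam"
    and \<Lambda>: "\<Lambda> = (if f \<noteq> Infty \<and> F \<noteq> Infty then lam 0 else lam 0 - 2)"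
    and v: "v = (if f = Infty then psi q F \<Lambda> else phi q f \<Lambda>)"
    and v': "v' = (if f = Infty then psi_deriv q F \<Lambda> else phi_deriv q f \<Lambda>)"
  shows "is_solution q \<Lambda> v v'" "\<And>x. x \<in> {0..pi} \<Longrightarrow> v x > 0"
    "f \<noteq> Infty \<Longrightarrow> (\<forall>k\<in>poles f. \<Lambda> < k) \<and> - v' 0 / v 0 = poly (fup f) \<Lambda> / poly (fdown f) \<Lambda>"
    "F \<noteq> Infty \<Longrightarrow> (\<forall>k\<in>poles F. \<Lambda> < k) \<and> v' pi / v pi = poly (fup F) \<Lambda> / poly (fdown F) \<Lambda>"
proof -
  have mono: "strict_mono lam" and eig: "range (\<lambda>n. complex_of_real (lam n)) = eigenvalues q f F"
    using sd by (auto simp: spectral_data_def)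
  have below: "complex_of_real l \<notin> eigenvalues q f F" if "l < lam 0" for l
  proof
    assume "complex_of_real l \<in> eigenvalues q f F"
    then have "complex_of_real l \<in> range (\<lambda>n. complex_of_real (lam n))" using eig by simp
    then obtain n where "complex_of_real l = complex_of_real (lam n)" by blast
    then have "l = lam n" by (simp only: of_real_eq_iff)
    then show False using that strict_mono_leD[OF mono, of 0 n] by simp
  qed
  show "is_solution q \<Lambda> v v'" using phi_solution psi_solution by (auto simp: v v')
  have *: "(\<forall>x\<in>{0..pi}. v x > 0) \<and> (f \<noteq> Infty \<longrightarrow> (\<forall>k\<in>poles f. \<Lambda> < k)) \<and> (F \<noteq> Infty \<longrightarrow> (\<forall>k\<in>poles F. \<Lambda> < k))"
  proof (cases "f = Infty")
    case False
    have "(\<forall>k\<in>poles f. \<Lambda> < k) \<and> (F \<noteq> Infty \<longrightarrow> (\<forall>k\<in>poles F. \<Lambda> < k)) \<and> (\<forall>x\<in>{0..pi}. phi q f \<Lambda> x > 0)"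
    proof (rule ground_state_positive[OF f False F phi_solution, where ?l0.0 = "lam 0"])
      show "poly (fdown F) l * phi_deriv q f l pi - poly (fup F) l * phi q f l pi \<noteq> 0" if "l < lam 0" for l
        using below[OF that] eigenvalue_iff[OF f] by simp
      show "if F = Infty then \<Lambda> < lam 0 else \<Lambda> \<le> lam 0" using \<Lambda> by simp
    qed
    then show ?thesis using False by (simp add: v)
  next
    case True
    then have FI: "F \<noteq> Infty" using nb by simp
    interpret r: integrable_potential "\<lambda>x. q (pi - x)" by (rule reflected)
    have "(\<forall>k\<in>poles F. \<Lambda> < k) \<and> (Infty \<noteq> Infty \<longrightarrow> (\<forall>k\<in>poles Infty. \<Lambda> < k)) \<and> (\<forall>x\<in>{0..pi}. psi q F \<Lambda> (pi - x) > 0)"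
    proof (rule r.ground_state_positive[OF F FI f, unfolded True,
          where y = "\<lambda>l x. psi q F l (pi - x)" and y' = "\<lambda>l x. - psi_deriv q F l (pi - x)" and ?l0.0 = "lam 0"])
      show "is_solution (\<lambda>x. q (pi - x)) l (\<lambda>x. psi q F l (pi - x)) (\<lambda>x. - psi_deriv q F l (pi - x))" for l
        by (rule is_solution_reflect[OF psi_solution(1)])
      show "psi q F l (pi - 0) = poly (fdown F) l" "- psi_deriv q F l (pi - 0) = - poly (fup F) l" for l
        by (simp_all add: psi_solution)
      \<comment> \<open>For this Dirichlet end the expression is the value of \<open>psi\<close> at
        0; a zero would make \<open>psi\<close> an eigenfunction below \<open>lam 0\<close>.\<close>
      show "poly (fdown Infty) l * - psi_deriv q F l (pi - pi) - poly (fup Infty) l * psi q F l (pi - pi) \<noteq> 0"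
        if "l < lam 0" for l
      proof
        assume "poly (fdown Infty) l * - psi_deriv q F l (pi - pi) - poly (fup Infty) l * psi q F l (pi - pi) = 0"
        then have p0: "psi q F l 0 = 0" by simp
        have "\<exists>x\<in>{0..pi}. psi q F l x \<noteq> 0"
        proof (rule ccontr)
          assume "\<not> (\<exists>x\<in>{0..pi}. psi q F l x \<noteq> 0)"
          then have z: "\<And>x. x \<in> {0..pi} \<Longrightarrow> psi q F l x = 0" by blast
          have "psi_deriv q F l pi = 0"
            by (rule is_solution_zero_deriv[OF psi_solution(1) z]) auto
          moreover have "psi q F l pi = 0" by (rule z) auto
          ultimately show False using fup_fdown_no_common_root[OF F, of l] by (simp add: psi_solution)
        qed
        then obtain x where "x \<in> {0..pi}" "psi q F l x \<noteq> 0" by blast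
        moreover have "poly (fdown f) l * psi_deriv q F l 0 + poly (fup f) l * psi q F l 0 = 0"
          unfolding p0 True by simp
        moreover have "poly (fdown F) l * psi_deriv q F l pi - poly (fup F) l * psi q F l pi = 0"
          by (simp add: psi_solution)
        ultimately have "complex_of_real l \<in> eigenvalues q f F"
          by (rule of_real_eigenvalue[OF psi_solution(1)])
        then show False using below[OF that] by simp
      qed
      show "if Infty = Infty then \<Lambda> < lam 0 else \<Lambda> \<le> lam 0" using \<Lambda> True by simp
    qed
    then have p: "\<forall>k\<in>poles F. \<Lambda> < k" "\<forall>x\<in>{0..pi}. psi q F \<Lambda> (pi - x) > 0" by auto
    have "psi q F \<Lambda> x > 0" if "x \<in> {0..pi}" for x
      using bspec[OF p(2), of "pi - x"] that by simp
    then show ?thesis using True p(1) by (simp add: v)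
  qed
  show vpos: "v x > 0" if "x \<in> {0..pi}" for x using * that by blast
  show "(\<forall>k\<in>poles f. \<Lambda> < k) \<and> - v' 0 / v 0 = poly (fup f) \<Lambda> / poly (fdown f) \<Lambda>" if "f \<noteq> Infty"
    using * that by (simp add: v v' phi_solution)
  show "(\<forall>k\<in>poles F. \<Lambda> < k) \<and> v' pi / v pi = poly (fup F) \<Lambda> / poly (fdown F) \<Lambda>" if FI: "F \<noteq> Infty"
  proof (intro conjI)
    show poles: "\<forall>k\<in>poles F. \<Lambda> < k" using * FI by blast
    show "v' pi / v pi = poly (fup F) \<Lambda> / poly (fdown F) \<Lambda>"
    proof (cases "f = Infty")
      case True
      then show ?thesis by (simp add: v v' psi_solution)
    next
      \<comment> \<open>Both boundary functions are finite, so \<Lambda> is the eigenvalue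
        \<open>lam 0\<close>, and the right condition on \<open>phi\<close> identifies
        \<open>v' / v\<close> at \<open>pi\<close> with the value of \<open>F\<close> at
        \<Lambda>.\<close>
      case False
      then have "complex_of_real \<Lambda> \<in> eigenvalues q f F" using eig FI \<Lambda> by auto
      then have bc: "poly (fdown F) \<Lambda> * v' pi = poly (fup F) \<Lambda> * v pi"
        using eigenvalue_iff[OF f, of \<Lambda> F] False by (simp add: v v')
      moreover have "poly (fdown F) \<Lambda> > 0" by (rule fdown_pos[OF F FI poles])
      ultimately show ?thesis using vpos[of pi] by (simp add: field_simps)
    qed
  qed
qed

theorem theorem3p3:
  fixes q qh :: "real \<Rightarrow> real" and f F fh Fh :: boundary_fun
    and lam gam :: "nat \<Rightarrow> real" and \<Lambda> J :: real and I :: int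
  assumes "q absolutely_integrable_on {0<..<pi}"
    and "f \<in> class_R" and "F \<in> class_R" and "ind f + ind F \<ge> -1"
    and "spectral_data q f F lam gam"
    and "\<Lambda> = (if f \<noteq> Infty \<and> F \<noteq> Infty then lam 0 else lam 0 - 2)"
    and "(qh, fh, Fh) = T_hat \<Lambda> (q, f, F)"
    and "I = ind f - ind fh"
    and "J = (real_of_int (ind f) + real_of_int (ind F)) / 2
             - (real_of_int (ind fh) + real_of_int (ind Fh)) / 2"
  shows "qh absolutely_integrable_on {0<..<pi} \<and> fh \<in> class_R \<and> Fh \<in> class_R \<and>
    I = (if ind f \<ge> 0 then 1 else -1) \<and>
    J = (if ind f \<ge> 0 \<and> ind F \<ge> 0 then 1 else 0) \<and>
    spectral_data qh fh Fh
      (\<lambda>n. lam (n + nat \<lfloor>J\<rfloor>))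
      (\<lambda>n. gam (n + nat \<lfloor>J\<rfloor>) / (lam (n + nat \<lfloor>J\<rfloor>) - \<Lambda>) powi I)"
proof -
  interpret P: integrable_potential q by unfold_locales (rule assms(1))
  have nb: "f \<noteq> Infty \<or> F \<noteq> Infty" using assms(4) by auto
  define v where "v = (if f = Infty then psi q F \<Lambda> else phi q f \<Lambda>)"
  define v' where "v' = (if f = Infty then psi_deriv q F \<Lambda> else phi_deriv q f \<Lambda>)"
  note gs = P.ground_state[OF assms(2,3) nb assms(5,6) v_def v'_def]
  have T: "qh = (\<lambda>x. q x - 2 * deriv (\<lambda>t. v' t / v t) x)" "fh = Theta \<Lambda> (- v' 0 / v 0) f"
    "Fh = Theta \<Lambda> (v' pi / v pi) F"
    using assms(7) by (simp_all add: T_hat_def Let_def split_def v_def v'_def phi_def psi_def)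
  have bf: "boundary_transform \<Lambda> (- v' 0 / v 0) f fh \<and> fh \<in> class_R \<and> ind f - ind fh = (if f = Infty then -1 else 1)"
    unfolding T(2) by (rule Theta_boundary_transform[OF assms(2)]) (use gs(3) in auto)
  have bF: "boundary_transform \<Lambda> (v' pi / v pi) F Fh \<and> Fh \<in> class_R \<and> ind F - ind Fh = (if F = Infty then -1 else 1)"
    unfolding T(3) by (rule Theta_boundary_transform[OF assms(3)]) (use gs(4) in auto)
  have D: "darboux q v v' \<Lambda> f F fh Fh"
  proof unfold_locales
    show "v x \<noteq> 0" if "x \<in> {0..pi}" for x using gs(2)[OF that] by simp
  qed (use gs(1) assms(2,3) bf bF nb in auto)
  interpret darboux q v v' \<Lambda> f F fh Fh by (rule D)
  have qh_eq: "qh = darboux.qh q v v'" by (simp add: T(1) darboux.qh_def[OF D] fun_eq_iff)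
  have I: "I = (if f = Infty then -1 else 1)" using assms(8) bf by simp
  have J: "J = (if f \<noteq> Infty \<and> F \<noteq> Infty then 1 else 0)"
  proof -
    have "J = real_of_int ((ind f - ind fh) + (ind F - ind Fh)) / 2" using assms(9) by (simp add: field_simps)
    \<comment> \<open>A finite boundary function loses one index and \<open>Infty\<close> gains one,
      so two finite ones give 2 and a mixed pair gives 0.\<close>
    also have "(ind f - ind fh) + (ind F - ind Fh) = (if f \<noteq> Infty \<and> F \<noteq> Infty then 2 else 0)"
      using bf bF nb by auto
    finally show ?thesis by (cases "f \<noteq> Infty \<and> F \<noteq> Infty") auto
  qed
  have j: "nat \<lfloor>J\<rfloor> = (if f \<noteq> Infty \<and> F \<noteq> Infty then 1 else 0)" by (simp add: J)
  have "spectral_data qh fh Fh (\<lambda>n. lam (n + nat \<lfloor>J\<rfloor>))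
      (\<lambda>n. gam (n + nat \<lfloor>J\<rfloor>) / (lam (n + nat \<lfloor>J\<rfloor>) - \<Lambda>) powi I)"
    unfolding T(1) I by (rule T_hat_spectral[OF D assms(5,6) j])
  moreover have "qh absolutely_integrable_on {0<..<pi}" unfolding qh_eq by (rule qh_int)
  ultimately show ?thesis using bf bF I J by (simp add: ind_nonneg_iff)
qed

end
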